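(* Let $r\geqslant1$ and let $\mathfrak d(r)=\mathfrak{sp}(2r)$ (when $G(N)=O(N)$) or $\mathfrak d(r)=\mathfrak o(2r)$ (when $G(N)=Sp(N)$). The extremal projector $P_{\mathfrak d(r)}$ is divisible on the right by the extremal projector $P_{\mathfrak{sl}(r)}$: $$P_{\mathfrak d(r)}=P_{\mathfrak t}\,P_{\mathfrak{sl}(r)},$$ where $P_{\mathfrak t}$ denotes the ordered product of those factors $P_\beta(c_\beta)$ of $P_{\mathfrak d(r)}$ whose roots $\beta$ belong to $\Delta(\mathfrak t)$ (the trace operators $\mathsf P_{ij}$).
   Context: Let $g_{ab}$ be a non-degenerate $N\times N$ matrix, symmetric when $G(N)=O(N)$ and skew-symmetric when $G(N)=Sp(N)$, with inverse $g^{ab}$. On $\mathbb C[\boldsymbol y]$, $\boldsymbol y=\{y^i_a:a=1,\dots,N,\ i=1,\dots,r\}$, consider (summing over repeated $a,b$) $$\mathsf K^{ij}=-\tfrac1{1+\delta_{ij}}g^{ab}y^i_ay^j_b,\quad \mathsf P_{ij}=\tfrac1{1+\delta_{ij}}g_{ab}\tfrac{\partial}{\partial y^i_a}\tfrac{\partial}{\partial y^j_b},\quad \mathsf H^i{}_j=-\big(\tfrac N2\delta^i_j+y^i_a\tfrac{\partial}{\partial y^j_a}\big).$$ They span the Lie algebra $\mathfrak d(r)$: $\mathfrak{sp}(2r)$ in the symmetric case and $\mathfrak o(2r)$ in the skew-symmetric case (where $\mathsf P_{ii}=\mathsf K^{ii}=0$). The operators $\mathsf H^i{}_j$ span $\mathfrak{gl}(r)\supset\mathfrak{sl}(r)$.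 The Cartan subalgebra $\mathfrak h$ is spanned by the $\mathsf H^i{}_i$; the positive root vectors of $\mathfrak d(r)$ span $\mathfrak g_+=\check{\mathfrak g}_+\oplus\mathfrak t$, where $\check{\mathfrak g}_+$ is spanned by $\mathsf H^i{}_j$, $i<j$ (positive root vectors of $\mathfrak{sl}(r)$), and $\mathfrak t$ is the abelian ideal of $\mathfrak g_+$ spanned by the $\mathsf P_{ij}$, $i\leqslant j$ ($i<j$ in the skew case). $\Delta(\cdot)$ denotes the corresponding set of roots. For a positive root $\beta$, $\mathsf e_\beta$ (resp. $\mathsf e_{-\beta}$) is $\mathsf H^i{}_j$ (resp. $\mathsf H^j{}_i$) with $i<j$, or $\mathsf P_{ij}$ (resp. $\mathsf K^{ij}$), and $\mathsf h_\beta=[\mathsf e_\beta,\mathsf e_{-\beta}]$, so that $[\mathsf h_\beta,\mathsf e_{\pm\beta}]=\pm2\mathsf e_{\pm\beta}$. Put $$P_\beta(c)=\sum_{f\geqslant0}\frac{(-1)^f}{f!}\,\frac1{\prod_{j=1}^f(\mathsf h_\beta+c+j)}\,\mathsf e_{-\beta}^f\,\mathsf e_\beta^f .$$ The extremal projector of $\mathfrak d(r)$ is the ordered product $P_{\mathfrak d(r)}=\prod_{\beta\in\Delta(\mathfrak g_+)}^{\longrightarrow}P_\beta(c_\beta)$ with $c_\beta=\frac12\sum_{\varphi\in\Delta(\mathfrak g_+)}\varphi(\mathsf h_\beta)$, the order of the factors being given by a normal (convex) ordering of the positive roots (whenever a positive root is the sum of two positive roots, it lies between them); the product does not depend on the choice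 of normal ordering. Likewise $P_{\mathfrak{sl}(r)}=\prod_{\beta\in\Delta(\check{\mathfrak g}_+)}^{\longrightarrow}P_\beta(c'_\beta)$ with $c'_\beta=\frac12\sum_{\varphi\in\Delta(\check{\mathfrak g}_+)}\varphi(\mathsf h_\beta)$. These are elements of the standard (Taylor) extension of the universal enveloping algebra of $\mathfrak d(r)$ allowing formal series and denominators in $U(\mathfrak h)$. Normal orderings used here may be taken with all roots of $\mathfrak t$ preceding those of $\check{\mathfrak g}_+$. *)

theory Defs
  imports
    "HOL-Analysis.Determinants"
    "HOL-Library.Poly_Mapping"
    "HOL-Algebra.QuotRing"
begin

section \<open>Polynomials and free associative algebras over the complex numbers\<close>

text \<open>
  A polynomial algebra is the algebra of finitely supported functions on exponent vectors, the
  free associative algebra is the algebra of finitely supported functions on words; the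
  multiplication of \<^typ>\<open>'a \<Rightarrow>\<^sub>0 'b\<close> is convolution, so words need a type on
  which addition is concatenation.
\<close>

datatype 'x fword = FWord (letters: "'x list")

instantiation fword :: (type) monoid_add
begin

definition zero_fword :: "'a fword" where
  "zero_fword = FWord []"

definition plus_fword :: "'a fword \<Rightarrow> 'a fword \<Rightarrow> 'a fword" where
  "plus_fword v w = FWord (letters v @ letters w)"

instance
  by standard (simp_all add: zero_fword_def plus_fword_def)

end

type_synonym 'x free_alg = "'x fword \<Rightarrow>\<^sub>0 complex"

text \<open>The scalar \<open>c\<close> as a constant of the algebra (for polynomials as well as for the free algebra).\<close>

definition cst :: "complex \<Rightarrow> ('k::zero \<Rightarrow>\<^sub>0 complex)" where
  "cst c = Poly_Mapping.single 0 c"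

definition gen :: "'x \<Rightarrow> 'x free_alg" where
  "gen x = Poly_Mapping.single (FWord [x]) 1"

definition free_algebra :: "'x set \<Rightarrow> 'x free_alg ring" where
  "free_algebra S =
     \<lparr>carrier = {u. \<forall>w\<in>Poly_Mapping.keys u. set (letters w) \<subseteq> S},
      mult = (*), one = 1, zero = 0, add = (+)\<rparr>"

section \<open>The Lie algebra of differential operators\<close>

text \<open>
  The variable \<open>y\<^sup>i\<^sub>a\<close> is indexed by the pair \<open>(i, a)\<close>;
  the types \<open>'r\<close> and \<open>'n\<close> have \<open>r\<close> and \<open>N\<close> elements.
\<close>

type_synonym ('r, 'n) ypoly = "(('r \<times> 'n) \<Rightarrow>\<^sub>0 nat) \<Rightarrow>\<^sub>0 complex"
type_synonym ('r, 'n) yop = "('r, 'n) ypoly \<Rightarrow> ('r, 'n) ypoly"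

definition yvar :: "'r \<Rightarrow> 'n \<Rightarrow> ('r, 'n) ypoly" where
  "yvar i a = Poly_Mapping.single (Poly_Mapping.single (i, a) 1) 1"

definition ydiff :: "'r \<Rightarrow> 'n \<Rightarrow> ('r, 'n) yop" where
  "ydiff i a p =
     (\<Sum>m\<in>Poly_Mapping.keys p.
        Poly_Mapping.single (m - Poly_Mapping.single (i, a) 1)
          (of_nat (Poly_Mapping.lookup m (i, a)) * Poly_Mapping.lookup p m))"

definition op_plus :: "('r, 'n) yop \<Rightarrow> ('r, 'n) yop \<Rightarrow> ('r, 'n) yop" where
  "op_plus A B = (\<lambda>p. A p + B p)"

definition op_scale :: "complex \<Rightarrow> ('r, 'n) yop \<Rightarrow> ('r, 'n) yop" where
  "op_scale c A = (\<lambda>p. cst c * A p)"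

definition op_comm :: "('r, 'n) yop \<Rightarrow> ('r, 'n) yop \<Rightarrow> ('r, 'n) yop" where
  "op_comm A B = (\<lambda>p. A (B p) - B (A p))"

definition op_span :: "('r, 'n) yop set \<Rightarrow> ('r, 'n) yop set" where
  "op_span S = {\<lambda>p. \<Sum>A\<in>F. cst (c A) * A p | c F. finite F \<and> F \<subseteq> S}"

text \<open>
  The inverse \<open>g\<^sup>a\<^sup>b\<close> is normalised by
  \<open>g\<^sub>a\<^sub>c g\<^sup>b\<^sup>c = \<delta>\<^sub>a\<^sup>b\<close>. This is the usual inverse for
  symmetric \<open>g\<close>. For skew-symmetric \<open>g\<close> it is the convention under which
  \<open>[h, e] = 2 e\<close> holds for \<open>h = [P\<^sub>i\<^sub>j, K\<^sup>i\<^sup>j]\<close>,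
  \<open>e = P\<^sub>i\<^sub>j\<close>; the opposite one would give \<open>-2 e\<close>.
\<close>

definition inv_form :: "complex^'n^'n \<Rightarrow> complex^'n^'n" where
  "inv_form g = transpose (matrix_inv g)"

definition opK :: "complex^'n^'n \<Rightarrow> 'r \<Rightarrow> 'r \<Rightarrow> ('r, 'n) yop" where
  "opK g i j = (\<lambda>p. cst (- 1 / (1 + of_bool (i = j))) *
     (\<Sum>a\<in>UNIV. \<Sum>b\<in>UNIV. cst (inv_form g $ a $ b) * (yvar i a * (yvar j b * p))))"

definition opP :: "complex^'n^'n \<Rightarrow> 'r \<Rightarrow> 'r \<Rightarrow> ('r, 'n) yop" where
  "opP g i j = (\<lambda>p. cst (1 / (1 + of_bool (i = j))) *
     (\<Sum>a\<in>UNIV. \<Sum>b\<in>UNIV. cst (g $ a $ b) * ydiff i a (ydiff j b p)))"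

definition opH :: "'r \<Rightarrow> 'r \<Rightarrow> ('r, 'n::finite) yop" where
  "opH i j = (\<lambda>p. - (cst (of_nat CARD('n) / 2 * of_bool (i = j)) * p
     + (\<Sum>a\<in>UNIV. yvar i a * ydiff j a p)))"

definition d_alg :: "complex^'n^'n \<Rightarrow> ('r, 'n) yop set" where
  "d_alg g = op_span ({opK g i j | i j. True} \<union> {opP g i j | i j. True} \<union> {opH i j | i j. True})"

definition cartan :: "('r, 'n::finite) yop set" where
  "cartan = op_span {opH i i | i. True}"

section \<open>Positive roots and normal orderings\<close>

text \<open>
  Positive roots are labelled by their root vectors: \<open>RootH i j\<close> by
  \<open>H\<^sup>i\<^sub>j\<close> with \<open>i < j\<close>, and \<open>RootP i j\<close> by
  \<open>P\<^sub>i\<^sub>j\<close> with \<open>i \<le> j\<close> (\<open>i < j\<close> for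
  skew-symmetric \<open>g\<close>). As linear functionals on the Cartan subalgebra they are
  given by \<open>root_val\<close>.
\<close>

datatype 'r pos_root = RootH 'r 'r | RootP 'r 'r

definition sl_roots :: "'r::linorder pos_root set" where
  "sl_roots = {RootH i j | i j. i < j}"

definition t_roots :: "complex^'n^'n \<Rightarrow> 'r::linorder pos_root set" where
  "t_roots g = {RootP i j | i j. i < j \<or> i = j \<and> transpose g = g}"

definition d_roots :: "complex^'n^'n \<Rightarrow> 'r::linorder pos_root set" where
  "d_roots g = sl_roots \<union> t_roots g"

fun root_vec :: "complex^'n^'n \<Rightarrow> 'r pos_root \<Rightarrow> ('r, 'n) yop" where
  "root_vec g (RootH i j) = opH i j"
| "root_vec g (RootP i j) = opP g i j"

fun neg_root_vec :: "complex^'n^'n \<Rightarrow> 'r pos_root \<Rightarrow> ('r, 'n) yop" where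
  "neg_root_vec g (RootH i j) = opH j i"
| "neg_root_vec g (RootP i j) = opK g i j"

definition coroot :: "complex^'n^'n \<Rightarrow> 'r pos_root \<Rightarrow> ('r, 'n) yop" where
  "coroot g \<beta> = op_comm (root_vec g \<beta>) (neg_root_vec g \<beta>)"

definition root_val :: "complex^'n^'n \<Rightarrow> 'r pos_root \<Rightarrow> ('r, 'n) yop \<Rightarrow> complex" where
  "root_val g \<phi> X = (THE c. op_comm X (root_vec g \<phi>) = op_scale c (root_vec g \<phi>))"

definition g_plus :: "complex^'n^'n \<Rightarrow> ('r::linorder, 'n) yop set" where
  "g_plus g = op_span (root_vec g ` d_roots g)"

definition is_root_sum ::
  "complex^'n^'n \<Rightarrow> 'r pos_root \<Rightarrow> 'r pos_root \<Rightarrow> 'r pos_root \<Rightarrow> bool" where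
  "is_root_sum g \<phi> \<beta> \<gamma> \<longleftrightarrow>
     (\<forall>X\<in>cartan. root_val g \<phi> X = root_val g \<beta> X + root_val g \<gamma> X)"

definition normal_ordering ::
  "complex^'n^'n \<Rightarrow> 'r pos_root set \<Rightarrow> 'r pos_root list \<Rightarrow> bool" where
  "normal_ordering g \<Delta> ws \<longleftrightarrow> distinct ws \<and> set ws = \<Delta> \<and>
     (\<forall>i j k. i < length ws \<longrightarrow> j < length ws \<longrightarrow> k < length ws \<longrightarrow>
        is_root_sum g (ws ! k) (ws ! i) (ws ! j) \<longrightarrow> i < k \<and> k < j \<or> j < k \<and> k < i)"

definition t_first_normal_ordering ::
  "complex^'n^'n \<Rightarrow> 'r::linorder pos_root list \<Rightarrow> bool" where
  "t_first_normal_ordering g ws \<longleftrightarrow> normal_ordering g (d_roots g) ws \<and>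
     (\<forall>i j. i < length ws \<longrightarrow> j < length ws \<longrightarrow>
        ws ! i \<in> t_roots g \<longrightarrow> ws ! j \<in> sl_roots \<longrightarrow> i < j)"

section \<open>The Taylor extension of the universal enveloping algebra\<close>

subsection \<open>The enveloping algebra and its localisation\<close>

text \<open>
  For a Lie algebra \<open>L\<close> of operators with Cartan subalgebra \<open>C\<close>, the
  enveloping algebra \<open>U(L)\<close> is the free algebra on the set \<open>L\<close> modulo
  \<open>env_ideal L\<close>. Its localisation \<open>U'(L)\<close> adjoins a two-sided inverse
  \<open>Inv u\<close> of every nonzero element \<open>u\<close> of \<open>U(C)\<close>; it is the
  free algebra on \<open>loc_letters L C\<close> modulo \<open>loc_ideal L C\<close>. Elements are
  handled through representatives in the free algebras.
\<close>

definition env_rels :: "('r, 'n) yop set \<Rightarrow> ('r, 'n) yop free_alg set" where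
  "env_rels L =
     {gen (op_plus A B) - gen A - gen B | A B. A \<in> L \<and> B \<in> L} \<union>
     {gen (op_scale c A) - cst c * gen A | c A. A \<in> L} \<union>
     {gen A * gen B - gen B * gen A - gen (op_comm A B) | A B. A \<in> L \<and> B \<in> L}"

definition env_ideal :: "('r, 'n) yop set \<Rightarrow> ('r, 'n) yop free_alg set" where
  "env_ideal L = Idl\<^bsub>free_algebra L\<^esub> (env_rels L)"

definition denominators ::
  "('r, 'n) yop set \<Rightarrow> ('r, 'n) yop set \<Rightarrow> ('r, 'n) yop free_alg set" where
  "denominators L C = {u \<in> carrier (free_algebra C). u \<notin> env_ideal L}"

datatype 'x loc_letter = Elt 'x | Inv "'x free_alg"

definition emb :: "'x free_alg \<Rightarrow> 'x loc_letter free_alg" where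
  "emb u = (\<Sum>w\<in>Poly_Mapping.keys u.
     Poly_Mapping.single (FWord (map Elt (letters w))) (Poly_Mapping.lookup u w))"

definition loc_letters ::
  "('r, 'n) yop set \<Rightarrow> ('r, 'n) yop set \<Rightarrow> ('r, 'n) yop loc_letter set" where
  "loc_letters L C = Elt ` L \<union> Inv ` denominators L C"

definition loc_rels ::
  "('r, 'n) yop set \<Rightarrow> ('r, 'n) yop set \<Rightarrow> ('r, 'n) yop loc_letter free_alg set" where
  "loc_rels L C = emb ` env_rels L \<union>
     {gen (Inv u) * emb u - 1 | u. u \<in> denominators L C} \<union>
     {emb u * gen (Inv u) - 1 | u. u \<in> denominators L C}"

definition loc_algebra ::
  "('r, 'n) yop set \<Rightarrow> ('r, 'n) yop set \<Rightarrow> ('r, 'n) yop loc_letter free_alg ring" where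
  "loc_algebra L C = free_algebra (loc_letters L C)"

definition loc_ideal ::
  "('r, 'n) yop set \<Rightarrow> ('r, 'n) yop set \<Rightarrow> ('r, 'n) yop loc_letter free_alg set" where
  "loc_ideal L C = Idl\<^bsub>loc_algebra L C\<^esub> (loc_rels L C)"

subsection \<open>Completion\<close>

text \<open>
  The component of weight \<open>\<mu>\<close> of the Taylor extension consists of the formal series of
  elements of \<open>U'(L)\<close> of weight \<open>\<mu>\<close>, in which only finitely many
  terms lie outside the left ideal \<open>U'(L) n\<^sup>m\<close> for each \<open>m\<close>, where
  \<open>n\<close> is spanned by the positive root vectors; the Taylor extension is the direct sum of
  these components. Such a series is given by its sequence of partial sums: the extension is the
  ring of Cauchy sequences for the filtration by \<open>U'(L) n\<^sup>m\<close>, whose terms have their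
  weights in a common finite set, modulo null sequences.
\<close>

definition weight_space ::
  "('r, 'n) yop set \<Rightarrow> ('r, 'n) yop set \<Rightarrow> (('r, 'n) yop \<Rightarrow> complex) \<Rightarrow>
     ('r, 'n) yop loc_letter free_alg set" where
  "weight_space L C \<mu> = {u \<in> carrier (loc_algebra L C).
     \<forall>X\<in>C. gen (Elt X) * u - u * gen (Elt X) - cst (\<mu> X) * u \<in> loc_ideal L C}"

text \<open>Representatives of the elements of \<open>U'(L) n\<^sup>m\<close>.\<close>

definition left_ideal_pow ::
  "('r, 'n) yop set \<Rightarrow> ('r, 'n) yop set \<Rightarrow> ('r, 'n) yop set \<Rightarrow> nat \<Rightarrow>
     ('r, 'n) yop loc_letter free_alg set" where
  "left_ideal_pow L C n m =
     {(\<Sum>i<l. a i * prod_list (map (\<lambda>X. gen (Elt X)) (w i))) + z | (l::nat) a w z.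
        (\<forall>i<l. a i \<in> carrier (loc_algebra L C) \<and> set (w i) \<subseteq> n \<and> length (w i) = m)
        \<and> z \<in> loc_ideal L C}"

definition taylor_seqs ::
  "('r, 'n) yop set \<Rightarrow> ('r, 'n) yop set \<Rightarrow> ('r, 'n) yop set \<Rightarrow>
     (nat \<Rightarrow> ('r, 'n) yop loc_letter free_alg) ring" where
  "taylor_seqs L C n =
     \<lparr>carrier = {x. (\<forall>k. x k \<in> carrier (loc_algebra L C)) \<and>
        (\<exists>W. finite W \<and>
          (\<forall>k. \<exists>v. (\<forall>\<mu>\<in>W. v \<mu> \<in> weight_space L C \<mu>) \<and> x k = (\<Sum>\<mu>\<in>W. v \<mu>))) \<and>
        (\<forall>m. \<exists>k0. \<forall>k\<ge>k0. \<forall>l\<ge>k0. x k - x l \<in> left_ideal_pow L C n m)},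
      mult = (\<lambda>x y k. x k * y k), one = (\<lambda>k. 1),
      zero = (\<lambda>k. 0), add = (\<lambda>x y k. x k + y k)\<rparr>"

definition null_seqs ::
  "('r, 'n) yop set \<Rightarrow> ('r, 'n) yop set \<Rightarrow> ('r, 'n) yop set \<Rightarrow>
     (nat \<Rightarrow> ('r, 'n) yop loc_letter free_alg) set" where
  "null_seqs L C n = {x \<in> carrier (taylor_seqs L C n).
     \<forall>m. \<exists>k0. \<forall>k\<ge>k0. x k \<in> left_ideal_pow L C n m}"

type_synonym ('r, 'n) taylor_elem = "(nat \<Rightarrow> ('r, 'n) yop loc_letter free_alg) set"

definition taylor_ext ::
  "('r, 'n) yop set \<Rightarrow> ('r, 'n) yop set \<Rightarrow> ('r, 'n) yop set \<Rightarrow> ('r, 'n) taylor_elem ring" where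
  "taylor_ext L C n = taylor_seqs L C n Quot null_seqs L C n"

definition taylor_d :: "complex^'n^'n \<Rightarrow> ('r::linorder, 'n) taylor_elem ring" where
  "taylor_d g = taylor_ext (d_alg g) cartan (g_plus g)"

section \<open>Extremal projectors\<close>

definition proj_partial_sum ::
  "complex^'n^'n \<Rightarrow> 'r pos_root \<Rightarrow> complex \<Rightarrow> nat \<Rightarrow> ('r, 'n) yop loc_letter free_alg" where
  "proj_partial_sum g \<beta> c k =
     (\<Sum>f<k. cst ((- 1) ^ f / fact f)
        * gen (Inv (prod_list (map (\<lambda>j. gen (coroot g \<beta>) + cst (c + of_nat j)) [1..<Suc f])))
        * gen (Elt (neg_root_vec g \<beta>)) ^ f * gen (Elt (root_vec g \<beta>)) ^ f)"

definition proj_factor ::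
  "complex^'n^'n \<Rightarrow> 'r::linorder pos_root \<Rightarrow> complex \<Rightarrow> ('r, 'n) taylor_elem" where
  "proj_factor g \<beta> c =
     null_seqs (d_alg g) cartan (g_plus g)
       +>\<^bsub>taylor_seqs (d_alg g) cartan (g_plus g)\<^esub> proj_partial_sum g \<beta> c"

text \<open>The shift attached to a set \<open>\<Delta>\<close> of positive roots: half the sum of their values on the coroot.\<close>

definition rho_shift :: "complex^'n^'n \<Rightarrow> 'r pos_root set \<Rightarrow> 'r pos_root \<Rightarrow> complex" where
  "rho_shift g \<Delta> \<beta> = (1 / 2) * (\<Sum>\<phi>\<in>\<Delta>. root_val g \<phi> (coroot g \<beta>))"

definition ordered_proj_prod ::
  "complex^'n^'n \<Rightarrow> ('r::linorder pos_root \<Rightarrow> complex) \<Rightarrow> 'r pos_root list \<Rightarrow> ('r, 'n) taylor_elem" where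
  "ordered_proj_prod g c ws =
     foldr (\<lambda>\<beta> x. proj_factor g \<beta> (c \<beta>) \<otimes>\<^bsub>taylor_d g\<^esub> x) ws \<one>\<^bsub>taylor_d g\<^esub>"

text \<open>
  The projectors computed along a given ordering of the roots. The first argument of
  \<open>proj_d\<close> should be a normal ordering of \<open>d_roots g\<close>, that of \<open>proj_sl\<close> a normal
  ordering of \<open>sl_roots\<close>; \<open>proj_sl\<close> is taken inside the Taylor extension for
  the larger algebra, where the factorisation takes place.
\<close>

definition proj_d :: "complex^'n^'n \<Rightarrow> 'r::linorder pos_root list \<Rightarrow> ('r, 'n) taylor_elem" where
  "proj_d g ws = ordered_proj_prod g (rho_shift g (d_roots g)) ws"

definition proj_sl :: "complex^'n^'n \<Rightarrow> 'r::linorder pos_root list \<Rightarrow> ('r, 'n) taylor_elem" where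
  "proj_sl g ws = ordered_proj_prod g (rho_shift g sl_roots) ws"

definition proj_t :: "complex^'n^'n \<Rightarrow> 'r::linorder pos_root list \<Rightarrow> ('r, 'n) taylor_elem" where
  "proj_t g ws =
     ordered_proj_prod g (rho_shift g (d_roots g)) (filter (\<lambda>\<beta>. \<beta> \<in> t_roots g) ws)"

end

theory Submission
  imports Defs
begin

text \<open>
  In an ordering with the roots of \<open>t\<close> first, the projector is the product of the factors for \<open>t\<close> and
  the factors for \<open>sl\<close>; what has to be seen is that the latter are the factors of the projector of \<open>sl\<close>,
  that is, that the two shifts agree. The weights of \<open>t\<close> are permuted by the symmetric group, so
  they sum to a multiple of the trace, which vanishes on the coroots of \<open>sl\<close>.

  Regrouping the product requires that cosets of Cauchy sequences multiply well. Right multiplication by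
  a letter of the Lie algebra is continuous for the filtration by the left ideals because iterated brackets
  with positive root vectors raise a bounded height; right multiplication by an inverse denominator is
  continuous because root vectors move past it at the price of a shift. The shifted denominators are
  nonzero in the enveloping algebra since they act on powers of a single variable by nonzero scalars.
\<close>

text \<open>The spaces \<open>U'(L) n^m\<close> are left ideals only, so there is no formal reason
  why a null sequence times a representative of a factor should again be null; a product of cosets
  might depend on the representatives. This is why the proof works with sequences of weight zero
  whose terms are continuous as right multipliers: their cosets multiply termwise, and the
  regrouping takes place in the free algebra, where associativity is plain. Pushing an inverse
  denominator past root vectors changes its constant, so every constant has to be admissible, not
  only the one in the projector. That an element lies outside \<open>env_ideal\<close> is seen from
  the action on polynomials: the kernel of this action is an ideal containing the relations, while a
  denominator has an eigenvector with non-zero eigenvalue. The brackets of the generators serve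
  three ends: closure of \<open>d_alg g\<close>, which keeps the relations inside the carrier where
  their ideal is generated; the height filtration; and the coroots. A sign \<epsilon> with
  \<open>g $ b $ a = \<epsilon> * g $ a $ b\<close> covers both types of form at once.\<close>

section \<open>Additive induction and scalars\<close>

text \<open>Reduces identities that are additive in a polynomial or free algebra element to
  monomials; zero is the monomial with coefficient 0.\<close>

lemma poly_mapping_additive_induct [case_names single add]:
  assumes "\<And>k c. P (Poly_Mapping.single k c)" and "\<And>p q. P p \<Longrightarrow> P q \<Longrightarrow> P (p + q)"
  shows "P (p :: 'a \<Rightarrow>\<^sub>0 'b::comm_monoid_add)"
proof (induction p rule: update_induct)
  case const
  show ?case using assms(1)[of undefined 0] by simp
next
  case (update p k c)
  have "Poly_Mapping.update k c p = p + Poly_Mapping.single k c"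
    using update(1) by (intro poly_mapping_eqI) (auto simp: lookup_update lookup_add lookup_single when_def in_keys_iff)
  then show ?case using update assms by simp
qed

lemma cst_simps [simp]:
  "cst 0 = 0" "cst 1 = 1" "cst (- a) = - cst a"
  by (simp_all add: cst_def single_uminus)

lemma cst_plus: "cst (a + b) = cst a + cst b"
  by (simp add: cst_def single_add)

lemma cst_diff: "cst (a - b) = cst a - cst b"
  by (simp add: cst_def single_diff)

lemma cst_mult: "cst (a * b) = cst a * (cst b :: 'k::monoid_add \<Rightarrow>\<^sub>0 complex)"
  by (simp add: cst_def mult_single)

lemma cst_mult_assoc: "cst a * (cst b * p) = cst (a * b) * (p :: 'k::monoid_add \<Rightarrow>\<^sub>0 complex)"
  by (simp add: cst_mult mult.assoc)

lemma cst_sum: "cst (sum f A) = (\<Sum>x\<in>A. cst (f x))"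
  by (induction A rule: infinite_finite_induct) (simp_all add: cst_plus)

lemma cst_of_bool: "cst (of_bool b) = (of_bool b :: 'k::monoid_add \<Rightarrow>\<^sub>0 complex)"
  by simp

section \<open>Brackets of the differential operators\<close>

text \<open>The type \<open>yop\<close> contains all functions on polynomials, so linearity is
  carried along as a predicate; brackets and products of words behave well only on linear
  operators.\<close>

definition op_linear :: "('r, 'n) yop \<Rightarrow> bool" where
  "op_linear A \<longleftrightarrow> (\<forall>p q. A (p + q) = A p + A q) \<and> (\<forall>c p. A (cst c * p) = cst c * A p)"

lemma op_linear_0: "op_linear A \<Longrightarrow> A 0 = 0"
  unfolding op_linear_def by (metis add_cancel_right_left)

lemma op_linear_add: "op_linear A \<Longrightarrow> A (p + q) = A p + A q"
  and op_linear_scale: "op_linear A \<Longrightarrow> A (cst c * p) = cst c * A p"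
  unfolding op_linear_def by auto

lemma op_linear_minus: "op_linear A \<Longrightarrow> A (- p) = - A p"
  using op_linear_scale[of A "-1" p] by simp

lemma op_linear_diff: "op_linear A \<Longrightarrow> A (p - q) = A p - A q"
  using op_linear_add[of A p "-q"] by (simp add: op_linear_minus)

lemma op_linear_sum: "op_linear A \<Longrightarrow> A (sum f S) = (\<Sum>x\<in>S. A (f x))"
  by (induction S rule: infinite_finite_induct) (simp_all add: op_linear_0 op_linear_add)

lemma ydiff_single:
  "ydiff i a (Poly_Mapping.single m c) =
     Poly_Mapping.single (m - Poly_Mapping.single (i, a) 1) (of_nat (Poly_Mapping.lookup m (i, a)) * c)"
  by (simp add: ydiff_def)

lemma ydiff_add: "ydiff i a (p + q) = ydiff i a p + ydiff i a q"
  unfolding ydiff_def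
  by (rule setsum_keys_plus_distrib) (simp_all add: distrib_left single_add)

lemma ydiff_linear: "op_linear (ydiff i a)"
proof -
  have "ydiff i a (cst c * p) = cst c * ydiff i a p" for c p
    by (induction p rule: poly_mapping_additive_induct)
      (simp_all add: cst_def mult_single ydiff_single ydiff_add distrib_left mult.left_commute)
  then show ?thesis by (simp add: op_linear_def ydiff_add)
qed

text \<open>The Leibniz rule for a variable, that is, the defining relation of the Weyl
  algebra.\<close>

lemma ydiff_yvar:
  fixes p :: "('a, 'b) ypoly"
  shows "ydiff i a (yvar j b * p) = of_bool (i = j \<and> a = b) * p + yvar j b * ydiff i a p"
proof (induction p rule: poly_mapping_additive_induct)
  case (single m c)
  define e where "e = (\<lambda>x::'a \<times> 'b. Poly_Mapping.single x (1::nat))"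
  show ?case
  proof (cases "(i, a) = (j, b)")
    case True
    show ?thesis
    \<comment> \<open>Subtraction of exponents is truncated: lowering and raising again restores
      \<open>m\<close> only for a positive exponent, and for exponent 0 the derivative has
      coefficient 0 anyway.\<close>
    proof (cases "Poly_Mapping.lookup m (i, a) = 0")
      case True
      then show ?thesis using \<open>(i, a) = (j, b)\<close>
        by (simp add: yvar_def mult_single ydiff_single lookup_add)
    next
      case False
      have "e (i, a) + (m - e (i, a)) = m"
        using False by (intro poly_mapping_eqI)
          (auto simp: e_def lookup_add lookup_minus lookup_single when_def)
      then show ?thesis using True unfolding e_def
        by (simp add: yvar_def mult_single ydiff_single lookup_add single_add[symmetric] algebra_simps)
    qed
  next
    case False
    have "e (j, b) + m - e (i, a) = e (j, b) + (m - e (i, a))"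
      using False by (intro poly_mapping_eqI)
        (auto simp: e_def lookup_add lookup_minus lookup_single when_def)
    then show ?thesis using False unfolding e_def
      by (auto simp: yvar_def mult_single ydiff_single lookup_add lookup_single when_def)
  qed
next
  case (add p q)
  then show ?case by (simp add: ydiff_add algebra_simps)
qed

lemma ydiff_commute: "ydiff i a (ydiff j b p) = ydiff j b (ydiff i a p)"
proof (induction p rule: poly_mapping_additive_induct)
  case (single m c)
  have "m - x - y = m - y - x" for x y by (intro poly_mapping_eqI) (simp add: lookup_minus)
  then show ?case
    by (cases "(i, a) = (j, b)") (auto simp: ydiff_single lookup_minus lookup_single when_def mult_ac)
next
  case (add p q)
  then show ?case by (simp add: ydiff_add)
qed

text \<open>The polarisation operators of gl(r). Together with \<open>rawP\<close> and
  \<open>rawK\<close> they are the generators stripped of the constant N/2 and of the factors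
  1/(1+delta), so that bracket formulas need no distinction between equal and different
  indices.\<close>

definition yE :: "'r \<Rightarrow> 'r \<Rightarrow> ('r, 'n::finite) yop" where
  "yE i j p = (\<Sum>a\<in>UNIV. yvar i a * ydiff j a p)"

definition rawP :: "complex^'n^'n \<Rightarrow> 'r \<Rightarrow> 'r \<Rightarrow> ('r, 'n) yop" where
  "rawP g i j p = (\<Sum>a\<in>UNIV. \<Sum>b\<in>UNIV. cst (g $ a $ b) * ydiff i a (ydiff j b p))"

definition rawK :: "complex^'n^'n \<Rightarrow> 'r \<Rightarrow> 'r \<Rightarrow> ('r, 'n) yop" where
  "rawK g i j p = (\<Sum>a\<in>UNIV. \<Sum>b\<in>UNIV. cst (inv_form g $ a $ b) * (yvar i a * (yvar j b * p)))"

lemma opP_raw: "opP g i j p = cst (1 / (1 + of_bool (i = j))) * rawP g i j p"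
  by (simp add: opP_def rawP_def)

lemma opK_raw: "opK g i j p = cst (- 1 / (1 + of_bool (i = j))) * rawK g i j p"
  by (simp add: opK_def rawK_def)

lemma opH_yE: "opH i j p = - (cst (of_nat CARD('n) / 2 * of_bool (i = j)) * p + yE i j p)"
  for p :: "('r, 'n::finite) ypoly"
  by (simp add: opH_def yE_def)

lemma yE_linear: "op_linear (yE i j)"
  by (simp add: op_linear_def yE_def op_linear_add[OF ydiff_linear] op_linear_scale[OF ydiff_linear]
      distrib_left sum.distrib sum_distrib_left mult.left_commute)

lemma rawP_linear: "op_linear (rawP g i j)"
  by (simp add: op_linear_def rawP_def op_linear_add[OF ydiff_linear] op_linear_scale[OF ydiff_linear]
      distrib_left sum.distrib sum_distrib_left mult.left_commute)

lemma rawK_linear: "op_linear (rawK g i j)"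
  by (simp add: op_linear_def rawK_def distrib_left sum.distrib sum_distrib_left mult.left_commute)

lemma opH_linear: "op_linear (opH i j)"
  by (simp add: op_linear_def opH_yE op_linear_add[OF yE_linear] op_linear_scale[OF yE_linear] distrib_left
      right_diff_distrib mult.left_commute)

lemma opP_linear: "op_linear (opP g i j)"
  by (simp add: op_linear_def opP_raw op_linear_add[OF rawP_linear] op_linear_scale[OF rawP_linear] distrib_left mult.left_commute)

lemma opK_linear: "op_linear (opK g i j)"
  by (simp add: op_linear_def opK_raw op_linear_add[OF rawK_linear] op_linear_scale[OF rawK_linear] distrib_left mult.left_commute)

lemma yE_yvar: "yE i j (yvar k b * p) = yvar k b * yE i j p + of_bool (j = k) * (yvar i b * p)"
proof -
  have "yE i j (yvar k b * p) =
      (\<Sum>a\<in>UNIV. (if a = b then of_bool (j = k) * (yvar i b * p) else 0) + yvar k b * (yvar i a * ydiff j a p))"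
    unfolding yE_def by (rule sum.cong) (auto simp: ydiff_yvar distrib_left mult.left_commute)
  then show ?thesis by (simp add: sum.distrib yE_def sum_distrib_left)
qed

lemma yE_ydiff: "yE i j (ydiff k b p) = ydiff k b (yE i j p) - of_bool (i = k) * ydiff j b p"
proof -
  have "ydiff k b (yE i j p) =
      (\<Sum>a\<in>UNIV. (if a = b then of_bool (i = k) * ydiff j b p else 0) + yvar i a * ydiff j a (ydiff k b p))"
    unfolding yE_def op_linear_sum[OF ydiff_linear]
    by (rule sum.cong) (auto simp: ydiff_yvar ydiff_commute[of k b])
  then show ?thesis by (simp add: sum.distrib yE_def)
qed

lemma yE_yE: "yE i j (yE k l p) = yE k l (yE i j p) + of_bool (j = k) * yE i l p - of_bool (i = l) * yE k j p"
proof -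
  have "yE i j (yE k l p) = (\<Sum>b\<in>UNIV. yE i j (yvar k b * ydiff l b p))"
    by (subst (2) yE_def) (rule op_linear_sum[OF yE_linear])
  also have "\<dots> = (\<Sum>b\<in>UNIV. yvar k b * ydiff l b (yE i j p)
      + of_bool (j = k) * (yvar i b * ydiff l b p) - of_bool (i = l) * (yvar k b * ydiff j b p))"
    by (rule sum.cong) (auto simp: yE_yvar yE_ydiff algebra_simps)
  finally show ?thesis by (simp add: sum.distrib sum_subtractf yE_def sum_distrib_left)
qed

lemma yE_rawP:
  "yE i j (rawP g k l p) = rawP g k l (yE i j p) - of_bool (i = k) * rawP g j l p - of_bool (i = l) * rawP g k j p"
  by (simp add: rawP_def op_linear_sum[OF yE_linear] op_linear_scale[OF yE_linear] yE_ydiff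
      op_linear_diff[OF ydiff_linear] op_linear_0[OF ydiff_linear] algebra_simps sum_subtractf sum.distrib)

lemma yE_rawK:
  "yE i j (rawK g k l p) = rawK g k l (yE i j p) + of_bool (j = k) * rawK g i l p + of_bool (j = l) * rawK g k i p"
  by (simp add: rawK_def op_linear_sum[OF yE_linear] op_linear_scale[OF yE_linear] yE_yvar
      distrib_left sum.distrib mult.left_commute)

lemma rawP_rawP: "rawP g i j (rawP h k l p) = rawP h k l (rawP g i j p)"
proof -
  have "rawP h k l (ydiff i a q) = ydiff i a (rawP h k l q)" for i a q
    by (simp add: rawP_def op_linear_sum[OF ydiff_linear] op_linear_scale[OF ydiff_linear] ydiff_commute)
  then show ?thesis
    by (simp add: rawP_def[of g] op_linear_sum[OF rawP_linear] op_linear_scale[OF rawP_linear])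
qed

lemma rawK_rawK: "rawK g i j (rawK h k l p) = rawK h k l (rawK g i j p)"
proof -
  have "rawK h k l (q * p) = q * rawK h k l p" for q p
    by (simp add: rawK_def sum_distrib_left mult_ac)
  then show ?thesis
    by (simp add: rawK_def[of g] op_linear_sum[OF rawK_linear])
qed

section \<open>The invariant form and the commutator of second derivatives with quadratic
  polynomials\<close>

locale nondegenerate_form =
  fixes g :: "complex^'n^'n" and \<epsilon> :: complex
  assumes invertible: "invertible g"
    and sign: "\<epsilon> = 1 \<or> \<epsilon> = - 1"
    and sym: "g $ b $ a = \<epsilon> * g $ a $ b"
begin

lemma sign_square [simp]: "\<epsilon> * \<epsilon> = 1"
  using sign by auto

lemma matrix_inv_right_eq: "g ** matrix_inv g = mat 1"
  and matrix_inv_left_eq: "matrix_inv g ** g = mat 1"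
  using someI_ex[of "\<lambda>h. g ** h = mat 1 \<and> h ** g = mat 1"] invertible
  by (simp_all add: matrix_inv_def invertible_def)

lemma inv_form_right: "(\<Sum>b\<in>UNIV. g $ a $ b * inv_form g $ d $ b) = of_bool (a = d)"
  using arg_cong[OF matrix_inv_right_eq, of "\<lambda>m. m $ a $ d"]
  by (simp add: inv_form_def transpose_def matrix_matrix_mult_def mat_def)

lemma inv_form_left: "(\<Sum>a\<in>UNIV. g $ a $ b * inv_form g $ a $ d) = of_bool (b = d)"
  using arg_cong[OF matrix_inv_left_eq, of "\<lambda>m. m $ d $ b"]
  by (auto simp: inv_form_def transpose_def matrix_matrix_mult_def mat_def mult.commute)

text \<open>Uniqueness of inverses: a Kronecker delta is inserted as the product of \<open>g\<close>
  with its inverse on one side, using \<open>sym\<close>, and the inversion relation on the other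
  side contracts the remaining pair.\<close>

lemma inv_form_sym: "inv_form g $ b $ a = \<epsilon> * inv_form g $ a $ b"
proof -
  let ?G = "inv_form g"
  have 1: "(\<Sum>c\<in>UNIV. \<epsilon> * g $ d $ c * ?G $ c $ a) = of_bool (d = a)" for d
  proof -
    have "g $ c $ d = \<epsilon> * g $ d $ c" for c by (rule sym)
    then show ?thesis using inv_form_left[of d a] by simp
  qed
  have "?G $ a $ b = (\<Sum>d\<in>UNIV. if d = a then ?G $ d $ b else 0)"
    by (subst sum.delta) auto
  also have "\<dots> = (\<Sum>d\<in>UNIV. of_bool (d = a) * ?G $ d $ b)"
    by (intro sum.cong) auto
  also have "\<dots> = (\<Sum>d\<in>UNIV. (\<Sum>c\<in>UNIV. \<epsilon> * g $ d $ c * ?G $ c $ a) * ?G $ d $ b)"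
    by (simp only: 1)
  also have "\<dots> = (\<Sum>d\<in>UNIV. \<Sum>c\<in>UNIV. \<epsilon> * ?G $ c $ a * (g $ d $ c * ?G $ d $ b))"
    by (simp add: sum_distrib_left sum_distrib_right mult_ac)
  also have "\<dots> = (\<Sum>c\<in>UNIV. \<Sum>d\<in>UNIV. \<epsilon> * ?G $ c $ a * (g $ d $ c * ?G $ d $ b))"
    by (rule sum.swap)
  also have "\<dots> = (\<Sum>c\<in>UNIV. if c = b then \<epsilon> * ?G $ c $ a else 0)"
    by (intro sum.cong refl) (simp add: inv_form_left flip: sum_distrib_left)
  also have "\<dots> = \<epsilon> * ?G $ b $ a"
    by (subst sum.delta) auto
  finally have "?G $ a $ b = \<epsilon> * ?G $ b $ a" .
  then have "\<epsilon> * ?G $ a $ b = \<epsilon> * \<epsilon> * ?G $ b $ a" by (simp only: mult.assoc)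
  then show ?thesis by simp
qed

text \<open>The variable with its index raised by the inverse form. Contraction with
  \<open>g\<close> lowers it again, with a factor \<epsilon> if the second slot is used.\<close>

definition dualvar :: "'r \<Rightarrow> 'n \<Rightarrow> ('r, 'n) ypoly" where
  "dualvar l b = (\<Sum>d\<in>UNIV. cst (inv_form g $ b $ d) * yvar l d)"

lemma ydiff_dualvar: "ydiff i a (dualvar l b * p) =
    dualvar l b * ydiff i a p + of_bool (i = l) * (cst (inv_form g $ b $ a) * p)"
proof -
  have "ydiff i a (dualvar l b * p) = (\<Sum>d\<in>UNIV. ydiff i a (cst (inv_form g $ b $ d) * (yvar l d * p)))"
    by (simp add: dualvar_def sum_distrib_right op_linear_sum[OF ydiff_linear] mult.assoc)
  also have "\<dots> = (\<Sum>d\<in>UNIV. cst (inv_form g $ b $ d) * yvar l d * ydiff i a p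
      + (if d = a then of_bool (i = l) * (cst (inv_form g $ b $ a) * p) else 0))"
    by (intro sum.cong) (auto simp: op_linear_scale[OF ydiff_linear] ydiff_yvar distrib_left mult.left_commute mult.assoc)
  finally show ?thesis by (simp add: sum.distrib dualvar_def sum_distrib_right)
qed

text \<open>The derivative hits either of the two variables; hitting the second one leaves the
  inverse form with its indices in the wrong order, whence \<epsilon>.\<close>

lemma ydiff_rawK: "ydiff j b (rawK g k l p) = rawK g k l (ydiff j b p)
    + of_bool (j = k) * (dualvar l b * p) + of_bool (j = l) * (cst \<epsilon> * (dualvar k b * p))"
proof -
  have "rawK g k l q = (\<Sum>c\<in>UNIV. yvar k c * (dualvar l c * q))" for q
    by (simp add: rawK_def dualvar_def sum_distrib_left sum_distrib_right mult_ac)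
  then have "ydiff j b (rawK g k l p) = (\<Sum>c\<in>UNIV. ydiff j b (yvar k c * (dualvar l c * p)))"
    by (simp add: op_linear_sum[OF ydiff_linear])
  also have "\<dots> = (\<Sum>c\<in>UNIV. (if c = b then of_bool (j = k) * (dualvar l c * p) else 0)
      + yvar k c * (dualvar l c * ydiff j b p)
      + of_bool (j = l) * (cst (inv_form g $ c $ b) * yvar k c * p))"
    by (intro sum.cong) (auto simp: ydiff_yvar ydiff_dualvar distrib_left mult.left_commute mult.assoc)
  also have "\<dots> = of_bool (j = k) * (dualvar l b * p) + rawK g k l (ydiff j b p)
      + of_bool (j = l) * ((\<Sum>c\<in>UNIV. cst (inv_form g $ c $ b) * yvar k c) * p)"
    by (simp add: sum.distrib sum_distrib_left sum_distrib_right mult.assoc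
        \<open>\<And>q. rawK g k l q = (\<Sum>c\<in>UNIV. yvar k c * (dualvar l c * q))\<close>)
  also have "(\<Sum>c\<in>UNIV. cst (inv_form g $ c $ b) * yvar k c) = cst \<epsilon> * dualvar k b"
  proof -
    have "inv_form g $ c $ b = \<epsilon> * inv_form g $ b $ c" for c by (rule inv_form_sym)
    then show ?thesis by (simp add: dualvar_def sum_distrib_left cst_mult mult.assoc)
  qed
  finally show ?thesis by (simp add: algebra_simps)
qed

lemma form_dualvar_left: "(\<Sum>a\<in>UNIV. cst (g $ a $ b) * dualvar l a) = yvar l b"
proof -
  have "(\<Sum>a\<in>UNIV. cst (g $ a $ b) * dualvar l a) =
      (\<Sum>d\<in>UNIV. (\<Sum>a\<in>UNIV. cst (g $ a $ b * inv_form g $ a $ d)) * yvar l d)"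
    unfolding dualvar_def sum_distrib_left sum_distrib_right cst_mult mult.assoc by (rule sum.swap)
  also have "\<dots> = (\<Sum>d\<in>UNIV. if d = b then yvar l d else 0)"
    by (intro sum.cong refl) (simp add: inv_form_left flip: cst_sum)
  finally show ?thesis by simp
qed

lemma form_dualvar_right: "(\<Sum>b\<in>UNIV. cst (g $ a $ b) * dualvar l b) = cst \<epsilon> * yvar l a"
proof -
  have "g $ a $ b = \<epsilon> * g $ b $ a" for b by (rule sym)
  then have "(\<Sum>b\<in>UNIV. cst (g $ a $ b) * dualvar l b) = cst \<epsilon> * (\<Sum>b\<in>UNIV. cst (g $ b $ a) * dualvar l b)"
    by (simp add: sum_distrib_left cst_mult mult.assoc)
  then show ?thesis by (simp add: form_dualvar_left)
qed

lemma form_trace: "(\<Sum>a\<in>UNIV. \<Sum>b\<in>UNIV. g $ a $ b * inv_form g $ b $ a) = \<epsilon> * of_nat CARD('n)"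
proof -
  have "g $ a $ b * inv_form g $ b $ a = \<epsilon> * (g $ a $ b * inv_form g $ a $ b)" for a b
    by (subst inv_form_sym) simp
  then have "(\<Sum>a\<in>UNIV. \<Sum>b\<in>UNIV. g $ a $ b * inv_form g $ b $ a) =
      (\<Sum>a\<in>UNIV. \<epsilon> * (\<Sum>b\<in>UNIV. g $ a $ b * inv_form g $ a $ b))"
    by (simp only: sum_distrib_left)
  then show ?thesis by (simp add: inv_form_right)
qed

text \<open>Of the two derivatives none, one or both hit the quadratic polynomial. One hit gives the
  four \<open>yE\<close> terms after contraction with \<open>g\<close>; two hits give the trace of
  \<open>g\<close> against its inverse, hence a multiple of N, which the constant N/2 in
  \<open>opH\<close> later absorbs.\<close>

lemma rawP_rawK: "rawP g i j (rawK g k l p) = rawK g k l (rawP g i j p)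
    + of_bool (i = k) * yE l j p + of_bool (i = l) * (cst \<epsilon> * yE k j p)
    + of_bool (j = k) * (cst \<epsilon> * yE l i p) + of_bool (j = l) * yE k i p
    + cst (of_nat CARD('n) * (of_bool (i = k \<and> j = l) + \<epsilon> * of_bool (i = l \<and> j = k))) * p"
proof -
  let ?D = "\<lambda>i a j b. ydiff i a (ydiff j b p)"
  have D: "ydiff i a (ydiff j b (rawK g k l p)) = rawK g k l (?D i a j b)
      + of_bool (i = k) * (dualvar l a * ydiff j b p) + of_bool (i = l) * (cst \<epsilon> * (dualvar k a * ydiff j b p))
      + of_bool (j = k) * (dualvar l b * ydiff i a p) + of_bool (j = l) * (cst \<epsilon> * (dualvar k b * ydiff i a p))
      + cst (inv_form g $ b $ a) * (of_bool (i = l \<and> j = k) * p)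
      + cst (inv_form g $ b $ a) * (cst \<epsilon> * (of_bool (i = k \<and> j = l) * p))" for a b
    by (auto simp: ydiff_rawK ydiff_dualvar op_linear_add[OF ydiff_linear] op_linear_scale[OF ydiff_linear]
        op_linear_0[OF ydiff_linear] distrib_left mult.left_commute)
  have left: "(\<Sum>a\<in>UNIV. \<Sum>b\<in>UNIV. cst (g $ a $ b) * (dualvar l a * ydiff j b q)) = yE l j q"
    for l j and q :: "('r, 'n) ypoly"
  proof -
    have "(\<Sum>a\<in>UNIV. \<Sum>b\<in>UNIV. cst (g $ a $ b) * (dualvar l a * ydiff j b q)) =
        (\<Sum>b\<in>UNIV. (\<Sum>a\<in>UNIV. cst (g $ a $ b) * dualvar l a) * ydiff j b q)"
      unfolding sum_distrib_right mult.assoc by (rule sum.swap)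
    then show ?thesis by (simp add: form_dualvar_left yE_def)
  qed
  have right: "(\<Sum>a\<in>UNIV. \<Sum>b\<in>UNIV. cst (g $ a $ b) * (dualvar l b * ydiff i a q)) = cst \<epsilon> * yE l i q"
    for l i and q :: "('r, 'n) ypoly"
  proof -
    have "(\<Sum>a\<in>UNIV. \<Sum>b\<in>UNIV. cst (g $ a $ b) * (dualvar l b * ydiff i a q)) =
        (\<Sum>a\<in>UNIV. (\<Sum>b\<in>UNIV. cst (g $ a $ b) * dualvar l b) * ydiff i a q)"
      unfolding sum_distrib_right mult.assoc ..
    then show ?thesis by (simp add: form_dualvar_right yE_def sum_distrib_left mult.assoc)
  qed
  have trace: "(\<Sum>a\<in>UNIV. \<Sum>b\<in>UNIV. cst (g $ a $ b) * (cst (inv_form g $ b $ a) * q)) =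
      cst (\<epsilon> * of_nat CARD('n)) * q" for q :: "('r, 'n) ypoly"
    unfolding form_trace[symmetric] cst_sum sum_distrib_right cst_mult mult.assoc ..
  have expand: "rawP g i j (rawK g k l p) =
      (\<Sum>a\<in>UNIV. \<Sum>b\<in>UNIV. cst (g $ a $ b) * rawK g k l (?D i a j b))
      + of_bool (i = k) * (\<Sum>a\<in>UNIV. \<Sum>b\<in>UNIV. cst (g $ a $ b) * (dualvar l a * ydiff j b p))
      + of_bool (i = l) * (cst \<epsilon> * (\<Sum>a\<in>UNIV. \<Sum>b\<in>UNIV. cst (g $ a $ b) * (dualvar k a * ydiff j b p)))
      + of_bool (j = k) * (\<Sum>a\<in>UNIV. \<Sum>b\<in>UNIV. cst (g $ a $ b) * (dualvar l b * ydiff i a p))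
      + of_bool (j = l) * (cst \<epsilon> * (\<Sum>a\<in>UNIV. \<Sum>b\<in>UNIV. cst (g $ a $ b) * (dualvar k b * ydiff i a p)))
      + (\<Sum>a\<in>UNIV. \<Sum>b\<in>UNIV. cst (g $ a $ b) * (cst (inv_form g $ b $ a) * (of_bool (i = l \<and> j = k) * p)))
      + (\<Sum>a\<in>UNIV. \<Sum>b\<in>UNIV. cst (g $ a $ b) * (cst (inv_form g $ b $ a) * (cst \<epsilon> * (of_bool (i = k \<and> j = l) * p))))"
    by (simp only: rawP_def D distrib_left sum.distrib sum_distrib_left mult.left_commute)
  have raw: "(\<Sum>a\<in>UNIV. \<Sum>b\<in>UNIV. cst (g $ a $ b) * rawK g k l (?D i a j b)) = rawK g k l (rawP g i j p)"
    by (simp add: rawP_def op_linear_sum[OF rawK_linear] op_linear_scale[OF rawK_linear])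
  have scal1: "cst \<epsilon> * (cst \<epsilon> * q) = q" for q :: "('r, 'n) ypoly"
    by (simp add: cst_mult_assoc)
  have scal2: "cst (\<epsilon> * c) * (of_bool b * q) = cst (c * (\<epsilon> * of_bool b)) * q" for q :: "('r, 'n) ypoly" and b c
    by (cases b) (simp_all add: mult.commute)
  have scal3: "cst (\<epsilon> * c) * (cst \<epsilon> * (of_bool b * q)) = cst (c * of_bool b) * q"
    for q :: "('r, 'n) ypoly" and b c
    using sign by (cases b) (auto simp: cst_mult_assoc)
  show ?thesis
    unfolding expand raw left right trace
    by (simp only: scal1 scal2 scal3 distrib_left distrib_right cst_plus add_ac)
qed

end

section \<open>Linear spans of operators\<close>

lemma op_span_zero: "(\<lambda>p. 0) \<in> op_span S"
  unfolding op_span_def by (auto intro!: exI[of _ "{}"])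

lemma op_span_base: "A \<in> S \<Longrightarrow> A \<in> op_span S"
  unfolding op_span_def by (auto intro!: exI[of _ "{A}"] exI[of _ "\<lambda>_. 1"])

lemma op_span_lincomb:
  assumes "A \<in> op_span S" "B \<in> op_span S"
  shows "(\<lambda>p. cst a * A p + cst b * B p) \<in> op_span S"
proof -
  obtain c F where F: "finite F" "F \<subseteq> S" "A = (\<lambda>p. \<Sum>X\<in>F. cst (c X) * X p)"
    using assms(1) by (auto simp: op_span_def)
  obtain d G where G: "finite G" "G \<subseteq> S" "B = (\<lambda>p. \<Sum>X\<in>G. cst (d X) * X p)"
    using assms(2) by (auto simp: op_span_def)
  define e where "e X = a * (if X \<in> F then c X else 0) + b * (if X \<in> G then d X else 0)" for X
  have "A p = (\<Sum>X\<in>F \<union> G. cst (if X \<in> F then c X else 0) * X p)" for p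
    unfolding F(3) using F(1) G(1) by (intro sum.mono_neutral_cong_left) auto
  moreover have "B p = (\<Sum>X\<in>F \<union> G. cst (if X \<in> G then d X else 0) * X p)" for p
    unfolding G(3) using F(1) G(1) by (intro sum.mono_neutral_cong_left) auto
  ultimately have "(\<lambda>p. cst a * A p + cst b * B p) = (\<lambda>p. \<Sum>X\<in>F \<union> G. cst (e X) * X p)"
    by (simp only: e_def cst_plus cst_mult distrib_right sum.distrib sum_distrib_left mult.assoc)
  then show ?thesis
    unfolding op_span_def using F G by blast
qed

lemma op_span_add: "A \<in> op_span S \<Longrightarrow> B \<in> op_span S \<Longrightarrow> (\<lambda>p. A p + B p) \<in> op_span S"
  using op_span_lincomb[of A S B 1 1] by simp

lemma op_span_scale: "A \<in> op_span S \<Longrightarrow> (\<lambda>p. cst c * A p) \<in> op_span S"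
  using op_span_lincomb[of A S A c 0] by simp

lemma op_span_minus: "A \<in> op_span S \<Longrightarrow> (\<lambda>p. - A p) \<in> op_span S"
  using op_span_scale[of A S "-1"] by simp

lemma op_span_of_bool: "(b \<Longrightarrow> A \<in> op_span S) \<Longrightarrow> (\<lambda>p. of_bool b * A p) \<in> op_span S"
  by (cases b) (auto intro: op_span_zero)

lemma op_span_induct [consumes 1, case_names zero lincomb]:
  assumes "A \<in> op_span S" and "P (\<lambda>p. 0)"
    and step: "\<And>A c B. A \<in> S \<Longrightarrow> B \<in> op_span S \<Longrightarrow> P B \<Longrightarrow> P (\<lambda>p. cst c * A p + B p)"
  shows "P A"
proof -
  have "P (\<lambda>p. \<Sum>X\<in>F. cst (c X) * X p)" if "finite F" "F \<subseteq> S" for c F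
    using that
  proof (induction F rule: finite_induct)
    case (insert X F)
    then have "(\<lambda>p. \<Sum>X\<in>F. cst (c X) * X p) \<in> op_span S" by (auto simp: op_span_def)
    then show ?case using insert step by simp
  qed (use assms(2) in simp)
  then show ?thesis using assms(1) by (auto simp: op_span_def)
qed

lemma op_span_mono: "S \<subseteq> T \<Longrightarrow> op_span S \<subseteq> op_span T"
  unfolding op_span_def by blast

lemma op_span_subset:
  assumes "S \<subseteq> op_span T" shows "op_span S \<subseteq> op_span T"
proof
  fix A assume "A \<in> op_span S"
  then show "A \<in> op_span T"
    by (induction rule: op_span_induct) (use assms in \<open>auto intro!: op_span_zero op_span_add op_span_scale\<close>)
qed

lemma op_span_linear:
  assumes "\<And>A. A \<in> S \<Longrightarrow> op_linear A" "A \<in> op_span S"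
  shows "op_linear A"
  using assms(2)
  by (induction rule: op_span_induct)
    (use assms(1) in \<open>auto simp: op_linear_def distrib_left mult.left_commute\<close>)

text \<open>Bilinearity in two passes: first \<open>B\<close> runs through its span for a fixed
  generator \<open>A\<close>, then \<open>A\<close> runs through its own; the second pass uses that
  all of \<open>op_span T\<close> is linear.\<close>

lemma op_comm_span:
  assumes S: "\<And>A. A \<in> S \<Longrightarrow> op_linear A" and T: "\<And>B. B \<in> T \<Longrightarrow> op_linear B"
    and comm: "\<And>A B. A \<in> S \<Longrightarrow> B \<in> T \<Longrightarrow> op_comm A B \<in> op_span U"
    and "A \<in> op_span S" "B \<in> op_span T"
  shows "op_comm A B \<in> op_span U"
proof -
  have 1: "op_comm A B \<in> op_span U" if A: "A \<in> S" and "B \<in> op_span T" for A B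
    using that(2)
  proof (induction rule: op_span_induct)
    case zero
    then show ?case using op_linear_0[OF S[OF A]] by (simp add: op_comm_def op_span_zero)
  next
    case (lincomb B c B')
    have "op_comm A (\<lambda>p. cst c * B p + B' p) = (\<lambda>p. cst c * op_comm A B p + op_comm A B' p)"
      by (simp add: fun_eq_iff op_comm_def op_linear_add[OF S[OF A]] op_linear_scale[OF S[OF A]] right_diff_distrib)
    then show ?case using lincomb A comm by (auto intro!: op_span_add op_span_scale)
  qed
  note B = op_span_linear[OF T \<open>B \<in> op_span T\<close>]
  show ?thesis using \<open>A \<in> op_span S\<close>
  proof (induction rule: op_span_induct)
    case zero
    then show ?case using op_linear_0[OF B] by (simp add: op_comm_def op_span_zero)
  next
    case (lincomb A c A')
    have "op_comm (\<lambda>p. cst c * A p + A' p) B = (\<lambda>p. cst c * op_comm A B p + op_comm A' B p)"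
      by (simp add: fun_eq_iff op_comm_def op_linear_add[OF B] op_linear_scale[OF B] right_diff_distrib)
    then show ?case using lincomb 1 assms(5) by (auto intro!: op_span_add op_span_scale)
  qed
qed

section \<open>Brackets of the generators of d(r)\<close>

lemma op_comm_swap: "op_comm B A = (\<lambda>p. - op_comm A B p)"
  by (simp add: op_comm_def)

lemma op_comm_opH:
  assumes "op_linear A"
  shows "op_comm (opH i j) A = (\<lambda>p. A (yE i j p) - yE i j (A p))"
  unfolding fun_eq_iff op_comm_def opH_yE op_linear_minus[OF assms] op_linear_add[OF assms]
    op_linear_scale[OF assms] by simp

lemma op_comm_H_H:
  fixes i j k l :: 'r
  shows "op_comm (opH i j) (opH k l :: ('r, 'n::finite) yop) =
    (\<lambda>p. of_bool (l = i) * opH k j p + - (of_bool (j = k) * opH i l p))"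
proof -
  have "yE i j (opH k l p) = opH k l (yE i j p) - of_bool (j = k) * yE i l p + of_bool (i = l) * yE k j p"
    for p :: "('r, 'n) ypoly"
    unfolding opH_yE op_linear_minus[OF yE_linear] op_linear_add[OF yE_linear]
      op_linear_scale[OF yE_linear] yE_yE[of i j k l] by simp
  then show ?thesis
    by (simp only: op_comm_opH[OF opH_linear]) (auto simp: opH_yE)
qed

text \<open>Expressed by \<open>rawP\<close> because the bracket changes an index, so that the
  factor 1/(1+delta) of the result need not be that of the original operator. The same holds for
  \<open>op_comm_H_K\<close>.\<close>

lemma op_comm_H_P:
  "op_comm (opH i j) (opP g k l) =
    (\<lambda>p. cst (1 / (1 + of_bool (k = l))) * (of_bool (i = k) * rawP g j l p + of_bool (i = l) * rawP g k j p))"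
  by (simp add: op_comm_opH[OF opP_linear] fun_eq_iff opP_raw op_linear_scale[OF yE_linear] yE_rawP
      distrib_left right_diff_distrib)

lemma op_comm_H_K:
  "op_comm (opH i j) (opK g k l) =
    (\<lambda>p. cst (1 / (1 + of_bool (k = l))) * (of_bool (j = k) * rawK g i l p + of_bool (j = l) * rawK g k i p))"
  by (simp add: op_comm_opH[OF opK_linear] fun_eq_iff opK_raw op_linear_scale[OF yE_linear] op_linear_minus[OF yE_linear] yE_rawK
      distrib_left right_diff_distrib)

lemma op_comm_P_P: "op_comm (opP g i j) (opP g k l) = (\<lambda>p. 0)"
  by (auto simp: fun_eq_iff op_comm_def opP_raw op_linear_scale[OF rawP_linear] rawP_rawP[of g i j] mult.left_commute)

lemma op_comm_K_K: "op_comm (opK g i j) (opK g k l) = (\<lambda>p. 0)"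
  by (auto simp: fun_eq_iff op_comm_def opK_raw op_linear_scale[OF rawK_linear] op_linear_minus[OF rawK_linear]
      rawK_rawK[of g i j] mult.left_commute)

lemma (in nondegenerate_form) op_comm_P_K:
  fixes i j k l :: 'r
  shows "op_comm (opP g i j) (opK g k l) =
    (\<lambda>p. cst (1 / ((1 + of_bool (i = j)) * (1 + of_bool (k = l)))) *
      (of_bool (i = k) * opH l j p + cst \<epsilon> * (of_bool (i = l) * opH k j p)
       + cst \<epsilon> * (of_bool (j = k) * opH l i p) + of_bool (j = l) * opH k i p))"
proof -
  \<comment> \<open>The scalar is cut into halves N/2, one for each of the four \<open>yE\<close>
    terms, which it completes to \<open>opH\<close>.\<close>
  have N: "cst (of_nat CARD('n) * (of_bool (i = k \<and> j = l) + \<epsilon> * of_bool (i = l \<and> j = k))) * p =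
      of_bool (i = k) * (cst (of_nat CARD('n) / 2 * of_bool (l = j)) * p)
      + cst \<epsilon> * (of_bool (i = l) * (cst (of_nat CARD('n) / 2 * of_bool (k = j)) * p))
      + cst \<epsilon> * (of_bool (j = k) * (cst (of_nat CARD('n) / 2 * of_bool (l = i)) * p))
      + of_bool (j = l) * (cst (of_nat CARD('n) / 2 * of_bool (k = i)) * p)" for p :: "('r, 'n) ypoly"
  proof -
    define h :: "('r, 'n) ypoly" where "h = cst (of_nat CARD('n) / 2)"
    have "cst (of_nat CARD('n) * c) = (h + h) * cst c" for c
      by (simp add: h_def flip: cst_plus cst_mult)
    moreover have "cst (of_nat CARD('n) / 2 * c) = h * cst c" for c
      by (simp add: h_def flip: cst_mult)
    moreover have "cst (of_bool (i = k \<and> j = l) + \<epsilon> * of_bool (i = l \<and> j = k)) =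
       (of_bool (i = k) * of_bool (j = l) + cst \<epsilon> * of_bool (i = l) * of_bool (j = k) :: ('r, 'n) ypoly)"
      by (auto simp: cst_plus)
    ultimately show ?thesis
      by (simp only: cst_of_bool eq_commute[of k i] eq_commute[of l j] eq_commute[of l i] eq_commute[of k j])
        (simp only: distrib_left distrib_right mult_ac add_ac)
  qed
  have "op_comm (opP g i j) (opK g k l) p = cst (- 1 / ((1 + of_bool (i = j)) * (1 + of_bool (k = l))))
      * (rawP g i j (rawK g k l p) - rawK g k l (rawP g i j p))" for p :: "('r, 'n) ypoly"
    unfolding op_comm_def opP_raw opK_raw op_linear_scale[OF rawP_linear] op_linear_scale[OF rawK_linear]
      cst_mult_assoc right_diff_distrib
    by (simp only: times_divide_times_eq mult_1_left mult_1_right mult.commute)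
  then show ?thesis
    unfolding rawP_rawK N
    by (simp add: fun_eq_iff opH_yE algebra_simps)
qed

section \<open>The height filtration of d(r)\<close>

text \<open>The position of an index. The index itself is counted, so positions start at 1 and the
  trace operators get positive height as well.\<close>

definition ht :: "'r::{finite,linorder} \<Rightarrow> int" where
  "ht i = int (card {..i})"

lemma ht_mono: "i < j \<Longrightarrow> ht i < ht j"
  unfolding ht_def by (auto intro!: psubset_card_mono)

lemma ht_pos: "0 < ht i"
  unfolding ht_def by (auto simp: card_gt_0_iff)

lemma ht_le: "ht (i :: 'r::{finite,linorder}) \<le> int CARD('r)"
  unfolding ht_def by (auto intro!: card_mono)

text \<open>The height is the eigenvalue under the bracket with the Cartan element whose coordinates
  are \<open>ht\<close>. It lies between -2r and 2r for every generator, so the filtration is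
  everything at -2r and zero above 2r; positive root vectors have height at least 1.\<close>

definition height_basis :: "complex^'n^'n \<Rightarrow> int \<Rightarrow> ('r::{finite,linorder}, 'n) yop set" where
  "height_basis g d = {opH i j | i j. d \<le> ht j - ht i} \<union> {opP g i j | i j. d \<le> ht i + ht j}
     \<union> {opK g i j | i j. d \<le> - (ht i + ht j)}"

definition height_filt :: "complex^'n^'n \<Rightarrow> int \<Rightarrow> ('r::{finite,linorder}, 'n) yop set" where
  "height_filt g d = op_span (height_basis g d)"

lemma height_filt_H: "d \<le> ht j - ht i \<Longrightarrow> opH i j \<in> height_filt g d"
  and height_filt_P: "d \<le> ht i + ht j \<Longrightarrow> opP g i j \<in> height_filt g d"
  and height_filt_K: "d \<le> - (ht i + ht j) \<Longrightarrow> opK g i j \<in> height_filt g d"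
  unfolding height_filt_def by (rule op_span_base; force simp: height_basis_def)+

lemma height_filt_rawP: "d \<le> ht i + ht j \<Longrightarrow> rawP g i j \<in> height_filt g d"
  using op_span_scale[OF height_filt_P[unfolded height_filt_def], of d i j "1 + of_bool (i = j)" g]
  by (cases "i = j") (simp_all add: opP_raw cst_mult_assoc height_filt_def)

lemma height_filt_rawK: "d \<le> - (ht i + ht j) \<Longrightarrow> rawK g i j \<in> height_filt g d"
  using op_span_scale[OF height_filt_K[unfolded height_filt_def], of d i j "- (1 + of_bool (i = j))" g]
  by (cases "i = j") (simp_all add: opK_raw cst_mult_assoc height_filt_def)

lemmas height_filt_intros = op_span_zero[of "height_basis g d" for g d, folded height_filt_def]
  op_span_add[of _ "height_basis g d" for g d, folded height_filt_def]
  op_span_scale[of _ "height_basis g d" for g d, folded height_filt_def]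
  op_span_minus[of _ "height_basis g d" for g d, folded height_filt_def]
  op_span_of_bool[of _ _ "height_basis g d" for g d, folded height_filt_def]
  height_filt_H height_filt_P height_filt_K height_filt_rawP height_filt_rawK

lemma height_basis_linear: "A \<in> height_basis g d \<Longrightarrow> op_linear A"
  by (auto simp: height_basis_def opH_linear opP_linear opK_linear)

text \<open>Heights are weights and so add under brackets; by bilinearity only the bracket formulas
  for generators have to be inspected.\<close>

lemma (in nondegenerate_form) height_filt_comm:
  fixes A B :: "('b::{finite,linorder}, 'n) yop"
  assumes "A \<in> height_filt g a" "B \<in> height_filt g b"
  shows "op_comm A B \<in> height_filt g (a + b)"
  unfolding height_filt_def
proof (rule op_comm_span[OF height_basis_linear height_basis_linear _ assms[unfolded height_filt_def]])
  have HH: "op_comm (opH i j) (opH k l) \<in> height_filt g (a + b)"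
    if "a \<le> ht j - ht i" "b \<le> ht l - ht k" for a b and i j k l :: 'b
    unfolding op_comm_H_H using that by (intro height_filt_intros) auto
  have HP: "op_comm (opH i j) (opP g k l) \<in> height_filt g (a + b)"
    if "a \<le> ht j - ht i" "b \<le> ht k + ht l" for a b and i j k l :: 'b
    unfolding op_comm_H_P using that by (intro height_filt_intros) auto
  have HK: "op_comm (opH i j) (opK g k l) \<in> height_filt g (a + b)"
    if "a \<le> ht j - ht i" "b \<le> - (ht k + ht l)" for a b and i j k l :: 'b
    unfolding op_comm_H_K using that by (intro height_filt_intros) auto
  have PK: "op_comm (opP g i j) (opK g k l) \<in> height_filt g (a + b)"
    if "a \<le> ht i + ht j" "b \<le> - (ht k + ht l)" for a b and i j k l :: 'b
    unfolding op_comm_P_K using that by (intro height_filt_intros) auto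
  have swap: "op_comm B A \<in> height_filt g (b + a)" if "op_comm A B \<in> height_filt g (a + b)" for A B :: "('b, 'n) yop" and a b
    unfolding op_comm_swap[of B A] using that by (intro height_filt_intros) (simp add: add.commute)
  fix A B :: "('b, 'n) yop" assume "A \<in> height_basis g a" "B \<in> height_basis g b"
  then show "op_comm A B \<in> op_span (height_basis g (a + b))"
    unfolding height_basis_def[of g a] height_basis_def[of g b] height_filt_def[symmetric]
    apply (elim UnE CollectE exE conjE)
    apply (simp_all only: op_comm_P_P op_comm_K_K)
    apply (intro HH HP HK PK swap[OF HP] swap[OF HK] swap[OF PK] height_filt_intros(1); assumption)+
    done
qed

lemma height_filt_linear: "A \<in> height_filt g d \<Longrightarrow> op_linear A"
  unfolding height_filt_def using height_basis_linear by (rule op_span_linear)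

lemma height_filt_eq_d_alg: "height_filt g (- 2 * int CARD('r)) = (d_alg g :: ('r::{finite,linorder}, 'n::finite) yop set)"
proof -
  have "- 2 * int CARD('r) \<le> ht j - ht i" "- 2 * int CARD('r) \<le> ht i + ht j"
    "- 2 * int CARD('r) \<le> - (ht i + ht j)" for i j :: 'r
    using ht_le[of i] ht_le[of j] ht_pos[of i] ht_pos[of j] by linarith+
  then have "height_basis g (- 2 * int CARD('r)) =
      ({opK g i j | i j. True} \<union> {opP g i j | i j. True} \<union> {opH i j | i j. True} :: ('r, 'n) yop set)"
    by (auto simp: height_basis_def)
  then show ?thesis by (simp add: height_filt_def d_alg_def)
qed

lemma height_filt_subset_d_alg: "height_filt g d \<subseteq> d_alg g"
  unfolding height_filt_def d_alg_def by (rule op_span_mono) (auto simp: height_basis_def)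

lemma height_filt_vanish:
  assumes "2 * int CARD('r) < d"
  shows "height_filt g d = {(\<lambda>p. 0) :: ('r::{finite,linorder}, 'n::finite) yop}"
proof -
  have "\<not> d \<le> ht j - ht i" "\<not> d \<le> ht i + ht j" "\<not> d \<le> - (ht i + ht j)" for i j :: 'r
    using ht_le[of i] ht_le[of j] ht_pos[of i] ht_pos[of j] assms by linarith+
  then have "height_basis g d = ({} :: ('r, 'n) yop set)"
    by (auto simp: height_basis_def)
  then show ?thesis by (simp add: height_filt_def op_span_def)
qed

lemma g_plus_subset: "(g_plus g :: ('r::{finite,linorder}, 'n::finite) yop set) \<subseteq> height_filt g 1"
proof -
  have "1 \<le> ht j - ht i" if "i < j" for i j :: 'r using ht_mono[OF that] by simp
  moreover have "1 \<le> ht i + ht j" for i j :: 'r using ht_pos[of i] ht_pos[of j] by simp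
  moreover have "1 \<le> 2 * ht j" for j :: 'r using ht_pos[of j] by simp
  ultimately have "root_vec g ` d_roots g \<subseteq> (height_filt g 1 :: ('r, 'n) yop set)"
    by (auto simp: d_roots_def sl_roots_def t_roots_def intro!: height_filt_H height_filt_P)
  then show ?thesis unfolding g_plus_def height_filt_def by (rule op_span_subset)
qed

text \<open>The bottom level of the filtration is the whole space, so
  \<open>height_filt_comm\<close> at level -2r in both arguments is closure under brackets.\<close>

lemma (in nondegenerate_form) d_alg_comm:
  fixes A B :: "('r::{finite,linorder}, 'n) yop"
  assumes "A \<in> d_alg g" "B \<in> d_alg g" shows "op_comm A B \<in> d_alg g"
  using assms height_filt_comm[of A "- 2 * int CARD('r)" B "- 2 * int CARD('r)"]
    height_filt_subset_d_alg[of g] unfolding height_filt_eq_d_alg by blast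

section \<open>Roots and normal orderings\<close>

lemma lookup_cst_mult: "Poly_Mapping.lookup (cst c * p) k = c * Poly_Mapping.lookup p k"
  for p :: "'k::monoid_add \<Rightarrow>\<^sub>0 complex"
  by (simp add: cst_def lookup_mapp flip: mult_map_scale_conv_mult)
    (simp add: Poly_Mapping.map.rep_eq when_def)

lemma cst_mult_cancel: "p \<noteq> 0 \<Longrightarrow> cst c * p = cst d * p \<longleftrightarrow> c = d"
  for p :: "'k::monoid_add \<Rightarrow>\<^sub>0 complex"
  by (auto simp: poly_mapping_eq_iff fun_eq_iff lookup_cst_mult)

section \<open>Cartan elements in coordinates, weights and eigenvectors\<close>

definition cartan_elt :: "('r::finite \<Rightarrow> complex) \<Rightarrow> ('r, 'n::finite) yop" where
  "cartan_elt x p = (\<Sum>i\<in>UNIV. cst (x i) * opH i i p)"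

lemma cartan_elt_add: "cartan_elt (\<lambda>i. x i + y i) p = cartan_elt x p + cartan_elt y p"
  by (simp add: cartan_elt_def cst_plus distrib_right sum.distrib)

lemma cartan_elt_scale: "cartan_elt (\<lambda>i. c * x i) p = cst c * cartan_elt x p"
  by (simp add: cartan_elt_def cst_mult_assoc sum_distrib_left)

lemma cartan_elt_delta: "cartan_elt (\<lambda>i. of_bool (i = j)) = opH j j"
proof
  fix p
  have "cartan_elt (\<lambda>i. of_bool (i = j)) p = (\<Sum>i\<in>UNIV. if i = j then opH j j p else 0)"
    unfolding cartan_elt_def by (rule sum.cong) auto
  then show "cartan_elt (\<lambda>i. of_bool (i = j)) p = opH j j p" by simp
qed

lemma cartan_elt_in_cartan: "cartan_elt x \<in> cartan"
proof -
  have "(\<lambda>p. \<Sum>i\<in>I. cst (x i) * opH i i p) \<in> cartan" if "finite I" for I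
    using that
  proof (induction I rule: finite_induct)
    case (insert i I)
    have "opH i i \<in> cartan" unfolding cartan_def by (rule op_span_base) blast
    then show ?case
      using insert by (auto simp: cartan_def intro!: op_span_add op_span_scale)
  qed (simp add: cartan_def op_span_zero)
  from this[OF finite] show ?thesis by (simp add: cartan_elt_def[abs_def])
qed

lemma cartan_eq: "(cartan :: ('r::finite, 'n::finite) yop set) = range cartan_elt"
proof
  show "cartan \<subseteq> range (cartan_elt :: _ \<Rightarrow> ('r, 'n) yop)"
  proof
    fix X :: "('r, 'n) yop" assume "X \<in> cartan"
    then show "X \<in> range cartan_elt"
      unfolding cartan_def
    proof (induction rule: op_span_induct)
      case zero
      have "(\<lambda>p. 0) = (cartan_elt (\<lambda>i. 0) :: ('r, 'n) yop)" by (simp add: cartan_elt_def fun_eq_iff)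
      then show ?case by (metis rangeI)
    next
      case (lincomb A c B)
      then obtain i x where "A = opH i i" "B = cartan_elt x" by auto
      then have "(\<lambda>p. cst c * A p + B p) = cartan_elt (\<lambda>k. c * of_bool (k = i) + x k)"
        by (simp add: fun_eq_iff cartan_elt_add cartan_elt_scale cartan_elt_delta)
      then show ?case by (metis rangeI)
    qed
  qed
qed (auto intro: cartan_elt_in_cartan)

lemma op_comm_cartan_elt:
  assumes "op_linear A"
  shows "op_comm (cartan_elt x) A = (\<lambda>p. \<Sum>i\<in>UNIV. cst (x i) * op_comm (opH i i) A p)"
  by (simp add: fun_eq_iff op_comm_def cartan_elt_def op_linear_sum[OF assms] op_linear_scale[OF assms]
      right_diff_distrib sum_subtractf)

lemma sum_cst_of_bool:
  "(\<Sum>i\<in>UNIV. cst (x i) * (of_bool (i = k) * f i)) = cst (x k) * (f k :: 'k::monoid_add \<Rightarrow>\<^sub>0 complex)"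
  for k :: "'r::finite"
proof -
  have "(\<Sum>i\<in>UNIV. cst (x i) * (of_bool (i = k) * f i)) = (\<Sum>i\<in>UNIV. if i = k then cst (x k) * f k else 0)"
    by (rule sum.cong) auto
  then show ?thesis by simp
qed

lemma cartan_weight_H: "op_comm (cartan_elt x) (opH k l) = op_scale (x l - x k) (opH k l)"
proof
  fix p
  have "op_comm (cartan_elt x) (opH k l) p = (\<Sum>i\<in>UNIV. cst (x i) * (of_bool (i = l) * opH k i p))
      - (\<Sum>i\<in>UNIV. cst (x i) * (of_bool (i = k) * opH i l p))"
    by (simp add: op_comm_cartan_elt[OF opH_linear] op_comm_H_H right_diff_distrib sum_subtractf eq_commute)
  then show "op_comm (cartan_elt x) (opH k l) p = op_scale (x l - x k) (opH k l) p"
    by (simp add: sum_cst_of_bool op_scale_def cst_diff left_diff_distrib)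
qed

lemma cartan_weight_P: "op_comm (cartan_elt x) (opP g k l) = op_scale (x k + x l) (opP g k l)"
proof
  fix p
  have "op_comm (cartan_elt x) (opP g k l) p = cst (1 / (1 + of_bool (k = l))) *
      ((\<Sum>i\<in>UNIV. cst (x i) * (of_bool (i = k) * rawP g i l p))
      + (\<Sum>i\<in>UNIV. cst (x i) * (of_bool (i = l) * rawP g k i p)))"
    by (simp only: op_comm_cartan_elt[OF opP_linear] op_comm_H_P distrib_left sum.distrib
        sum_distrib_left mult.left_commute)
  then show "op_comm (cartan_elt x) (opP g k l) p = op_scale (x k + x l) (opP g k l) p"
    by (simp add: sum_cst_of_bool op_scale_def opP_raw cst_plus distrib_left distrib_right mult.left_commute)
qed

lemma cartan_weight_K: "op_comm (cartan_elt x) (opK g k l) = op_scale (- (x k + x l)) (opK g k l)"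
proof
  fix p
  have "op_comm (cartan_elt x) (opK g k l) p = cst (1 / (1 + of_bool (k = l))) *
      ((\<Sum>i\<in>UNIV. cst (x i) * (of_bool (i = k) * rawK g i l p))
      + (\<Sum>i\<in>UNIV. cst (x i) * (of_bool (i = l) * rawK g k i p)))"
    by (simp only: op_comm_cartan_elt[OF opK_linear] op_comm_H_K distrib_left sum.distrib
        sum_distrib_left mult.left_commute)
  then show "op_comm (cartan_elt x) (opK g k l) p = op_scale (- (x k + x l)) (opK g k l) p"
    unfolding sum_cst_of_bool op_scale_def opK_raw minus_divide_left[symmetric] cst_simps cst_plus
    by (simp only: mult_minus_left mult_minus_right minus_minus distrib_left distrib_right mult.left_commute)
qed

text \<open>The value of a root on \<^term>\<open>cartan_elt x\<close>, and its coroot in the same coordinates.\<close>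

fun root_wt :: "'r pos_root \<Rightarrow> ('r \<Rightarrow> complex) \<Rightarrow> complex" where
  "root_wt (RootH i j) x = x j - x i"
| "root_wt (RootP i j) x = x i + x j"

fun coweight :: "'r pos_root \<Rightarrow> 'r \<Rightarrow> complex" where
  "coweight (RootH i j) k = of_bool (k = j) - of_bool (k = i)"
| "coweight (RootP i j) k = (if i = j then of_bool (k = i) else of_bool (k = i) + of_bool (k = j))"

lemma root_vec_weight: "op_comm (cartan_elt x) (root_vec g \<beta>) = op_scale (root_wt \<beta> x) (root_vec g \<beta>)"
  by (cases \<beta>) (simp_all only: root_vec.simps root_wt.simps cartan_weight_H cartan_weight_P)

lemma neg_root_vec_weight:
  "op_comm (cartan_elt x) (neg_root_vec g \<beta>) = op_scale (- root_wt \<beta> x) (neg_root_vec g \<beta>)"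
  by (cases \<beta>) (simp_all only: neg_root_vec.simps root_wt.simps cartan_weight_H cartan_weight_K minus_diff_eq)

lemma op_comm_cartan_cartan:
  fixes X Y :: "('r::finite, 'n::finite) yop"
  assumes "X \<in> cartan" "Y \<in> cartan"
  shows "op_comm X Y = (\<lambda>p. 0)"
proof
  fix p
  obtain x y where XY: "X = cartan_elt x" "Y = cartan_elt y" using assms by (auto simp: cartan_eq)
  have X: "op_linear X" using assms(1) unfolding cartan_def by (rule op_span_linear[rotated]) (auto simp: opH_linear)
  have "op_comm X Y p = (\<Sum>i\<in>UNIV. cst (y i) * op_comm X (opH i i) p)"
    by (simp add: op_comm_def XY(2) cartan_elt_def op_linear_sum[OF X] op_linear_scale[OF X]
        right_diff_distrib sum_subtractf)
  then show "op_comm X Y p = 0" by (simp add: XY(1) cartan_weight_H op_scale_def)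
qed

lemma yE_yvar_power:
  fixes i k :: 'r and a :: "'n::finite"
  shows "yE k k (yvar i a ^ n) = cst (of_nat n * of_bool (k = i)) * yvar i a ^ n"
proof (induction n)
  case 0
  have "ydiff k c 1 = 0" for c :: 'n using ydiff_single[of k c 0 1] by simp
  then show ?case by (simp add: yE_def)
next
  case (Suc n)
  have "yE k k (yvar i a ^ Suc n) = yvar i a * yE k k (yvar i a ^ n) + of_bool (k = i) * (yvar k a * yvar i a ^ n)"
    by (simp only: power_Suc yE_yvar)
  then show ?case
    by (auto simp: Suc.IH distrib_left distrib_right cst_plus mult.left_commute)
qed

lemma yvar_power: "yvar i a ^ n = Poly_Mapping.single (Poly_Mapping.single (i, a) n) 1"
  by (induction n) (simp_all add: yvar_def mult_single flip: single_add)

lemma yvar_power_nonzero: "yvar i a ^ n \<noteq> 0"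
proof
  assume "yvar i a ^ n = 0"
  then have "Poly_Mapping.lookup (yvar i a ^ n) (Poly_Mapping.single (i, a) n) = 0" by simp
  then show False by (simp add: yvar_power)
qed

lemma cartan_elt_yvar_power:
  "cartan_elt x (yvar i a ^ n :: ('r::finite, 'n::finite) ypoly) =
     cst (- (of_nat CARD('n) / 2 * sum x UNIV) - of_nat n * x i) * yvar i a ^ n"
proof -
  have "cst (x k) * opH k k (yvar i a ^ n) =
      cst (- (of_nat CARD('n) / 2 * x k) - of_nat n * (if k = i then x i else 0)) * (yvar i a ^ n :: ('r, 'n) ypoly)" for k
  proof -
    have H: "opH k k (yvar i a ^ n) = cst (- (of_nat CARD('n) / 2) - of_nat n * of_bool (k = i)) * (yvar i a ^ n :: ('r, 'n) ypoly)"
      by (simp add: opH_yE yE_yvar_power cst_diff left_diff_distrib)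
    show ?thesis
      unfolding H cst_mult_assoc
      by (intro arg_cong[where f = "\<lambda>c. cst c * _"]) (simp add: algebra_simps)
  qed
  then have "cartan_elt x (yvar i a ^ n :: ('r, 'n) ypoly) =
      cst (\<Sum>k\<in>UNIV. - (of_nat CARD('n) / 2 * x k) - of_nat n * (if k = i then x i else 0)) * yvar i a ^ n"
    by (simp add: cartan_elt_def cst_sum sum_distrib_right)
  also have "(\<Sum>k\<in>UNIV. - (of_nat CARD('n) / 2 * x k) - of_nat n * (if k = i then x i else 0)) =
      - (of_nat CARD('n) / 2 * sum x UNIV) - of_nat n * x i"
    by (simp only: sum_subtractf sum_negf sum_distrib_left[symmetric]) simp
  finally show ?thesis .
qed

text \<open>On the n-th power of a variable \<open>y\<close> with upper index \<open>i\<close> the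
  eigenvalue is affine in n with slope \<open>- x i\<close>. As this slope is not 0, the eigenvalues
  are pairwise different and one of them avoids the finite set \<open>F\<close>.\<close>

lemma cartan_elt_eigenvector:
  fixes x :: "'r::finite \<Rightarrow> complex"
  assumes "x i \<noteq> 0" "finite F"
  obtains p :: "('r, 'n::finite) ypoly" and \<mu> where "p \<noteq> 0" "\<mu> \<notin> F" "cartan_elt x p = cst \<mu> * p"
proof -
  define f where "f n = - (of_nat CARD('n) / 2 * sum x UNIV) - of_nat n * x i" for n :: nat
  have "inj f" using assms(1) by (auto simp: f_def inj_on_def)
  then have "infinite (range f)" by (simp add: range_inj_infinite)
  then obtain n where "f n \<notin> F" using assms(2) by (metis finite_subset image_subsetI)
  then show thesis using that yvar_power_nonzero cartan_elt_yvar_power[of x] by (metis f_def)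
qed

section \<open>Coroots and the values of roots\<close>

context nondegenerate_form
begin

lemma form_nonzero: "g \<noteq> 0"
proof
  assume "g = 0"
  then have "(mat 1 :: complex^'n^'n) = 0" using matrix_inv_right_eq by (simp add: matrix_matrix_mult_def vec_eq_iff)
  then have "(mat 1 :: complex^'n^'n) $ undefined $ undefined = 0" by simp
  then show False by (simp add: mat_def)
qed

text \<open>Translates the condition for diagonal roots in \<open>t_roots\<close> into one on the
  sign; a non-zero entry of \<open>g\<close> rules out that both signs fit.\<close>

lemma symmetric_iff: "transpose g = g \<longleftrightarrow> \<epsilon> = 1"
proof
  assume *: "transpose g = g"
  obtain a b where ab: "g $ a $ b \<noteq> 0" using form_nonzero by (auto simp: vec_eq_iff)
  have "g $ b $ a = g $ a $ b" using arg_cong[OF *, of "\<lambda>m. m $ a $ b"] by (simp add: transpose_def)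
  then show "\<epsilon> = 1" using sym[of b a] ab by simp
next
  assume "\<epsilon> = 1"
  then have "g $ a $ b = g $ b $ a" for a b using sym[of a b] by (simp only: mult_1_left)
  then show "transpose g = g" unfolding vec_eq_iff transpose_def by (simp only: vec_lambda_beta) blast
qed

text \<open>For different indices only two of the four terms of \<open>op_comm_P_K\<close> survive,
  those without \<epsilon>. Diagonal roots occur only for \<epsilon> = 1, where all four terms
  agree.\<close>

lemma coroot_eq:
  fixes \<beta> :: "'r::{finite,linorder} pos_root"
  assumes "\<beta> \<in> d_roots g"
  shows "coroot g \<beta> = cartan_elt (coweight \<beta>)"
proof -
  consider i j where "\<beta> = RootH i j" "i < j" | i j where "\<beta> = RootP i j" "i < j"
    | i where "\<beta> = RootP i i" "\<epsilon> = 1"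
    using assms symmetric_iff by (auto simp: d_roots_def sl_roots_def t_roots_def)
  then show ?thesis
  proof cases
    case 1
    have "cartan_elt (coweight \<beta>) = (cartan_elt (\<lambda>k. of_bool (k = j) + (- 1) * of_bool (k = i)) :: ('r, 'n) yop)"
      using 1 by (intro arg_cong[where f = cartan_elt]) auto
    also have "\<dots> = (\<lambda>p. opH j j p + cst (- 1) * opH i i p)"
      by (simp only: fun_eq_iff cartan_elt_add cartan_elt_scale cartan_elt_delta) simp
    finally show ?thesis using 1 by (simp add: coroot_def op_comm_H_H)
  next
    case 2
    have "cartan_elt (coweight \<beta>) = (cartan_elt (\<lambda>k. of_bool (k = i) + of_bool (k = j)) :: ('r, 'n) yop)"
      using 2 by (intro arg_cong[where f = cartan_elt]) auto
    also have "\<dots> = (\<lambda>p. opH i i p + opH j j p)"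
      by (simp only: fun_eq_iff cartan_elt_add cartan_elt_delta) simp
    moreover have "i \<noteq> j" "j \<noteq> i" using 2 by auto
    ultimately show ?thesis using 2 by (simp add: coroot_def op_comm_P_K add.commute)
  next
    case 3
    have "cartan_elt (coweight \<beta>) = (cartan_elt (\<lambda>k. of_bool (k = i)) :: ('r, 'n) yop)"
      using 3 by (intro arg_cong[where f = cartan_elt]) auto
    \<comment> \<open>The factor 1/4 is the product of the normalisations 1/2 of
      \<open>opP g i i\<close> and \<open>opK g i i\<close>; it makes the coroot a single
      \<open>opH i i\<close>.\<close>
    moreover have "cst (1 / 4) * (h + h + h + h) = h" for h :: "('r, 'n) ypoly"
    proof -
      have "cst (1 / 4) * (h + h + h + h) = cst (1 / 4 + 1 / 4 + 1 / 4 + 1 / 4) * h"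
        by (simp only: cst_plus distrib_left distrib_right)
      then show ?thesis by simp
    qed
    ultimately show ?thesis using 3
      by (simp add: cartan_elt_delta coroot_def op_comm_P_K)
  qed
qed

lemma coweight_nonzero:
  fixes \<beta> :: "'r::{finite,linorder} pos_root"
  assumes "\<beta> \<in> d_roots g" obtains i where "coweight \<beta> i \<noteq> 0"
proof -
  obtain i j where "\<beta> = RootH i j \<and> i < j \<or> \<beta> = RootP i j"
    using assms by (auto simp: d_roots_def sl_roots_def t_roots_def)
  then have "coweight \<beta> i \<noteq> 0" by (elim disjE; cases "i = j") auto
  then show thesis by (rule that)
qed

text \<open>If the root vector e vanished, so would its bracket h with the negative root vector; but
  h has an eigenvector with non-zero eigenvalue.\<close>

lemma root_vec_nonzero:
  assumes "\<beta> \<in> d_roots g"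
  obtains p where "root_vec g \<beta> p \<noteq> (0 :: ('r::{finite,linorder}, 'n) ypoly)"
proof -
  obtain i where i: "coweight \<beta> i \<noteq> 0" using coweight_nonzero[OF assms] .
  obtain p :: "('r, 'n) ypoly" and \<mu> where p: "p \<noteq> 0" "\<mu> \<notin> {0}" "cartan_elt (coweight \<beta>) p = cst \<mu> * p"
    using cartan_elt_eigenvector[of "coweight \<beta>" i "{0}"] i by blast
  have lin: "op_linear (neg_root_vec g \<beta>)"
    by (cases \<beta>) (simp_all add: opH_linear opK_linear)
  have "cst \<mu> * p \<noteq> cst 0 * p" using p cst_mult_cancel[of p \<mu> 0] by simp
  then have "coroot g \<beta> p \<noteq> 0" using coroot_eq[OF assms] p by simp
  then have "root_vec g \<beta> (neg_root_vec g \<beta> p) \<noteq> 0 \<or> root_vec g \<beta> p \<noteq> 0"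
    by (auto simp: coroot_def op_comm_def op_linear_0[OF lin])
  then show thesis using that by blast
qed

text \<open>The description by \<open>THE\<close> in \<open>root_val\<close> determines a value
  because the root vector is not zero.\<close>

lemma root_val_eq:
  assumes "\<phi> \<in> d_roots g"
  shows "root_val g \<phi> (cartan_elt x :: ('r::{finite,linorder}, 'n) yop) = root_wt \<phi> x"
proof -
  obtain p :: "('r, 'n) ypoly" where p: "root_vec g \<phi> p \<noteq> 0" using root_vec_nonzero[OF assms] .
  show ?thesis unfolding root_val_def root_vec_weight
  proof (rule the_equality)
    fix c assume "op_scale (root_wt \<phi> x) (root_vec g \<phi>) = op_scale c (root_vec g \<phi> :: ('r, 'n) yop)"
    then have "cst (root_wt \<phi> x) * root_vec g \<phi> p = cst c * root_vec g \<phi> p"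
      unfolding op_scale_def by (rule fun_cong)
    then show "c = root_wt \<phi> x" using cst_mult_cancel[OF p] by simp
  qed simp
qed

lemma is_root_sum_iff:
  fixes \<phi> \<beta> \<gamma> :: "'r::{finite,linorder} pos_root"
  assumes "\<phi> \<in> d_roots g" "\<beta> \<in> d_roots g" "\<gamma> \<in> d_roots g"
  shows "is_root_sum g \<phi> \<beta> \<gamma> \<longleftrightarrow> (\<forall>x. root_wt \<phi> x = root_wt \<beta> x + root_wt \<gamma> x)"
  using assms by (auto simp: is_root_sum_def cartan_eq root_val_eq)

end

section \<open>The sum of the roots of t and the two shifts\<close>

lemma finite_d_roots: "finite (d_roots g :: 'r::{finite,linorder} pos_root set)"
proof -
  have "d_roots g \<subseteq> (\<lambda>(i, j). RootH i j) ` UNIV \<union> (\<lambda>(i, j). RootP i j) ` (UNIV :: ('r \<times> 'r) set)"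
    by (auto simp: d_roots_def sl_roots_def t_roots_def)
  then show ?thesis by (rule finite_subset) simp
qed

lemma sl_t_disjoint: "sl_roots \<inter> t_roots g = {}"
  by (auto simp: sl_roots_def t_roots_def)

text \<open>Every index lies in r - 1 of the pairs, so the sum is r - 1 times the trace of
  \<open>x\<close>. Formally, the second summands are renamed to pairs \<open>j < i\<close>, which
  together with \<open>i < j\<close> leave out only the diagonal.\<close>

lemma sum_pairs_less:
  fixes x :: "'r::{finite,linorder} \<Rightarrow> complex"
  assumes "sum x UNIV = 0"
  shows "(\<Sum>(i, j)\<in>{(i, j). i < j}. x i + x j) = 0"
proof -
  have "(\<Sum>(i, j)\<in>{(i, j). i < j}. x i + x j) = (\<Sum>(i, j)\<in>UNIV. if i < j then x i + x j else 0)"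
    by (rule sum.mono_neutral_cong_left) (auto split: if_splits)
  also have "\<dots> = (\<Sum>i\<in>UNIV. \<Sum>j\<in>UNIV. if i < j then x i else 0) + (\<Sum>i\<in>UNIV. \<Sum>j\<in>UNIV. if i < j then x j else 0)"
    by (simp add: sum.cartesian_product flip: UNIV_Times_UNIV sum.distrib) (intro sum.cong, auto)
  also have "(\<Sum>i\<in>UNIV. \<Sum>j\<in>UNIV. if i < j then x j else 0) = (\<Sum>i\<in>UNIV. \<Sum>j\<in>UNIV. if j < i then x i else 0)"
    by (rule sum.swap)
  also have "(\<Sum>i\<in>UNIV. \<Sum>j\<in>UNIV. if i < j then x i else 0) + \<dots> = (\<Sum>i\<in>UNIV. \<Sum>j\<in>UNIV. x i - (if j = i then x i else 0))"
    by (simp only: sum.distrib[symmetric]) (intro sum.cong, auto)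
  also have "\<dots> = 0"
    using assms by (simp add: sum_subtractf flip: sum_distrib_left)
  finally show ?thesis .
qed

text \<open>The off-diagonal roots contribute r - 1 times the trace, the diagonal ones, present only
  for symmetric \<open>g\<close>, twice the trace.\<close>

lemma sum_t_roots:
  fixes x :: "'r::{finite,linorder} \<Rightarrow> complex"
  assumes "sum x UNIV = 0"
  shows "(\<Sum>\<phi>\<in>t_roots g. root_wt \<phi> x) = 0"
proof -
  have "(\<Sum>\<phi>\<in>(\<lambda>(i, j). RootP i j) ` S. root_wt \<phi> x) = (\<Sum>(i, j)\<in>S. x i + x j)" for S
    by (subst sum.reindex) (auto simp: inj_on_def intro!: sum.cong)
  moreover define D :: "('r \<times> 'r) set" where "D = (if transpose g = g then (\<lambda>i. (i, i)) ` UNIV else {})"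
  moreover have "t_roots g = (\<lambda>(i, j). RootP i j) ` ({(i, j). i < j} \<union> D)"
    by (auto simp: t_roots_def D_def)
  moreover have "(\<Sum>(i, j)\<in>D. x i + x j) = 0"
  proof -
    have "(\<Sum>(i, j)\<in>(\<lambda>i. (i, i)) ` UNIV. x i + x j) = 0"
      using assms by (subst sum.reindex) (auto simp: inj_on_def simp flip: sum_distrib_left)
    then show ?thesis by (simp add: D_def)
  qed
  moreover have "(\<Sum>(i, j)\<in>{(i, j). i < j} \<union> D. x i + x j) =
      (\<Sum>(i, j)\<in>{(i, j). i < j}. x i + x j) + (\<Sum>(i, j)\<in>D. x i + x j)"
    by (rule sum.union_disjoint) (auto simp: D_def split: if_splits)
  ultimately show ?thesis using sum_pairs_less[OF assms] by simp
qed

lemma (in nondegenerate_form) rho_shift_sl: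
  assumes "\<beta> \<in> sl_roots"
  shows "rho_shift g (d_roots g) \<beta> = rho_shift g sl_roots (\<beta> :: 'r::{finite,linorder} pos_root)"
proof -
  have fin: "finite (sl_roots :: 'r pos_root set)" "finite (t_roots g :: 'r pos_root set)"
    using finite_d_roots[of g, where 'r = 'r] by (simp_all add: d_roots_def)
  obtain i j where ij: "\<beta> = RootH i j" using assms by (auto simp: sl_roots_def)
  have "sum (coweight \<beta>) UNIV = 0" by (simp add: ij sum_subtractf of_bool_def)
  then have "(\<Sum>\<phi>\<in>t_roots g. root_wt \<phi> (coweight \<beta>)) = 0" by (rule sum_t_roots)
  moreover have "coroot g \<beta> = cartan_elt (coweight \<beta>)" using assms by (simp add: coroot_eq d_roots_def)
  ultimately have "(\<Sum>\<phi>\<in>t_roots g. root_val g \<phi> (coroot g \<beta>)) = 0"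
    by (simp add: root_val_eq d_roots_def)
  then show ?thesis
    unfolding rho_shift_def d_roots_def by (subst sum.union_disjoint[OF fin sl_t_disjoint]) simp
qed

text \<open>
  Sorting by this key gives a normal ordering: adding a root of \<open>sl\<close> to a root of \<open>t\<close> raises the
  height but stays below all roots of \<open>sl\<close>, and \<open>i < j < k\<close> puts \<open>(i, k)\<close> between \<open>(i, j)\<close> and
  \<open>(j, k)\<close>.
\<close>

fun root_key :: "'r::{finite,linorder} pos_root \<Rightarrow> int" where
  "root_key (RootP i j) = ht i + ht j"
| "root_key (RootH i j) = 2 * int CARD('r) + ht i + ht j"

section \<open>Convexity of the order given by the keys, and existence of a normal ordering\<close>

text \<open>Indicator functions for \<open>x\<close> compare the coefficients of both sides. The
  coefficient -1 at \<open>a\<close> can only come from the start \<open>i\<close> or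
  \<open>k\<close> of a summand; once the common start is cancelled, the other three ends are
  forced.\<close>

lemma sl_root_sum_cases:
  fixes a b i j k l :: "'r::linorder"
  assumes sum: "\<And>x :: 'r \<Rightarrow> complex. x b - x a = (x j - x i) + (x l - x k)"
    and less: "a < b" "i < j" "k < l"
  shows "i = a \<and> j = k \<and> l = b \<or> k = a \<and> l = i \<and> j = b"
proof -
  have D: "of_bool (c = b) - of_bool (c = a) = of_bool (c = j) - of_bool (c = i) + (of_bool (c = l) - of_bool (c = k) :: int)" for c
  proof -
    have "complex_of_int (of_bool (c = b) - of_bool (c = a)) =
        complex_of_int (of_bool (c = j) - of_bool (c = i) + (of_bool (c = l) - of_bool (c = k)))"
      using sum[of "\<lambda>d. of_bool (c = d)"] by simp
    then show ?thesis by (simp only: of_int_eq_iff)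
  qed
  \<comment> \<open>The negative term at \<open>k\<close> cannot cancel against \<open>l\<close>, as
    \<open>k < l\<close>, so it cancels against \<open>j\<close>.\<close>
  have ends: "j = k \<and> l = b" if E: "\<And>c. of_bool (c = b) = of_bool (c = j) + of_bool (c = l) - (of_bool (c = k) :: int)"
    and "k < l" for j k l :: 'r
  proof -
    have "k \<noteq> l" using \<open>k < l\<close> by simp
    then have "j = k" using E[of k] by (cases "k = j"; cases "k = b") auto
    moreover have "l = b" using E[of l] \<open>k \<noteq> l\<close> by (cases "l = j"; cases "l = b") auto
    ultimately show ?thesis by simp
  qed
  have "i = a \<or> k = a"
    using D[of a] less(1) by (cases "a = i"; cases "a = k"; cases "a = j"; cases "a = l") (auto simp: of_bool_def split: if_splits)
  then show ?thesis
  proof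
    assume "i = a"
    then show ?thesis using ends[of j l k] D less(3) by simp
  next
    assume "k = a"
    then show ?thesis using ends[of l j i] D less(2) by simp
  qed
qed

lemma root_key_between:
  fixes \<phi> \<beta> \<gamma> :: "'r::{finite,linorder} pos_root"
  assumes roots: "\<phi> \<in> d_roots g" "\<beta> \<in> d_roots g" "\<gamma> \<in> d_roots g"
    and sum: "\<And>x. root_wt \<phi> x = root_wt \<beta> x + root_wt \<gamma> x"
  shows "root_key \<beta> < root_key \<phi> \<and> root_key \<phi> < root_key \<gamma> \<or>
    root_key \<gamma> < root_key \<phi> \<and> root_key \<phi> < root_key \<beta>"
proof -
  have PH: "root_key (RootP a b) < root_key (RootP k l) \<and> root_key (RootP k l) < root_key (RootH i j)"
    if "\<And>x. root_wt (RootP k l) x = root_wt (RootP a b) x + root_wt (RootH i j) x" "i < j"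
    for a b k l i j :: 'r
  proof -
    \<comment> \<open>Taking \<open>ht\<close> for \<open>x\<close> turns the relation between roots
      into one between keys.\<close>
    have "complex_of_int (ht k + ht l) = complex_of_int (ht a + ht b + (ht j - ht i))"
      using that(1)[of "\<lambda>i. of_int (ht i)"] by simp
    then have "ht k + ht l = ht a + ht b + (ht j - ht i)" by (simp only: of_int_eq_iff)
    then show ?thesis using ht_mono[OF that(2)] ht_le[of k] ht_le[of l] ht_pos[of i] ht_pos[of j] by simp
  qed
  have HH: ?thesis if H: "\<phi> = RootH a b" "\<beta> = RootH i j" "\<gamma> = RootH k l" and less: "a < b" "i < j" "k < l" for a b i j k l
  proof -
    have "i = a \<and> j = k \<and> l = b \<or> k = a \<and> l = i \<and> j = b"
      by (rule sl_root_sum_cases[OF _ less]) (use sum H in simp)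
    then show ?thesis using H less ht_mono[of i j] ht_mono[of k l] by auto
  qed
  \<comment> \<open>On the constant function 1 the roots of sl take the value 0 and those of t the
    value 2. Hence a root of t is a sum only of one root of each kind, and a root of sl only of two
    roots of sl.\<close>
  have one: "root_wt \<phi> (\<lambda>_. 1) = root_wt \<beta> (\<lambda>_. 1) + root_wt \<gamma> (\<lambda>_. 1)" by (rule sum)
  have cases: "(\<exists>i j. \<psi> = RootH i j \<and> i < j) \<or> (\<exists>i j. \<psi> = RootP i j)" if "\<psi> \<in> d_roots g" for \<psi> :: "'r pos_root"
    using that by (auto simp: d_roots_def sl_roots_def t_roots_def)
  show ?thesis
    using cases[OF roots(1)] cases[OF roots(2)] cases[OF roots(3)]
  proof (elim disjE exE conjE)
    fix a b i j k l assume "\<phi> = RootP a b" "\<beta> = RootP i j" "\<gamma> = RootH k l" "k < l"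
    then show ?thesis using PH[of a b i j k l] sum by simp
  next
    fix a b i j k l assume "\<phi> = RootP a b" "\<beta> = RootH i j" "i < j" "\<gamma> = RootP k l"
    then show ?thesis using PH[of a b k l i j] sum by (simp add: add.commute)
  qed (use one HH in auto)
qed

text \<open>Keeps the statement about all such orderings from being vacuous.\<close>

lemma (in nondegenerate_form) t_first_normal_ordering_exists:
  "\<exists>ws :: 'r::{finite,linorder} pos_root list. t_first_normal_ordering g ws"
proof -
  obtain xs :: "'r pos_root list" where xs: "set xs = d_roots g" "distinct xs"
    using finite_distinct_list[OF finite_d_roots] by blast
  define ws where "ws = sort_key root_key xs"
  have ws: "set ws = d_roots g" "distinct ws" "sorted (map root_key ws)"
    using xs by (simp_all add: ws_def)
  \<comment> \<open>Different roots may share a key, so only strict inequalities of keys are carried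
    over to positions.\<close>
  have less: "i < j" if "root_key (ws ! i) < root_key (ws ! j)" "i < length ws" "j < length ws" for i j
  proof (rule ccontr)
    assume "\<not> i < j"
    then have "root_key (ws ! j) \<le> root_key (ws ! i)"
      using sorted_nth_mono[OF ws(3), of j i] that by simp
    then show False using that by simp
  qed
  have "i < k \<and> k < j \<or> j < k \<and> k < i"
    if "i < length ws" "j < length ws" "k < length ws" "is_root_sum g (ws ! k) (ws ! i) (ws ! j)" for i j k
  proof -
    have in_roots: "ws ! i \<in> d_roots g" if "i < length ws" for i using ws(1) that nth_mem by blast
    have "root_key (ws ! i) < root_key (ws ! k) \<and> root_key (ws ! k) < root_key (ws ! j) \<or>
      root_key (ws ! j) < root_key (ws ! k) \<and> root_key (ws ! k) < root_key (ws ! i)"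
      using that is_root_sum_iff in_roots by (intro root_key_between) auto
    then show ?thesis using less that by blast
  qed
  moreover have "i < j" if "i < length ws" "j < length ws" "ws ! i \<in> t_roots g" "ws ! j \<in> sl_roots" for i j
  proof -
    obtain k l a b where "ws ! i = RootP k l" "ws ! j = RootH a b"
      using \<open>ws ! i \<in> t_roots g\<close> \<open>ws ! j \<in> sl_roots\<close> by (auto simp: t_roots_def sl_roots_def)
    then have "root_key (ws ! i) < root_key (ws ! j)"
      using ht_le[of k] ht_le[of l] ht_pos[of a] ht_pos[of b] by simp
    then show ?thesis using less that by blast
  qed
  ultimately have "t_first_normal_ordering g ws"
    using ws by (auto simp: t_first_normal_ordering_def normal_ordering_def)
  then show ?thesis ..
qed

section \<open>Splitting an ordering into roots of t and roots of sl\<close>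

lemma filter_partition:
  assumes "\<And>i j. i < length ws \<Longrightarrow> j < length ws \<Longrightarrow> P (ws ! i) \<Longrightarrow> \<not> P (ws ! j) \<Longrightarrow> i < j"
  shows "ws = filter P ws @ filter (\<lambda>x. \<not> P x) ws"
  using assms
proof (induction ws)
  case (Cons w ws)
  show ?case
  proof (cases "P w")
    case True
    have "ws = filter P ws @ filter (\<lambda>x. \<not> P x) ws"
      using Cons.prems[of "Suc _" "Suc _"] by (intro Cons.IH) auto
    then show ?thesis using True by simp
  next
    case False
    have "\<not> P (ws ! i)" if "i < length ws" for i
      using Cons.prems[of "Suc i" 0] that False by auto
    then have "\<forall>x\<in>set ws. \<not> P x" by (auto simp: in_set_conv_nth)
    then have "filter P ws = []" "filter (\<lambda>x. \<not> P x) ws = ws" by (auto simp: filter_empty_conv)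
    then show ?thesis using False by simp
  qed
qed simp

lemma t_first_split:
  assumes "t_first_normal_ordering g ws"
  shows "ws = filter (\<lambda>\<beta>. \<beta> \<in> t_roots g) ws @ filter (\<lambda>\<beta>. \<beta> \<in> sl_roots) ws"
proof -
  have sets: "set ws = sl_roots \<union> t_roots g"
    using assms by (auto simp: t_first_normal_ordering_def normal_ordering_def d_roots_def)
  then have "\<beta> \<in> sl_roots \<longleftrightarrow> \<beta> \<notin> t_roots g" if "\<beta> \<in> set ws" for \<beta>
    using that sl_t_disjoint by blast
  then have "filter (\<lambda>\<beta>. \<beta> \<in> sl_roots) ws = filter (\<lambda>\<beta>. \<beta> \<notin> t_roots g) ws"
    by (intro filter_cong) auto
  moreover have "ws = filter (\<lambda>\<beta>. \<beta> \<in> t_roots g) ws @ filter (\<lambda>\<beta>. \<beta> \<notin> t_roots g) ws"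
  proof (rule filter_partition)
    fix i j assume "i < length ws" "j < length ws" "ws ! i \<in> t_roots g" "ws ! j \<notin> t_roots g"
    then show "i < j" using assms sets nth_mem[of j ws]
      by (auto simp: t_first_normal_ordering_def)
  qed
  ultimately show ?thesis by simp
qed

text \<open>The roots of sl form the final segment of \<open>ws\<close>, so their positions only
  shift by the length of the t part and betweenness is inherited.\<close>

lemma normal_ordering_sl:
  assumes "t_first_normal_ordering g ws"
  shows "normal_ordering g sl_roots (filter (\<lambda>\<beta>. \<beta> \<in> sl_roots) ws)"
proof -
  define ts where "ts = filter (\<lambda>\<beta>. \<beta> \<in> t_roots g) ws"
  define ss where "ss = filter (\<lambda>\<beta>. \<beta> \<in> sl_roots) ws"
  have ws: "ws = ts @ ss" unfolding ts_def ss_def by (rule t_first_split[OF assms])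
  have normal: "normal_ordering g (d_roots g) ws"
    using assms by (simp add: t_first_normal_ordering_def)
  have "i < k \<and> k < j \<or> j < k \<and> k < i"
    if "i < length ss" "j < length ss" "k < length ss" "is_root_sum g (ss ! k) (ss ! i) (ss ! j)" for i j k
  proof -
    let ?n = "length ts"
    have nth: "ws ! (?n + m) = ss ! m" for m by (simp add: ws)
    have "?n + i < ?n + k \<and> ?n + k < ?n + j \<or> ?n + j < ?n + k \<and> ?n + k < ?n + i"
      using normal that unfolding normal_ordering_def
      by (metis nth ws length_append nat_add_left_cancel_less)
    then show ?thesis by simp
  qed
  moreover have "distinct ss" "set ss = sl_roots"
    using normal by (auto simp: ss_def normal_ordering_def d_roots_def)
  ultimately show ?thesis unfolding ss_def[symmetric] normal_ordering_def by blast
qed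

section \<open>Free algebras\<close>

lemma letters_simps [simp]: "letters 0 = []" "letters (v + w) = letters v @ letters w"
  by (simp_all add: zero_fword_def plus_fword_def)

lemma free_algebra_simps [simp]:
  "\<zero>\<^bsub>free_algebra S\<^esub> = 0" "\<one>\<^bsub>free_algebra S\<^esub> = 1"
  "mult (free_algebra S) = (*)" "add (free_algebra S) = (+)"
  by (simp_all add: free_algebra_def)

lemma free_algebra_carrier:
  "u \<in> carrier (free_algebra S) \<longleftrightarrow> (\<forall>w\<in>Poly_Mapping.keys u. set (letters w) \<subseteq> S)"
  by (simp add: free_algebra_def)

lemma free_algebra_single: "set (letters w) \<subseteq> S \<Longrightarrow> Poly_Mapping.single w c \<in> carrier (free_algebra S)"
  by (simp add: free_algebra_carrier)

lemma free_algebra_cst: "cst c \<in> carrier (free_algebra S)"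
  unfolding cst_def by (rule free_algebra_single) simp

lemma free_algebra_gen: "x \<in> S \<Longrightarrow> gen x \<in> carrier (free_algebra S)"
  unfolding gen_def by (rule free_algebra_single) simp

lemma free_algebra_zero: "0 \<in> carrier (free_algebra S)"
  and free_algebra_one: "1 \<in> carrier (free_algebra S)"
  using free_algebra_cst[of 0] free_algebra_cst[of 1] by simp_all

lemma free_algebra_add:
  "u \<in> carrier (free_algebra S) \<Longrightarrow> v \<in> carrier (free_algebra S) \<Longrightarrow> u + v \<in> carrier (free_algebra S)"
  using keys_add[of u v] by (auto simp: free_algebra_carrier)

lemma free_algebra_mult:
  "u \<in> carrier (free_algebra S) \<Longrightarrow> v \<in> carrier (free_algebra S) \<Longrightarrow> u * v \<in> carrier (free_algebra S)"
  using keys_mult[of u v] unfolding free_algebra_carrier by fastforce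

lemma free_algebra_uminus: "u \<in> carrier (free_algebra S) \<Longrightarrow> - u \<in> carrier (free_algebra S)"
  using free_algebra_mult[OF free_algebra_cst[of "-1"]] by fastforce

lemma free_algebra_diff:
  "u \<in> carrier (free_algebra S) \<Longrightarrow> v \<in> carrier (free_algebra S) \<Longrightarrow> u - v \<in> carrier (free_algebra S)"
  using free_algebra_add[OF _ free_algebra_uminus] by fastforce

lemma free_algebra_power: "u \<in> carrier (free_algebra S) \<Longrightarrow> u ^ k \<in> carrier (free_algebra S)"
  by (induction k) (simp_all add: free_algebra_one free_algebra_mult)

lemma free_algebra_prod_list:
  "(\<And>u. u \<in> set us \<Longrightarrow> u \<in> carrier (free_algebra S)) \<Longrightarrow> prod_list us \<in> carrier (free_algebra S)"
  by (induction us) (simp_all add: free_algebra_one free_algebra_mult)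

lemma free_algebra_sum:
  "(\<And>i. i \<in> A \<Longrightarrow> f i \<in> carrier (free_algebra S)) \<Longrightarrow> sum f A \<in> carrier (free_algebra S)"
  by (induction A rule: infinite_finite_induct) (simp_all add: free_algebra_zero free_algebra_add)

lemma free_algebra_mono: "S \<subseteq> T \<Longrightarrow> carrier (free_algebra S) \<subseteq> carrier (free_algebra T)"
  by (simp add: free_algebra_carrier subset_iff)

lemmas free_algebra_arith = free_algebra_cst free_algebra_zero free_algebra_one
  free_algebra_add free_algebra_mult free_algebra_uminus free_algebra_diff free_algebra_power

lemmas free_algebra_closed = free_algebra_arith free_algebra_gen

lemma free_algebra_ring: "ring (free_algebra S)"
proof -
  have "\<exists>y\<in>carrier (free_algebra S). y + x = 0" if "x \<in> carrier (free_algebra S)" for x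
    using that by (intro bexI[of _ "- x"]) (simp_all add: free_algebra_uminus)
  then have "abelian_group (free_algebra S)"
    by (intro abelian_groupI) (simp_all add: free_algebra_closed add_ac)
  moreover have "Group.monoid (free_algebra S)"
    by (intro Group.monoidI) (simp_all add: free_algebra_closed mult.assoc)
  ultimately show ?thesis
    by (rule ringI) (simp_all add: distrib_left distrib_right)
qed

text \<open>Closure under negation is supplied by multiplication with the scalar -1.\<close>

lemma free_algebra_idealI:
  assumes "J \<subseteq> carrier (free_algebra S)" "0 \<in> J" "\<And>u v. u \<in> J \<Longrightarrow> v \<in> J \<Longrightarrow> u + v \<in> J"
    and left: "\<And>u a. u \<in> J \<Longrightarrow> a \<in> carrier (free_algebra S) \<Longrightarrow> a * u \<in> J"
    and right: "\<And>u a. u \<in> J \<Longrightarrow> a \<in> carrier (free_algebra S) \<Longrightarrow> u * a \<in> J"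
  shows "ideal J (free_algebra S)"
proof (rule idealI[OF free_algebra_ring])
  interpret ring "free_algebra S" by (rule free_algebra_ring)
  show "subgroup J (add_monoid (free_algebra S))"
  proof (rule add.subgroupI)
    fix u assume "u \<in> J"
    then have "- u \<in> J" using left[OF _ free_algebra_cst[of "- 1"]] by fastforce
    moreover have "u \<in> carrier (free_algebra S)" using \<open>u \<in> J\<close> assms(1) by blast
    then have "\<ominus>\<^bsub>free_algebra S\<^esub> u = - u"
      using minus_equality[of "- u" u] by (simp add: free_algebra_uminus)
    ultimately show "\<ominus>\<^bsub>free_algebra S\<^esub> u \<in> J" by simp
  qed (use assms in auto)
qed (use left right in auto)

lemma free_algebra_induct [consumes 1, case_names single add]:
  assumes "u \<in> carrier (free_algebra S)"
    and "\<And>w c. set (letters w) \<subseteq> S \<Longrightarrow> P (Poly_Mapping.single w c)"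
    and "\<And>u v. P u \<Longrightarrow> P v \<Longrightarrow> P (u + v)"
  shows "P u"
  using assms(1)
proof (induction u rule: update_induct)
  case const
  show ?case using assms(2)[of 0 0] by simp
next
  case (update u w c)
  have "Poly_Mapping.update w c u = u + Poly_Mapping.single w c"
    using update(1) by (intro poly_mapping_eqI) (auto simp: lookup_update lookup_add lookup_single when_def in_keys_iff)
  moreover have "u \<in> carrier (free_algebra S)" "set (letters w) \<subseteq> S"
    using update by (auto simp: free_algebra_carrier keys_update)
  ultimately show ?case using update.IH assms(2,3) by simp
qed

lemma cst_commute: "u * cst c = cst c * (u :: 'x free_alg)"
  by (induction u rule: poly_mapping_additive_induct)
    (simp_all add: cst_def mult_single distrib_left distrib_right mult.commute)

lemma mult_cst_left: "u * (cst c * v) = cst c * (u * (v :: 'x free_alg))"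
  by (metis cst_commute mult.assoc)

lemma emb_single: "emb (Poly_Mapping.single w c) = Poly_Mapping.single (FWord (map Elt (letters w))) c"
  by (simp add: emb_def)

lemma emb_add: "emb (u + v) = emb u + emb v"
  unfolding emb_def by (rule setsum_keys_plus_distrib) (simp_all add: single_add)

lemma emb_cst [simp]: "emb (cst c) = cst c"
  by (simp add: cst_def emb_single) (simp add: zero_fword_def)

lemma emb_gen [simp]: "emb (gen x) = gen (Elt x)"
  by (simp add: gen_def emb_single)

lemma emb_mult: "emb (u * v) = emb u * emb v"
proof (induction u rule: poly_mapping_additive_induct)
  case (single w c)
  show ?case
    by (induction v rule: poly_mapping_additive_induct)
      (simp_all add: emb_single emb_add mult_single distrib_left plus_fword_def)
qed (simp add: emb_add distrib_right)

lemma emb_one [simp]: "emb 1 = 1"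
  using emb_cst[of 1] by simp

lemma emb_diff: "emb (u - v) = emb u - emb v"
  using emb_add[of u "cst (- 1) * v"] by (simp only: emb_mult emb_cst) simp

lemma emb_carrier:
  assumes "u \<in> carrier (free_algebra S)" shows "emb u \<in> carrier (free_algebra (Elt ` S))"
  using assms by (induction rule: free_algebra_induct)
    (simp_all add: emb_single emb_add free_algebra_single free_algebra_add image_mono)

section \<open>The action of the enveloping algebra on polynomials\<close>

text \<open>Letters are themselves operators and \<open>foldr\<close> lets the rightmost act first,
  so that products become compositions. This multiplicativity relies on the letters of the left
  factor being linear.\<close>

definition word_act :: "('r, 'n) yop free_alg \<Rightarrow> ('r, 'n) yop" where
  "word_act u p = (\<Sum>w\<in>Poly_Mapping.keys u. cst (Poly_Mapping.lookup u w) * foldr (\<lambda>A q. A q) (letters w) p)"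

lemma op_linear_word: "(\<And>A. A \<in> set As \<Longrightarrow> op_linear A) \<Longrightarrow> op_linear (foldr (\<lambda>A q. A q) As)"
  by (induction As) (simp_all add: op_linear_def)

lemma word_act_add: "word_act (u + v) p = word_act u p + word_act v p"
  unfolding word_act_def by (rule setsum_keys_plus_distrib) (simp_all add: cst_plus distrib_right)

lemma word_act_single: "word_act (Poly_Mapping.single w c) p = cst c * foldr (\<lambda>A q. A q) (letters w) p"
  by (simp add: word_act_def)

lemma word_act_gen: "word_act (gen A) p = A p"
  by (simp add: gen_def word_act_single)

lemma word_act_cst: "word_act (cst c) p = cst c * p"
  by (subst (1) cst_def) (simp add: word_act_single)

lemma word_act_single_mult:
  assumes "\<And>A. A \<in> set (letters w) \<Longrightarrow> op_linear A"
  shows "word_act (Poly_Mapping.single w c * v) p = cst c * foldr (\<lambda>A q. A q) (letters w) (word_act v p)"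
proof -
  note lin = op_linear_word[OF assms]
  show ?thesis
    by (induction v rule: poly_mapping_additive_induct)
      (simp_all add: mult_single word_act_single word_act_add distrib_left cst_mult mult.assoc
        op_linear_add[OF lin] op_linear_scale[OF lin])
qed

lemma word_act_mult:
  assumes "\<And>A. A \<in> S \<Longrightarrow> op_linear A" "u \<in> carrier (free_algebra S)"
  shows "word_act (u * v) p = word_act u (word_act v p)"
  using assms(2)
proof (induction rule: free_algebra_induct)
  case (single w c)
  then show ?case by (subst word_act_single_mult) (use assms(1) in \<open>auto simp: word_act_single\<close>)
qed (simp add: word_act_add distrib_right)

lemma word_act_cst_mult: "word_act (cst c * v) p = cst c * word_act v p"
  using word_act_single_mult[of 0 c v p] by (simp add: cst_def)

lemma word_act_zero: "word_act 0 p = 0"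
  using word_act_cst_mult[of 0 0 p] by simp

lemma word_act_minus: "word_act (- u) p = - word_act u p"
  using word_act_cst_mult[of "- 1" u p] by simp

lemma word_act_diff: "word_act (u - v) p = word_act u p - word_act v p"
  using word_act_add[of u "- v" p] by (simp add: word_act_minus)

section \<open>The localised algebra\<close>

text \<open>The closure conditions put every letter occurring in \<open>env_rels L\<close> into
  \<open>L\<close>, so that the relations lie in the carrier of the free algebra and generate an
  ideal of it.\<close>

locale operator_lie_algebra =
  fixes L C n :: "('r, 'n) yop set"
  assumes linear: "A \<in> L \<Longrightarrow> op_linear A"
    and L_plus: "A \<in> L \<Longrightarrow> B \<in> L \<Longrightarrow> op_plus A B \<in> L"
    and L_scale: "A \<in> L \<Longrightarrow> op_scale c A \<in> L"
    and L_comm: "A \<in> L \<Longrightarrow> B \<in> L \<Longrightarrow> op_comm A B \<in> L"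
    and L_nonempty: "L \<noteq> {}"
    and C_subset: "C \<subseteq> L"
    and n_subset: "n \<subseteq> L"
begin

lemma env_rels_subset: "env_rels L \<subseteq> carrier (free_algebra L)"
  unfolding env_rels_def by (auto intro!: free_algebra_closed L_plus L_scale L_comm)

text \<open>The elements acting by zero form an ideal that contains the relations, hence contains
  \<open>env_ideal L\<close>. Used contrapositively, to recognise denominators.\<close>

lemma env_ideal_act:
  assumes "u \<in> env_ideal L" shows "word_act u p = 0"
proof -
  let ?J = "{u \<in> carrier (free_algebra L). \<forall>p. word_act u p = 0}"
  interpret ring "free_algebra L" by (rule free_algebra_ring)
  note mult = word_act_mult[of L, OF linear]
  \<comment> \<open>For closure under left multiplication: the product with an element acting by
    zero acts as \<open>word_act a\<close> applied to 0.\<close>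
  have zero: "word_act a 0 = 0" if "a \<in> carrier (free_algebra L)" for a
    using that
  proof (induction rule: free_algebra_induct)
    case (single w c)
    then have "op_linear (foldr (\<lambda>A q. A q) (letters w))" by (intro op_linear_word linear) auto
    then show ?case by (simp add: word_act_single op_linear_0)
  qed (simp add: word_act_add)
  have "ideal ?J (free_algebra L)"
    by (rule free_algebra_idealI) (auto simp: word_act_zero word_act_add mult zero free_algebra_closed)
  moreover have "env_rels L \<subseteq> ?J"
  proof
    fix u assume u: "u \<in> env_rels L"
    have "word_act u p = 0" for p
      using u unfolding env_rels_def
      by (auto simp: word_act_add word_act_diff word_act_gen word_act_cst_mult mult
          free_algebra_gen op_plus_def op_scale_def op_comm_def)
    then show "u \<in> ?J" using u env_rels_subset by auto
  qed
  ultimately have "env_ideal L \<subseteq> ?J" unfolding env_ideal_def by (rule genideal_minimal)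
  then show ?thesis using assms by auto
qed

abbreviation loc_carrier :: "('r, 'n) yop loc_letter free_alg set" where
  "loc_carrier \<equiv> carrier (free_algebra (loc_letters L C))"

abbreviation ltr :: "('r, 'n) yop \<Rightarrow> ('r, 'n) yop loc_letter free_alg" where
  "ltr X \<equiv> gen (Elt X)"

lemma loc_ideal_alt: "loc_ideal L C = Idl\<^bsub>free_algebra (loc_letters L C)\<^esub> (loc_rels L C)"
  by (simp add: loc_ideal_def loc_algebra_def)

lemma ltr_closed: "X \<in> L \<Longrightarrow> ltr X \<in> loc_carrier"
  by (rule free_algebra_gen) (simp add: loc_letters_def)

lemma emb_closed: "u \<in> carrier (free_algebra L) \<Longrightarrow> emb u \<in> loc_carrier"
  using emb_carrier[of u L] free_algebra_mono[of "Elt ` L" "loc_letters L C"] by (auto simp: loc_letters_def)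

lemma Inv_closed: "u \<in> denominators L C \<Longrightarrow> gen (Inv u) \<in> loc_carrier"
  by (rule free_algebra_gen) (simp add: loc_letters_def)

lemma denominators_closed: "u \<in> denominators L C \<Longrightarrow> u \<in> carrier (free_algebra L)"
  using free_algebra_mono[OF C_subset] by (auto simp: denominators_def)

lemmas loc_closed = free_algebra_arith[where S = "loc_letters L C"]
  free_algebra_sum[where S = "loc_letters L C"] free_algebra_prod_list[where S = "loc_letters L C"]
  ltr_closed Inv_closed emb_closed

lemma loc_rels_subset: "loc_rels L C \<subseteq> loc_carrier"
  unfolding loc_rels_def using env_rels_subset
  by (auto intro!: loc_closed intro: denominators_closed)

lemma loc_ideal: "ideal (loc_ideal L C) (free_algebra (loc_letters L C))"
proof -
  interpret ring "free_algebra (loc_letters L C)" by (rule free_algebra_ring)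
  show ?thesis unfolding loc_ideal_alt by (rule genideal_ideal[OF loc_rels_subset])
qed

lemma loc_rels_in_ideal: "u \<in> loc_rels L C \<Longrightarrow> u \<in> loc_ideal L C"
proof -
  interpret ring "free_algebra (loc_letters L C)" by (rule free_algebra_ring)
  show "u \<in> loc_rels L C \<Longrightarrow> u \<in> loc_ideal L C"
    unfolding loc_ideal_alt using genideal_self[OF loc_rels_subset] by blast
qed

lemma loc_ideal_subset: "u \<in> loc_ideal L C \<Longrightarrow> u \<in> loc_carrier"
  using additive_subgroup.a_subset[OF ideal.axioms(1)[OF loc_ideal]] by blast

lemma loc_ideal_zero: "0 \<in> loc_ideal L C"
  using additive_subgroup.zero_closed[OF ideal.axioms(1)[OF loc_ideal]] by simp

lemma loc_ideal_add: "u \<in> loc_ideal L C \<Longrightarrow> v \<in> loc_ideal L C \<Longrightarrow> u + v \<in> loc_ideal L C"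
  using additive_subgroup.a_closed[OF ideal.axioms(1)[OF loc_ideal]] by simp

lemma loc_ideal_left: "u \<in> loc_ideal L C \<Longrightarrow> a \<in> loc_carrier \<Longrightarrow> a * u \<in> loc_ideal L C"
  using ideal.I_l_closed[OF loc_ideal] by simp

lemma loc_ideal_right: "u \<in> loc_ideal L C \<Longrightarrow> a \<in> loc_carrier \<Longrightarrow> u * a \<in> loc_ideal L C"
  using ideal.I_r_closed[OF loc_ideal] by simp

lemma loc_ideal_minus: "u \<in> loc_ideal L C \<Longrightarrow> - u \<in> loc_ideal L C"
  using loc_ideal_left[OF _ free_algebra_cst[of "- 1"]] by fastforce

text \<open>Equality in the localised algebra, stated for representatives so that computations can
  be chained.\<close>

definition loc_eq :: "('r, 'n) yop loc_letter free_alg \<Rightarrow> ('r, 'n) yop loc_letter free_alg \<Rightarrow> bool" (infix \<open>\<doteq>\<close> 50)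
  where "u \<doteq> v \<longleftrightarrow> u - v \<in> loc_ideal L C"

lemma loc_eq_refl [simp]: "u \<doteq> u"
  by (simp add: loc_eq_def loc_ideal_zero)

lemma loc_eq_sym: "u \<doteq> v \<Longrightarrow> v \<doteq> u"
  unfolding loc_eq_def using loc_ideal_minus by fastforce

lemma loc_eq_trans [trans]: "u \<doteq> v \<Longrightarrow> v \<doteq> w \<Longrightarrow> u \<doteq> w"
  unfolding loc_eq_def using loc_ideal_add by fastforce

lemma loc_eq_add: "u \<doteq> v \<Longrightarrow> u' \<doteq> v' \<Longrightarrow> u + u' \<doteq> v + v'"
  unfolding loc_eq_def add_diff_add by (rule loc_ideal_add)

lemma loc_eq_left: "u \<doteq> v \<Longrightarrow> a \<in> loc_carrier \<Longrightarrow> a * u \<doteq> a * v"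
  unfolding loc_eq_def right_diff_distrib[symmetric] by (rule loc_ideal_left)

lemma loc_eq_right: "u \<doteq> v \<Longrightarrow> a \<in> loc_carrier \<Longrightarrow> u * a \<doteq> v * a"
  unfolding loc_eq_def left_diff_distrib[symmetric] by (rule loc_ideal_right)

lemma loc_eq_zero_iff: "u \<doteq> 0 \<longleftrightarrow> u \<in> loc_ideal L C"
  by (simp add: loc_eq_def)

lemma emb_rel: "u \<in> env_rels L \<Longrightarrow> emb u \<doteq> 0"
  unfolding loc_eq_zero_iff by (rule loc_rels_in_ideal) (simp add: loc_rels_def)

lemma ltr_plus:
  assumes "A \<in> L" "B \<in> L" shows "ltr (op_plus A B) \<doteq> ltr A + ltr B"
proof -
  have "gen (op_plus A B) - gen A - gen B \<in> env_rels L"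
    unfolding env_rels_def using assms by blast
  from emb_rel[OF this] show ?thesis by (simp add: emb_add emb_diff loc_eq_def diff_diff_eq)
qed

lemma ltr_scale:
  assumes "A \<in> L" shows "ltr (op_scale c A) \<doteq> cst c * ltr A"
proof -
  have "gen (op_scale c A) - cst c * gen A \<in> env_rels L"
    unfolding env_rels_def using assms by blast
  from emb_rel[OF this] show ?thesis by (simp add: emb_diff emb_mult loc_eq_def)
qed

lemma ltr_comm:
  assumes "A \<in> L" "B \<in> L" shows "ltr A * ltr B \<doteq> ltr B * ltr A + ltr (op_comm A B)"
proof -
  have "gen A * gen B - gen B * gen A - gen (op_comm A B) \<in> env_rels L"
    unfolding env_rels_def using assms by blast
  from emb_rel[OF this] show ?thesis by (simp add: emb_add emb_diff emb_mult loc_eq_def diff_diff_eq)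
qed

lemma Inv_left: "u \<in> denominators L C \<Longrightarrow> gen (Inv u) * emb u \<doteq> 1"
  and Inv_right: "u \<in> denominators L C \<Longrightarrow> emb u * gen (Inv u) \<doteq> 1"
  unfolding loc_eq_def by (auto intro!: loc_rels_in_ideal simp: loc_rels_def)

lemma op_scale_zero: "op_scale 0 A = (\<lambda>p. 0)"
  by (simp add: op_scale_def)

lemma ltr_zero: "ltr (\<lambda>p. 0) \<doteq> 0"
  using ltr_scale[of _ 0] L_nonempty by (auto simp: op_scale_zero)

subsection \<open>The filtration by the left ideals\<close>

abbreviation LP :: "nat \<Rightarrow> ('r, 'n) yop loc_letter free_alg set" where
  "LP \<equiv> left_ideal_pow L C n"

lemma LP_memI:
  fixes k :: nat
  assumes "u = (\<Sum>i<k. a i * prod_list (map ltr (w i))) + z" "z \<in> loc_ideal L C"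
    and "\<And>i. i < k \<Longrightarrow> a i \<in> loc_carrier \<and> set (w i) \<subseteq> n \<and> length (w i) = m"
  shows "u \<in> LP m"
  unfolding left_ideal_pow_def loc_algebra_def using assms by blast

lemma LP_memE:
  assumes "u \<in> LP m"
  obtains k :: nat and a w z where "u = (\<Sum>i<k. a i * prod_list (map ltr (w i))) + z" "z \<in> loc_ideal L C"
    "\<And>i. i < k \<Longrightarrow> a i \<in> loc_carrier \<and> set (w i) \<subseteq> n \<and> length (w i) = m"
  using assms unfolding left_ideal_pow_def loc_algebra_def by blast

lemma LP_ideal: "z \<in> loc_ideal L C \<Longrightarrow> z \<in> LP m"
  by (rule LP_memI[where k = 0]) simp_all

lemma LP_prod:
  assumes "a \<in> loc_carrier" "set w \<subseteq> n"
  shows "a * prod_list (map ltr w) \<in> LP (length w)"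
  using assms loc_ideal_zero
  by (intro LP_memI[where k = 1 and a = "\<lambda>_. a" and w = "\<lambda>_. w" and z = 0]) simp_all

lemma LP_add:
  assumes "u \<in> LP m" "v \<in> LP m"
  shows "u + v \<in> LP m"
proof -
  obtain k :: nat and a w z where u: "u = (\<Sum>i<k. a i * prod_list (map ltr (w i))) + z" "z \<in> loc_ideal L C"
    "\<And>i. i < k \<Longrightarrow> a i \<in> loc_carrier \<and> set (w i) \<subseteq> n \<and> length (w i) = m"
    using assms(1) by (rule LP_memE) blast
  obtain l :: nat and b x y where v: "v = (\<Sum>i<l. b i * prod_list (map ltr (x i))) + y" "y \<in> loc_ideal L C"
    "\<And>i. i < l \<Longrightarrow> b i \<in> loc_carrier \<and> set (x i) \<subseteq> n \<and> length (x i) = m"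
    using assms(2) by (rule LP_memE) blast
  define c where "c i = (if i < k then a i else b (i - k))" for i
  define t where "t i = (if i < k then w i else x (i - k))" for i
  have "(\<Sum>i<k + l. c i * prod_list (map ltr (t i))) =
      (\<Sum>i<k. c i * prod_list (map ltr (t i))) + (\<Sum>i<l. c (k + i) * prod_list (map ltr (t (k + i))))"
    by (induction l) (simp_all add: add.assoc)
  then have "u + v = (\<Sum>i<k + l. c i * prod_list (map ltr (t i))) + (z + y)"
    using u(1) v(1) by (simp add: c_def t_def)
  moreover have "c i \<in> loc_carrier \<and> set (t i) \<subseteq> n \<and> length (t i) = m" if "i < k + l" for i
    using that u(3)[of i] v(3)[of "i - k"] by (cases "i < k") (auto simp: c_def t_def)
  ultimately show ?thesis
    using loc_ideal_add[OF u(2) v(2)]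
    by (intro LP_memI[where k = "k + l" and a = c and w = t and z = "z + y"])
qed

lemma LP_induct [consumes 1, case_names ideal prod add]:
  assumes "u \<in> LP m" and ideal: "\<And>z. z \<in> loc_ideal L C \<Longrightarrow> P z"
    and prod: "\<And>a w. a \<in> loc_carrier \<Longrightarrow> set w \<subseteq> n \<Longrightarrow> length w = m \<Longrightarrow> P (a * prod_list (map ltr w))"
    and add: "\<And>u v. u \<in> LP m \<Longrightarrow> v \<in> LP m \<Longrightarrow> P u \<Longrightarrow> P v \<Longrightarrow> P (u + v)"
  shows "P u"
proof -
  obtain k :: nat and a w z where u: "u = (\<Sum>i<k. a i * prod_list (map ltr (w i))) + z" "z \<in> loc_ideal L C"
    "\<And>i. i < k \<Longrightarrow> a i \<in> loc_carrier \<and> set (w i) \<subseteq> n \<and> length (w i) = m"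
    using assms(1) by (rule LP_memE) blast
  have "P (\<Sum>i<j. a i * prod_list (map ltr (w i))) \<and> (\<Sum>i<j. a i * prod_list (map ltr (w i))) \<in> LP m" if "j \<le> k" for j
    using that
  proof (induction j)
    case 0
    then show ?case using ideal LP_ideal loc_ideal_zero by simp
  next
    case (Suc j)
    then have "a j * prod_list (map ltr (w j)) \<in> LP m" using u(3)[of j] LP_prod[of "a j" "w j"] by simp
    then show ?case using Suc u(3)[of j] by (auto intro!: add prod LP_add)
  qed
  then show ?thesis unfolding u(1) using ideal[OF u(2)] LP_ideal[OF u(2)] by (auto intro!: add)
qed

lemma ltr_word_closed: "set w \<subseteq> n \<Longrightarrow> prod_list (map ltr w) \<in> loc_carrier"
  using n_subset by (intro loc_closed) (auto intro!: loc_closed)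

lemma LP_closed: "u \<in> LP m \<Longrightarrow> u \<in> loc_carrier"
  by (induction rule: LP_induct) (simp_all add: loc_ideal_subset loc_closed ltr_word_closed)

lemma LP_0: "LP 0 = loc_carrier"
  using LP_closed LP_prod[of _ "[]"] by auto

lemma LP_left: "u \<in> LP m \<Longrightarrow> c \<in> loc_carrier \<Longrightarrow> c * u \<in> LP m"
proof (induction rule: LP_induct)
  case (prod a w)
  then show ?case using LP_prod[of "c * a" w] by (simp add: loc_closed mult.assoc)
qed (simp_all add: LP_ideal loc_ideal_left distrib_left LP_add)

lemma LP_minus: "u \<in> LP m \<Longrightarrow> - u \<in> LP m"
  using LP_left[OF _ free_algebra_cst[of "- 1"]] by fastforce

lemma LP_diff: "u \<in> LP m \<Longrightarrow> v \<in> LP m \<Longrightarrow> u - v \<in> LP m"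
  using LP_add[OF _ LP_minus] by fastforce

lemma LP_sum: "(\<And>i. i \<in> I \<Longrightarrow> f i \<in> LP m) \<Longrightarrow> sum f I \<in> LP m"
  by (induction I rule: infinite_finite_induct) (simp_all add: LP_add LP_ideal loc_ideal_zero)

lemma LP_cong: "u \<in> LP m \<Longrightarrow> v \<doteq> u \<Longrightarrow> v \<in> LP m"
  using LP_add[OF LP_ideal[of "v - u"]] by (fastforce simp: loc_eq_def)

text \<open>The surplus letters at the front of each word are absorbed into its coefficient.\<close>

lemma LP_antimono:
  assumes "u \<in> LP m" "k \<le> m" shows "u \<in> LP k"
  using assms
proof (induction rule: LP_induct)
  case (prod a w)
  have "a * prod_list (map ltr (take (m - k) w)) \<in> loc_carrier"
    using prod set_take_subset[of "m - k" w] by (intro loc_closed ltr_word_closed) auto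
  then have "a * prod_list (map ltr (take (m - k) w)) * prod_list (map ltr (drop (m - k) w)) \<in> LP (length (drop (m - k) w))"
    using prod set_drop_subset[of "m - k" w] by (intro LP_prod) auto
  then show ?case using prod
    by (simp add: mult.assoc flip: prod_list.append map_append)
qed (simp_all add: LP_ideal LP_add)

lemma LP_mult_n:
  assumes "X \<in> n" "u \<in> LP m"
  shows "u * ltr X \<in> LP (Suc m)"
  using assms(2)
proof (induction rule: LP_induct)
  case (ideal z)
  then show ?case using assms(1) n_subset by (intro LP_ideal loc_ideal_right loc_closed) auto
next
  case (prod a w)
  then show ?case using LP_prod[of a "w @ [X]"] assms(1) by (simp add: mult.assoc)
qed (simp add: LP_add distrib_right)

text \<open>Splits off the last letter, the one that a factor coming from the right meets
  first.\<close>

lemma LP_Suc_induct [consumes 1, case_names ideal mult add]: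
  assumes "u \<in> LP (Suc m)" and "\<And>z. z \<in> loc_ideal L C \<Longrightarrow> P z"
    and "\<And>v X. v \<in> LP m \<Longrightarrow> X \<in> n \<Longrightarrow> P (v * ltr X)"
    and "\<And>u v. P u \<Longrightarrow> P v \<Longrightarrow> P (u + v)"
  shows "P u"
  using assms(1)
proof (induction rule: LP_induct)
  case (prod a w)
  then obtain w' X where w: "w = w' @ [X]" by (cases w rule: rev_cases) auto
  then have "P (a * prod_list (map ltr w') * ltr X)"
    using prod LP_prod[of a w'] by (intro assms(3)) auto
  then show ?case by (simp add: w mult.assoc)
qed (use assms in auto)

section \<open>Continuity of right multiplication\<close>

text \<open>Continuity at 0, in the topology with the \<open>LP m\<close> as neighbourhoods of 0, of
  right multiplication by a fixed element. For left multiplication this is immediate, by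
  \<open>LP_left\<close>.\<close>

definition right_cont :: "('r, 'n) yop loc_letter free_alg \<Rightarrow> bool" where
  "right_cont y \<longleftrightarrow> y \<in> loc_carrier \<and> (\<forall>m. \<exists>k. \<forall>u\<in>LP k. u * y \<in> LP m)"

lemma right_cont_cst: "right_cont (cst c)"
  unfolding right_cont_def
  by (auto simp: loc_closed cst_commute intro!: LP_left)

lemma right_cont_one: "right_cont 1"
  using right_cont_cst[of 1] by simp

lemma right_cont_mult:
  assumes "right_cont y" "right_cont y'"
  shows "right_cont (y * y')"
  unfolding right_cont_def
proof (intro conjI allI)
  show "y * y' \<in> loc_carrier" using assms by (simp add: right_cont_def loc_closed)
  fix m
  obtain k where k: "\<forall>u\<in>LP k. u * y' \<in> LP m" using assms(2) by (auto simp: right_cont_def)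
  obtain l where "\<forall>u\<in>LP l. u * y \<in> LP k" using assms(1) by (auto simp: right_cont_def)
  then have "\<forall>u\<in>LP l. u * (y * y') \<in> LP m" using k by (simp flip: mult.assoc)
  then show "\<exists>l. \<forall>u\<in>LP l. u * (y * y') \<in> LP m" ..
qed

lemma right_cont_add:
  assumes "right_cont y" "right_cont y'"
  shows "right_cont (y + y')"
  unfolding right_cont_def
proof (intro conjI allI)
  show "y + y' \<in> loc_carrier" using assms by (simp add: right_cont_def loc_closed)
  fix m
  obtain k where k: "\<forall>u\<in>LP k. u * y' \<in> LP m" using assms(2) by (auto simp: right_cont_def)
  obtain l where l: "\<forall>u\<in>LP l. u * y \<in> LP m" using assms(1) by (auto simp: right_cont_def)
  have "u * (y + y') \<in> LP m" if "u \<in> LP (max k l)" for u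
    using that k l LP_antimono[of u "max k l" k] LP_antimono[of u "max k l" l]
    by (auto simp: distrib_left intro!: LP_add)
  then show "\<exists>j. \<forall>u\<in>LP j. u * (y + y') \<in> LP m" by blast
qed

lemma right_cont_power: "right_cont y \<Longrightarrow> right_cont (y ^ k)"
  by (induction k) (simp_all add: right_cont_one right_cont_mult)

lemma right_cont_sum: "(\<And>i. i \<in> I \<Longrightarrow> right_cont (f i)) \<Longrightarrow> right_cont (sum f I)"
  using right_cont_cst[of 0] by (induction I rule: infinite_finite_induct) (simp_all add: right_cont_add)

text \<open>
  Moving \<open>X\<close> to the left past a word in \<open>n\<close> produces iterated brackets, which vanish after
  boundedly many steps because each bracket raises the height.
\<close>

lemma right_cont_ltr:
  assumes V_step: "\<And>Y X d. Y \<in> n \<Longrightarrow> X \<in> V d \<Longrightarrow> op_comm Y X \<in> V (d + 1)"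
    and V_sub: "\<And>d. V d \<subseteq> L"
    and V_vanish: "\<And>d. N < d \<Longrightarrow> V d \<subseteq> {\<lambda>p. 0}"
    and X: "X \<in> V (d :: int)"
  shows "right_cont (ltr X)"
proof -
  \<comment> \<open>Since \<open>N - d\<close> is the room left above height \<open>d\<close>, any
    \<open>k\<close> successive brackets of \<open>X\<close> with elements of \<open>n\<close>
    vanish; at most \<open>k\<close> levels are lost. The outer induction is on \<open>k\<close>,
    the inner one on \<open>m\<close>.\<close>
  have main: "u * ltr X \<in> LP m" if "X \<in> V d" "N - d < int k" "u \<in> LP (m + k)" for k m d X u
    using that
  proof (induction k arbitrary: m d X u)
    case 0
    then have "X = (\<lambda>p. 0)" using V_vanish[of d] by auto
    then have "u * ltr X \<doteq> u * 0"
      using ltr_zero LP_closed[OF 0(3)] loc_eq_left[of "ltr (\<lambda>p. 0)" 0 u] by simp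
    then show ?case using LP_cong[OF LP_ideal[OF loc_ideal_zero]] by simp
  next
    case (Suc k)
    note outer = Suc.IH
    from Suc.prems show ?case
    proof (induction m arbitrary: u)
      case 0
      then show ?case using V_sub LP_closed[OF 0(3)] by (auto simp: LP_0 intro!: loc_closed)
    next
      case (Suc m)
      have X: "X \<in> L" using Suc.prems(1) V_sub by blast
      have "u \<in> LP (Suc (m + Suc k))" using Suc.prems(3) by simp
      then show ?case
      proof (induction rule: LP_Suc_induct)
        case (ideal z)
        then show ?case using X by (intro LP_ideal loc_ideal_right loc_closed)
      next
        case (mult v Y)
        have Y: "Y \<in> L" using mult(2) n_subset by blast
        have comm: "op_comm Y X \<in> V (d + 1)" using V_step[OF mult(2) Suc.prems(1)] .
        have v: "v \<in> loc_carrier" using mult(1) by (rule LP_closed)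
        have "v * ltr X * ltr Y \<in> LP (Suc m)"
          using Suc.IH[OF Suc.prems(1,2) mult(1)] by (rule LP_mult_n[OF mult(2)])
        \<comment> \<open>The bracket lies one step higher, so the outer hypothesis applies to it,
          with \<open>LP (m + Suc k)\<close> read as \<open>LP (Suc m + k)\<close>. The other term
          regains through \<open>Y\<close> the level it lacks.\<close>
        moreover have "v * ltr (op_comm Y X) \<in> LP (Suc m)"
          using comm Suc.prems(2) mult(1) by (intro outer) auto
        ultimately have "v * ltr X * ltr Y + v * ltr (op_comm Y X) \<in> LP (Suc m)" by (rule LP_add)
        moreover have "v * (ltr Y * ltr X) \<doteq> v * (ltr X * ltr Y + ltr (op_comm Y X))"
          by (rule loc_eq_left[OF ltr_comm[OF Y X] v])
        ultimately show ?case by (auto simp: distrib_left mult.assoc intro: LP_cong)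
      qed (simp add: distrib_right LP_add)
    qed
  qed
  show ?thesis
    unfolding right_cont_def
  proof (intro conjI allI exI ballI)
    show "ltr X \<in> loc_carrier" using X V_sub by (intro loc_closed) auto
    fix m u assume "u \<in> LP (m + nat (N - d + 1))"
    then show "u * ltr X \<in> LP m" by (intro main[OF X, of "nat (N - d + 1)"]) auto
  qed
qed

section \<open>Inverse denominators\<close>

text \<open>Literally the argument of \<open>Inv\<close> in \<open>proj_partial_sum\<close>: inverse
  letters are indexed by representatives, so the syntactic form matters. Moving past a root vector
  only changes \<open>c\<close> and keeps this form.\<close>

definition den :: "('r, 'n) yop \<Rightarrow> complex \<Rightarrow> nat \<Rightarrow> ('r, 'n) yop free_alg" where
  "den h c f = prod_list (map (\<lambda>j. gen h + cst (c + of_nat j)) [1..<Suc f])"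

text \<open>From \<open>h e = e h + a e\<close> each factor \<open>h + c + j\<close> becomes
  \<open>h + c - a + j\<close> on passing \<open>e\<close>.\<close>

lemma ltr_shift:
  assumes "h \<in> L" "e \<in> L" "op_comm h e = op_scale a e"
  shows "ltr e * emb (prod_list (map (\<lambda>j. gen h + cst (c + of_nat j)) js)) \<doteq>
    emb (prod_list (map (\<lambda>j. gen h + cst (c - a + of_nat j)) js)) * ltr e"
proof (induction js)
  case (Cons j js)
  let ?d = "c + of_nat j"
  define u where "u = emb (prod_list (map (\<lambda>j. gen h + cst (c + of_nat j)) js))"
  define v where "v = emb (prod_list (map (\<lambda>j. gen h + cst (c - a + of_nat j)) js))"
  have "u \<in> loc_carrier" "v \<in> loc_carrier"
    using assms(1) unfolding u_def v_def
    by (auto intro!: emb_closed free_algebra_prod_list free_algebra_closed)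
  then have closed: "u \<in> loc_carrier" "v \<in> loc_carrier" "ltr h \<in> loc_carrier" "ltr e \<in> loc_carrier"
    using assms(1,2) by (auto intro!: ltr_closed)
  have "ltr h * ltr e \<doteq> ltr e * ltr h + ltr (op_scale a e)"
    using ltr_comm[OF assms(1,2)] by (simp add: assms(3))
  also have "\<dots> \<doteq> ltr e * ltr h + cst a * ltr e"
    by (intro loc_eq_add loc_eq_refl ltr_scale assms)
  finally have "ltr e * ltr h + cst a * ltr e + (cst (c - a + of_nat j) * ltr e) \<doteq>
      ltr h * ltr e + (cst (c - a + of_nat j) * ltr e)"
    by (intro loc_eq_add[OF loc_eq_sym loc_eq_refl])
  moreover have "ltr e * ltr h + cst a * ltr e + (cst (c - a + of_nat j) * ltr e) = ltr e * (ltr h + cst ?d)"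
  proof -
    have "cst a * ltr e + cst (c - a + of_nat j) * ltr e = cst (a + (c - a + of_nat j)) * ltr e"
      by (simp only: cst_plus distrib_right)
    also have "a + (c - a + of_nat j) = ?d" by simp
    finally show ?thesis by (simp add: distrib_left add.assoc cst_commute)
  qed
  ultimately have "ltr e * (ltr h + cst ?d) \<doteq> (ltr h + cst (c - a + of_nat j)) * ltr e"
    by (simp add: distrib_right)
  then have "ltr e * (ltr h + cst ?d) * u \<doteq> (ltr h + cst (c - a + of_nat j)) * ltr e * u"
    by (rule loc_eq_right) (rule closed)
  also have "\<dots> = (ltr h + cst (c - a + of_nat j)) * (ltr e * u)" by (rule mult.assoc)
  also have "\<dots> \<doteq> (ltr h + cst (c - a + of_nat j)) * (v * ltr e)"
    using Cons.IH closed assms(1) unfolding u_def v_def by (intro loc_eq_left loc_closed)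
  finally show ?case
    by (simp add: emb_mult emb_add u_def v_def mult.assoc)
qed simp

lemma emb_den_closed: "h \<in> L \<Longrightarrow> emb (den h c f) \<in> loc_carrier"
  unfolding den_def by (auto intro!: loc_closed free_algebra_prod_list free_algebra_closed)

text \<open>The relation of \<open>ltr_shift\<close> is multiplied by the inverse of one denominator
  on the left and of the other on the right.\<close>

lemma Inv_shift:
  assumes "h \<in> L" "e \<in> L" "op_comm h e = op_scale a e"
    and den: "den h c f \<in> denominators L C" "den h (c - a) f \<in> denominators L C"
  shows "ltr e * gen (Inv (den h c f)) \<doteq> gen (Inv (den h (c - a) f)) * ltr e"
proof -
  let ?u = "den h c f" and ?v = "den h (c - a) f"
  have closed: "gen (Inv ?u) \<in> loc_carrier" "gen (Inv ?v) \<in> loc_carrier" "emb ?u \<in> loc_carrier"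
    "emb ?v \<in> loc_carrier" "ltr e \<in> loc_carrier"
    using assms by (auto intro!: loc_closed emb_den_closed)
  have "gen (Inv ?v) * emb ?v * (ltr e * gen (Inv ?u)) \<doteq> 1 * (ltr e * gen (Inv ?u))"
    using closed assms(2) by (intro loc_eq_right Inv_left den loc_closed)
  then have "ltr e * gen (Inv ?u) \<doteq> gen (Inv ?v) * (emb ?v * ltr e * gen (Inv ?u))"
    by (subst loc_eq_sym) (simp_all add: mult.assoc)
  also have "\<dots> \<doteq> gen (Inv ?v) * (ltr e * emb ?u * gen (Inv ?u))"
    using closed assms(2) unfolding den_def
    by (intro loc_eq_left loc_eq_right loc_eq_sym[OF ltr_shift[OF assms(1-3)]])
  also have "\<dots> = gen (Inv ?v) * ltr e * (emb ?u * gen (Inv ?u))" by (simp add: mult.assoc)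
  also have "\<dots> \<doteq> gen (Inv ?v) * ltr e * 1"
    using closed assms(2) by (intro loc_eq_left Inv_right den loc_closed)
  finally show ?thesis by simp
qed

text \<open>No level is lost here: each letter of a word in root vectors reappears to the right of
  the inverse. Since every passage changes \<open>c\<close>, the induction on the level is for all
  \<open>c\<close> simultaneously; general elements of \<open>n\<close> are reached by induction on
  the span.\<close>

lemma right_cont_Inv:
  assumes h: "h \<in> L" and den: "\<And>c. den h c f \<in> denominators L C"
    and n: "n \<subseteq> op_span R" and R: "R \<subseteq> n"
    and wt: "\<And>e. e \<in> R \<Longrightarrow> \<exists>a. op_comm h e = op_scale a e"
    and spanL: "op_span R \<subseteq> L"
  shows "right_cont (gen (Inv (den h c f)))"
proof -
  have "u * gen (Inv (den h c f)) \<in> LP m" if "u \<in> LP m" for m u c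
    using that
  proof (induction m arbitrary: u c)
    case 0
    then show ?case by (auto simp: LP_0 intro!: loc_closed den)
  next
    case (Suc m)
    from Suc.prems show ?case
    proof (induction rule: LP_Suc_induct)
      case (ideal z)
      then show ?case by (intro LP_ideal loc_ideal_right loc_closed den)
    next
      case (mult v X)
      have v: "v \<in> loc_carrier" using mult(1) by (rule LP_closed)
      have "X \<in> op_span R" using mult(2) n by blast
      then show ?case
      proof (induction rule: op_span_induct)
        case zero
        have "v * ltr (\<lambda>p. 0) * gen (Inv (den h c f)) \<doteq> v * 0 * gen (Inv (den h c f))"
          using v by (intro loc_eq_left loc_eq_right ltr_zero loc_closed den)
        then show ?case using LP_cong[OF LP_ideal[OF loc_ideal_zero]] by simp
      next
        case (lincomb e b B)
        have e: "e \<in> n" "e \<in> L" using lincomb(1) R n_subset by auto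
        have B: "B \<in> L" using lincomb(2) spanL by blast
        obtain a where a: "op_comm h e = op_scale a e" using wt[OF lincomb(1)] by blast
        have "v * gen (Inv (den h (c - a) f)) * ltr e \<in> LP (Suc m)"
          by (intro LP_mult_n e Suc.IH mult)
        moreover have "v * (ltr e * gen (Inv (den h c f))) \<doteq> v * (gen (Inv (den h (c - a) f)) * ltr e)"
          using v by (intro loc_eq_left Inv_shift h e a den)
        ultimately have 1: "v * ltr e * gen (Inv (den h c f)) \<in> LP (Suc m)"
          by (auto simp: mult.assoc intro: LP_cong)
        \<comment> \<open>Each operator is a letter of its own, additive only modulo the relations,
          so the combination is written with \<open>op_plus\<close> and
          \<open>op_scale\<close>.\<close>
        have "(\<lambda>p. cst b * e p + B p) = op_plus (op_scale b e) B"
          by (simp add: op_plus_def op_scale_def)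
        then have "ltr (\<lambda>p. cst b * e p + B p) \<doteq> cst b * ltr e + ltr B"
          using loc_eq_trans[OF ltr_plus[OF L_scale[OF e(2), of b] B] loc_eq_add[OF ltr_scale[OF e(2)] loc_eq_refl]]
          by simp
        then have "v * ltr (\<lambda>p. cst b * e p + B p) * gen (Inv (den h c f)) \<doteq>
            v * (cst b * ltr e + ltr B) * gen (Inv (den h c f))"
          using v by (intro loc_eq_left loc_eq_right loc_closed den)
        also have "\<dots> = cst b * (v * ltr e * gen (Inv (den h c f))) + v * ltr B * gen (Inv (den h c f))"
          by (simp add: distrib_left distrib_right mult_cst_left mult.assoc)
        finally show ?case
          by (rule LP_cong[rotated]) (intro LP_add LP_left 1 lincomb.IH loc_closed)
      qed
    qed (simp add: distrib_right LP_add)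
  qed
  then show ?thesis unfolding right_cont_def using den by (auto intro!: loc_closed)
qed

subsection \<open>Weights\<close>

lemma weight_space_iff: "u \<in> weight_space L C \<mu> \<longleftrightarrow>
    u \<in> loc_carrier \<and> (\<forall>X\<in>C. ltr X * u \<doteq> u * ltr X + cst (\<mu> X) * u)"
  by (simp add: weight_space_def loc_algebra_def loc_eq_def diff_diff_eq)

lemma weight_space_add:
  assumes "u \<in> weight_space L C \<mu>" "v \<in> weight_space L C \<mu>"
  shows "u + v \<in> weight_space L C \<mu>"
  unfolding weight_space_iff
proof (intro conjI ballI)
  fix X assume "X \<in> C"
  then have "ltr X * u + ltr X * v \<doteq> (u * ltr X + cst (\<mu> X) * u) + (v * ltr X + cst (\<mu> X) * v)"
    using assms by (intro loc_eq_add) (auto simp: weight_space_iff)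
  then show "ltr X * (u + v) \<doteq> (u + v) * ltr X + cst (\<mu> X) * (u + v)"
    by (simp add: distrib_left distrib_right algebra_simps)
qed (use assms in \<open>auto simp: weight_space_iff intro!: loc_closed\<close>)

lemma weight_space_mult:
  assumes u: "u \<in> weight_space L C \<mu>" and v: "v \<in> weight_space L C \<nu>"
  shows "u * v \<in> weight_space L C (\<lambda>X. \<mu> X + \<nu> X)"
  unfolding weight_space_iff
proof (intro conjI ballI)
  fix X assume X: "X \<in> C"
  have closed: "u \<in> loc_carrier" "v \<in> loc_carrier" using u v by (auto simp: weight_space_iff)
  have "ltr X * (u * v) = ltr X * u * v" by (simp add: mult.assoc)
  also have "\<dots> \<doteq> (u * ltr X + cst (\<mu> X) * u) * v"
    using u X closed by (intro loc_eq_right) (auto simp: weight_space_iff)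
  also have "\<dots> = u * (ltr X * v) + cst (\<mu> X) * u * v" by (simp add: distrib_right mult.assoc)
  also have "\<dots> \<doteq> u * (v * ltr X + cst (\<nu> X) * v) + cst (\<mu> X) * u * v"
    using v X closed by (intro loc_eq_add loc_eq_left loc_eq_refl) (auto simp: weight_space_iff)
  also have "\<dots> = u * v * ltr X + cst (\<mu> X + \<nu> X) * (u * v)"
    by (simp add: distrib_left distrib_right cst_plus mult_cst_left mult.assoc add_ac)
  finally show "ltr X * (u * v) \<doteq> u * v * ltr X + cst (\<mu> X + \<nu> X) * (u * v)" .
qed (use assms in \<open>auto simp: weight_space_iff intro!: loc_closed\<close>)

lemma weight_space_cst: "cst c \<in> weight_space L C (\<lambda>_. 0)"
  by (simp add: weight_space_iff loc_closed cst_commute)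

lemma weight_space_zero: "0 \<in> weight_space L C \<mu>"
  by (simp add: weight_space_iff loc_closed)

lemma weight_space_one: "1 \<in> weight_space L C (\<lambda>_. 0)"
  using weight_space_cst[of 1] by simp

lemma weight_space_sum:
  "(\<And>i. i \<in> I \<Longrightarrow> f i \<in> weight_space L C \<mu>) \<Longrightarrow> sum f I \<in> weight_space L C \<mu>"
  by (induction I rule: infinite_finite_induct) (simp_all add: weight_space_add weight_space_zero)

lemma weight_space_power:
  "u \<in> weight_space L C \<mu> \<Longrightarrow> u ^ k \<in> weight_space L C (\<lambda>X. of_nat k * \<mu> X)"
proof (induction k)
  case (Suc k)
  then show ?case using weight_space_mult[OF Suc.prems Suc.IH] by (simp add: distrib_right)
qed (simp add: weight_space_one)

lemma weight_space_ltr: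
  assumes "e \<in> L" "\<And>X. X \<in> C \<Longrightarrow> op_comm X e = op_scale (\<mu> X) e"
  shows "ltr e \<in> weight_space L C \<mu>"
  unfolding weight_space_iff
proof (intro conjI ballI)
  fix X assume X: "X \<in> C"
  then have "ltr X * ltr e \<doteq> ltr e * ltr X + ltr (op_comm X e)"
    using C_subset assms(1) by (intro ltr_comm) auto
  also have "\<dots> \<doteq> ltr e * ltr X + cst (\<mu> X) * ltr e"
    unfolding assms(2)[OF X] by (intro loc_eq_add loc_eq_refl ltr_scale assms)
  finally show "ltr X * ltr e \<doteq> ltr e * ltr X + cst (\<mu> X) * ltr e" .
qed (use assms in \<open>auto intro!: loc_closed\<close>)

text \<open>The case of shift 0 of \<open>Inv_shift\<close>, the Cartan subalgebra being
  commutative.\<close>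

lemma weight_space_Inv:
  assumes h: "h \<in> C" and comm: "\<And>X. X \<in> C \<Longrightarrow> op_comm h X = (\<lambda>p. 0)"
    and den: "den h c f \<in> denominators L C"
  shows "gen (Inv (den h c f)) \<in> weight_space L C (\<lambda>_. 0)"
  unfolding weight_space_iff
proof (intro conjI ballI)
  fix X assume X: "X \<in> C"
  have "op_comm h X = op_scale 0 X" using comm[OF X] by (simp add: op_scale_def)
  then have "ltr X * gen (Inv (den h c f)) \<doteq> gen (Inv (den h (c - 0) f)) * ltr X"
    using h X C_subset den by (intro Inv_shift) auto
  then show "ltr X * gen (Inv (den h c f)) \<doteq> gen (Inv (den h c f)) * ltr X + cst 0 * gen (Inv (den h c f))"
    by simp
qed (intro loc_closed den)

end

section \<open>Multiplication of cosets in the Taylor extension\<close>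

context operator_lie_algebra
begin

abbreviation null :: "(nat \<Rightarrow> ('r, 'n) yop loc_letter free_alg) set" where
  "null \<equiv> null_seqs L C n"

definition fin_weights :: "(nat \<Rightarrow> ('r, 'n) yop loc_letter free_alg) \<Rightarrow> bool" where
  "fin_weights x \<longleftrightarrow> (\<exists>W. finite W \<and>
     (\<forall>k. \<exists>v. (\<forall>\<mu>\<in>W. v \<mu> \<in> weight_space L C \<mu>) \<and> x k = (\<Sum>\<mu>\<in>W. v \<mu>)))"

definition LP_cauchy :: "(nat \<Rightarrow> ('r, 'n) yop loc_letter free_alg) \<Rightarrow> bool" where
  "LP_cauchy x \<longleftrightarrow> (\<forall>m. \<exists>k0. \<forall>k\<ge>k0. \<forall>l\<ge>k0. x k - x l \<in> LP m)"

definition LP_vanishing :: "(nat \<Rightarrow> ('r, 'n) yop loc_letter free_alg) \<Rightarrow> bool" where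
  "LP_vanishing x \<longleftrightarrow> (\<forall>m. \<exists>k0. \<forall>k\<ge>k0. x k \<in> LP m)"

text \<open>The Cauchy clause is implied by vanishing, because every \<open>LP m\<close> is closed
  under differences.\<close>

lemma null_iff: "x \<in> null \<longleftrightarrow> (\<forall>k. x k \<in> loc_carrier) \<and> fin_weights x \<and> LP_vanishing x"
proof -
  have "LP_cauchy x" if vanish: "LP_vanishing x"
    unfolding LP_cauchy_def
  proof
    fix m
    obtain k0 where "\<forall>k\<ge>k0. x k \<in> LP m" using vanish unfolding LP_vanishing_def by blast
    then show "\<exists>k0. \<forall>k\<ge>k0. \<forall>l\<ge>k0. x k - x l \<in> LP m" by (auto intro: LP_diff)
  qed
  then show ?thesis
    unfolding null_seqs_def taylor_seqs_def fin_weights_def LP_cauchy_def LP_vanishing_def loc_algebra_def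
    by auto
qed

lemma fin_weights_weight_zero: "(\<And>k. x k \<in> weight_space L C (\<lambda>_. 0)) \<Longrightarrow> fin_weights x"
  unfolding fin_weights_def by (intro exI[of _ "{\<lambda>_. 0}"]) (auto intro!: exI[of _ "\<lambda>_. x _"])

lemma fin_weights_add:
  assumes "fin_weights x" "fin_weights y"
  shows "fin_weights (\<lambda>k. x k + y k)"
proof -
  obtain V where V: "finite V" "\<And>k. \<exists>v. (\<forall>\<mu>\<in>V. v \<mu> \<in> weight_space L C \<mu>) \<and> x k = (\<Sum>\<mu>\<in>V. v \<mu>)"
    using assms(1) unfolding fin_weights_def by blast
  obtain W where W: "finite W" "\<And>k. \<exists>v. (\<forall>\<mu>\<in>W. v \<mu> \<in> weight_space L C \<mu>) \<and> y k = (\<Sum>\<mu>\<in>W. v \<mu>)"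
    using assms(2) unfolding fin_weights_def by blast
  have "\<exists>u. (\<forall>\<mu>\<in>V \<union> W. u \<mu> \<in> weight_space L C \<mu>) \<and> x k + y k = (\<Sum>\<mu>\<in>V \<union> W. u \<mu>)" for k
  proof -
    obtain v where v: "\<forall>\<mu>\<in>V. v \<mu> \<in> weight_space L C \<mu>" "x k = (\<Sum>\<mu>\<in>V. v \<mu>)" using V(2) by blast
    obtain w where w: "\<forall>\<mu>\<in>W. w \<mu> \<in> weight_space L C \<mu>" "y k = (\<Sum>\<mu>\<in>W. w \<mu>)" using W(2) by blast
    define u where "u \<mu> = (if \<mu> \<in> V then v \<mu> else 0) + (if \<mu> \<in> W then w \<mu> else 0)" for \<mu>
    have "x k = (\<Sum>\<mu>\<in>V \<union> W. if \<mu> \<in> V then v \<mu> else 0)"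
      unfolding v(2) using V(1) W(1) by (intro sum.mono_neutral_cong_left) auto
    moreover have "y k = (\<Sum>\<mu>\<in>V \<union> W. if \<mu> \<in> W then w \<mu> else 0)"
      unfolding w(2) using V(1) W(1) by (intro sum.mono_neutral_cong_left) auto
    ultimately have "x k + y k = (\<Sum>\<mu>\<in>V \<union> W. u \<mu>)" by (simp add: u_def sum.distrib)
    moreover have "\<forall>\<mu>\<in>V \<union> W. u \<mu> \<in> weight_space L C \<mu>"
      using v(1) w(1) by (auto simp: u_def intro!: weight_space_add weight_space_zero)
    ultimately show ?thesis by blast
  qed
  then show ?thesis unfolding fin_weights_def using V(1) W(1) by blast
qed

lemma fin_weights_mult:
  assumes "fin_weights x" "fin_weights y"
  shows "fin_weights (\<lambda>k. x k * y k)"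
proof -
  obtain V where V: "finite V" "\<And>k. \<exists>v. (\<forall>\<mu>\<in>V. v \<mu> \<in> weight_space L C \<mu>) \<and> x k = (\<Sum>\<mu>\<in>V. v \<mu>)"
    using assms(1) unfolding fin_weights_def by blast
  obtain W where W: "finite W" "\<And>k. \<exists>v. (\<forall>\<mu>\<in>W. v \<mu> \<in> weight_space L C \<mu>) \<and> y k = (\<Sum>\<mu>\<in>W. v \<mu>)"
    using assms(2) unfolding fin_weights_def by blast
  define s :: "(('r, 'n) yop \<Rightarrow> complex) \<times> (('r, 'n) yop \<Rightarrow> complex) \<Rightarrow> (('r, 'n) yop \<Rightarrow> complex)"
    where "s = (\<lambda>(\<mu>, \<nu>) X. \<mu> X + \<nu> X)"
  have "\<exists>u. (\<forall>\<kappa>\<in>s ` (V \<times> W). u \<kappa> \<in> weight_space L C \<kappa>) \<and> x k * y k = (\<Sum>\<kappa>\<in>s ` (V \<times> W). u \<kappa>)" for k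
  proof -
    obtain v where v: "\<forall>\<mu>\<in>V. v \<mu> \<in> weight_space L C \<mu>" "x k = (\<Sum>\<mu>\<in>V. v \<mu>)" using V(2) by blast
    obtain w where w: "\<forall>\<mu>\<in>W. w \<mu> \<in> weight_space L C \<mu>" "y k = (\<Sum>\<mu>\<in>W. w \<mu>)" using W(2) by blast
    define t where "t = (\<lambda>(\<mu>, \<nu>). v \<mu> * w \<nu>)"
    \<comment> \<open>Different pairs of weights may have the same sum, so the products are
      collected along the fibres of \<open>s\<close>.\<close>
    define u where "u \<kappa> = sum t {p \<in> V \<times> W. s p = \<kappa>}" for \<kappa>
    have "x k * y k = sum t (V \<times> W)"
      by (simp add: v(2) w(2) sum_product sum.cartesian_product t_def)
    also have "\<dots> = (\<Sum>\<kappa>\<in>s ` (V \<times> W). u \<kappa>)"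
      unfolding u_def using V(1) W(1) by (intro sum.image_gen) simp
    finally have "x k * y k = (\<Sum>\<kappa>\<in>s ` (V \<times> W). u \<kappa>)" .
    moreover have "u \<kappa> \<in> weight_space L C \<kappa>" for \<kappa>
      unfolding u_def
    proof (rule weight_space_sum)
      fix p assume p: "p \<in> {p \<in> V \<times> W. s p = \<kappa>}"
      then obtain \<mu> \<nu> where "p = (\<mu>, \<nu>)" "\<mu> \<in> V" "\<nu> \<in> W" "\<kappa> = (\<lambda>X. \<mu> X + \<nu> X)"
        by (auto simp: s_def)
      then show "t p \<in> weight_space L C \<kappa>"
        using v(1) w(1) by (auto simp: t_def intro: weight_space_mult)
    qed
    ultimately show ?thesis by blast
  qed
  moreover have "finite (s ` (V \<times> W))" using V(1) W(1) by simp
  ultimately show ?thesis unfolding fin_weights_def by (intro exI[of _ "s ` (V \<times> W)"] conjI allI)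
qed

lemma null_add:
  assumes "x \<in> null" "y \<in> null"
  shows "(\<lambda>k. x k + y k) \<in> null"
  unfolding null_iff
proof (intro conjI allI)
  show "LP_vanishing (\<lambda>k. x k + y k)"
    unfolding LP_vanishing_def
  proof
    fix m
    obtain k1 k2 where "\<forall>k\<ge>k1. x k \<in> LP m" "\<forall>k\<ge>k2. y k \<in> LP m"
      using assms unfolding null_iff LP_vanishing_def by metis
    then have "\<forall>k\<ge>max k1 k2. x k + y k \<in> LP m" by (auto intro: LP_add)
    then show "\<exists>k0. \<forall>k\<ge>k0. x k + y k \<in> LP m" ..
  qed
qed (use assms in \<open>auto simp: null_iff intro!: loc_closed fin_weights_add\<close>)

lemma null_zero: "(\<lambda>k. 0) \<in> null"
  unfolding null_iff LP_vanishing_def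
  by (auto intro!: loc_closed fin_weights_weight_zero weight_space_zero LP_ideal loc_ideal_zero)

lemma null_left:
  assumes "\<And>k. c k \<in> loc_carrier" "fin_weights c" "x \<in> null"
  shows "(\<lambda>k. c k * x k) \<in> null"
proof -
  have "LP_vanishing (\<lambda>k. c k * x k)"
    unfolding LP_vanishing_def
  proof
    fix m
    obtain k0 where "\<forall>k\<ge>k0. x k \<in> LP m"
      using assms(3) unfolding null_iff LP_vanishing_def by blast
    then have "\<forall>k\<ge>k0. c k * x k \<in> LP m" using assms(1) by (simp add: LP_left)
    then show "\<exists>k0. \<forall>k\<ge>k0. c k * x k \<in> LP m" ..
  qed
  then show ?thesis using assms by (simp add: null_iff loc_closed fin_weights_mult)
qed

text \<open>
  The sequences of weight zero by which one can multiply null sequences from the right. Their cosets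
  multiply like their representatives, so that no ring structure on the whole extension is needed.
\<close>

definition mult_seqs :: "(nat \<Rightarrow> ('r, 'n) yop loc_letter free_alg) set" where
  "mult_seqs = {b. (\<forall>k. b k \<in> weight_space L C (\<lambda>_. 0)) \<and> (\<forall>k. right_cont (b k)) \<and> LP_cauchy b}"

lemma mult_seqs_closed: "b \<in> mult_seqs \<Longrightarrow> b k \<in> loc_carrier"
  by (simp add: mult_seqs_def right_cont_def)

lemma mult_seqs_fin_weights: "b \<in> mult_seqs \<Longrightarrow> fin_weights b"
  by (rule fin_weights_weight_zero) (simp add: mult_seqs_def)

text \<open>Continuity of a single term gives a level depending on that term. The Cauchy property
  makes it uniform: \<open>b k\<close> differs from \<open>b k0\<close> by an element of
  \<open>LP m\<close>, and this is a left ideal.\<close>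

lemma mult_seqs_absorb:
  assumes "b \<in> mult_seqs"
  obtains j k0 where "\<And>u k. u \<in> LP j \<Longrightarrow> k \<ge> k0 \<Longrightarrow> u * b k \<in> LP m"
proof -
  obtain k0 where k0: "\<forall>k\<ge>k0. \<forall>l\<ge>k0. b k - b l \<in> LP m"
    using assms unfolding mult_seqs_def LP_cauchy_def by blast
  obtain j where j: "\<forall>u\<in>LP j. u * b k0 \<in> LP m"
    using assms unfolding mult_seqs_def right_cont_def by blast
  have "u * b k \<in> LP m" if "u \<in> LP j" "k \<ge> k0" for u k
  proof -
    have "u * b k0 + u * (b k - b k0) \<in> LP m"
      using that k0 j by (intro LP_add[OF _ LP_left]) (auto dest: LP_closed)
    then show ?thesis by (simp add: right_diff_distrib)
  qed
  then show thesis by (rule that)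
qed

lemma null_right:
  assumes "x \<in> null" "b \<in> mult_seqs"
  shows "(\<lambda>k. x k * b k) \<in> null"
  unfolding null_iff
proof (intro conjI allI)
  show "LP_vanishing (\<lambda>k. x k * b k)"
    unfolding LP_vanishing_def
  proof
    fix m
    obtain j k0 where j: "\<And>u k. u \<in> LP j \<Longrightarrow> k \<ge> k0 \<Longrightarrow> u * b k \<in> LP m"
      using mult_seqs_absorb[OF assms(2)] by blast
    obtain k1 where "\<forall>k\<ge>k1. x k \<in> LP j"
      using assms(1) unfolding null_iff LP_vanishing_def by blast
    then have "\<forall>k\<ge>max k0 k1. x k * b k \<in> LP m" using j by simp
    then show "\<exists>k0. \<forall>k\<ge>k0. x k * b k \<in> LP m" ..
  qed
qed (use assms in \<open>simp_all add: null_iff loc_closed fin_weights_mult mult_seqs_closed mult_seqs_fin_weights\<close>)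

lemma mult_seqs_one: "(\<lambda>k. 1) \<in> mult_seqs"
  by (simp add: mult_seqs_def weight_space_one right_cont_one LP_cauchy_def LP_ideal loc_ideal_zero)

lemma mult_seqs_mult:
  assumes a: "a \<in> mult_seqs" and b: "b \<in> mult_seqs"
  shows "(\<lambda>k. a k * b k) \<in> mult_seqs"
  unfolding mult_seqs_def
proof (intro CollectI conjI allI)
  fix k
  show "a k * b k \<in> weight_space L C (\<lambda>_. 0)"
    using weight_space_mult[of "a k" "\<lambda>_. 0" "b k" "\<lambda>_. 0"] a b by (simp add: mult_seqs_def)
  show "right_cont (a k * b k)"
    using a b by (auto simp: mult_seqs_def intro: right_cont_mult)
next
  show "LP_cauchy (\<lambda>k. a k * b k)"
    unfolding LP_cauchy_def
  proof
    fix m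
    obtain j k0 where j: "\<And>u k. u \<in> LP j \<Longrightarrow> k \<ge> k0 \<Longrightarrow> u * b k \<in> LP m"
      using mult_seqs_absorb[OF b] by blast
    obtain k1 where k1: "\<forall>k\<ge>k1. \<forall>l\<ge>k1. a k - a l \<in> LP j"
      using a unfolding mult_seqs_def LP_cauchy_def by blast
    obtain k2 where k2: "\<forall>k\<ge>k2. \<forall>l\<ge>k2. b k - b l \<in> LP m"
      using b unfolding mult_seqs_def LP_cauchy_def by blast
    have "a k * b k - a l * b l \<in> LP m" if "k \<ge> max k0 (max k1 k2)" "l \<ge> max k0 (max k1 k2)" for k l
    proof -
      have "a k * (b k - b l) + (a k - a l) * b l \<in> LP m"
        using that j k1 k2 by (intro LP_add[OF LP_left] mult_seqs_closed[OF a]) auto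
      then show ?thesis by (simp add: algebra_simps)
    qed
    then show "\<exists>k0. \<forall>k\<ge>k0. \<forall>l\<ge>k0. a k * b k - a l * b l \<in> LP m" by blast
  qed
qed

abbreviation coset :: "(nat \<Rightarrow> ('r, 'n) yop loc_letter free_alg) \<Rightarrow> ('r, 'n) taylor_elem" where
  "coset a \<equiv> null +>\<^bsub>taylor_seqs L C n\<^esub> a"

lemma coset_eq: "coset a = {(\<lambda>k. i k + a k) | i. i \<in> null}"
  by (auto simp: a_r_coset_def' taylor_seqs_def)

text \<open>The quotient product gathers the cosets of all products of representatives
  \<open>i + a\<close> and \<open>j + b\<close>. The excess over \<open>a b\<close> is
  \<open>i b + (i + a) j\<close>: the first term is null by \<open>null_right\<close>, the second by
  \<open>null_left\<close>.\<close>

lemma coset_mult: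
  assumes a: "a \<in> mult_seqs" and b: "b \<in> mult_seqs"
  shows "coset a \<otimes>\<^bsub>taylor_ext L C n\<^esub> coset b = coset (\<lambda>k. a k * b k)"
proof -
  have "coset a \<otimes>\<^bsub>taylor_ext L C n\<^esub> coset b =
      {(\<lambda>k. h k + (i k + a k) * (j k + b k)) | h i j. h \<in> null \<and> i \<in> null \<and> j \<in> null}" (is "_ = ?S")
    by (auto simp: taylor_ext_def FactRing_def rcoset_mult_def coset_eq) (auto simp: taylor_seqs_def)
  also have "?S = coset (\<lambda>k. a k * b k)"
  proof (intro equalityI subsetI)
    fix y assume "y \<in> ?S"
    then obtain h i j where y: "y = (\<lambda>k. h k + (i k + a k) * (j k + b k))" and null: "h \<in> null" "i \<in> null" "j \<in> null"
      by blast
    have "(\<lambda>k. (i k + a k) * j k) \<in> null"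
      using null a by (intro null_left fin_weights_add loc_closed)
        (auto simp: null_iff mult_seqs_closed mult_seqs_fin_weights)
    then have "(\<lambda>k. h k + i k * b k + (i k + a k) * j k) \<in> null"
      by (rule null_add[OF null_add[OF null(1) null_right[OF null(2) b]]])
    moreover have "y = (\<lambda>k. h k + i k * b k + (i k + a k) * j k + a k * b k)"
      by (simp add: y algebra_simps)
    ultimately show "y \<in> coset (\<lambda>k. a k * b k)"
      unfolding coset_eq by (intro CollectI exI[of _ "\<lambda>k. h k + i k * b k + (i k + a k) * j k"] conjI)
  next
    fix y assume "y \<in> coset (\<lambda>k. a k * b k)"
    then obtain h where "y = (\<lambda>k. h k + (0 + a k) * (0 + b k))" "h \<in> null" by (auto simp: coset_eq)
    then show "y \<in> ?S"
      using null_zero by (intro CollectI exI[of _ h] exI[of _ "\<lambda>k. 0"] conjI)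
  qed
  finally show ?thesis .
qed

lemma coset_prod:
  assumes "\<And>\<beta>. \<beta> \<in> set ws \<Longrightarrow> a \<beta> \<in> mult_seqs"
  shows "(\<lambda>k. prod_list (map (\<lambda>\<beta>. a \<beta> k) ws)) \<in> mult_seqs"
    and "foldr (\<lambda>\<beta> x. coset (a \<beta>) \<otimes>\<^bsub>taylor_ext L C n\<^esub> x) ws \<one>\<^bsub>taylor_ext L C n\<^esub> =
      coset (\<lambda>k. prod_list (map (\<lambda>\<beta>. a \<beta> k) ws))"
proof -
  have "(\<lambda>k. prod_list (map (\<lambda>\<beta>. a \<beta> k) ws)) \<in> mult_seqs \<and>
    foldr (\<lambda>\<beta> x. coset (a \<beta>) \<otimes>\<^bsub>taylor_ext L C n\<^esub> x) ws \<one>\<^bsub>taylor_ext L C n\<^esub> =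
      coset (\<lambda>k. prod_list (map (\<lambda>\<beta>. a \<beta> k) ws))"
    using assms
  proof (induction ws)
    case Nil
    then show ?case by (simp add: mult_seqs_one taylor_ext_def FactRing_def) (simp add: taylor_seqs_def)
  next
    case (Cons \<beta> ws)
    then show ?case by (auto simp: coset_mult mult_seqs_mult)
  qed
  then show "(\<lambda>k. prod_list (map (\<lambda>\<beta>. a \<beta> k) ws)) \<in> mult_seqs"
    "foldr (\<lambda>\<beta> x. coset (a \<beta>) \<otimes>\<^bsub>taylor_ext L C n\<^esub> x) ws \<one>\<^bsub>taylor_ext L C n\<^esub> =
      coset (\<lambda>k. prod_list (map (\<lambda>\<beta>. a \<beta> k) ws))" by auto
qed

text \<open>Both sides are cosets of termwise products of sequences, and there the regrouping is the
  product over an appended list.\<close>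

lemma coset_prod_append:
  assumes "\<And>\<beta>. \<beta> \<in> set vs \<union> set ws \<Longrightarrow> a \<beta> \<in> mult_seqs"
  shows "foldr (\<lambda>\<beta> x. coset (a \<beta>) \<otimes>\<^bsub>taylor_ext L C n\<^esub> x) (vs @ ws) \<one>\<^bsub>taylor_ext L C n\<^esub> =
    foldr (\<lambda>\<beta> x. coset (a \<beta>) \<otimes>\<^bsub>taylor_ext L C n\<^esub> x) vs \<one>\<^bsub>taylor_ext L C n\<^esub>
    \<otimes>\<^bsub>taylor_ext L C n\<^esub>
    foldr (\<lambda>\<beta> x. coset (a \<beta>) \<otimes>\<^bsub>taylor_ext L C n\<^esub> x) ws \<one>\<^bsub>taylor_ext L C n\<^esub>"
proof -
  have vs: "\<And>\<beta>. \<beta> \<in> set vs \<Longrightarrow> a \<beta> \<in> mult_seqs" and ws: "\<And>\<beta>. \<beta> \<in> set ws \<Longrightarrow> a \<beta> \<in> mult_seqs"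
    and vws: "\<And>\<beta>. \<beta> \<in> set (vs @ ws) \<Longrightarrow> a \<beta> \<in> mult_seqs"
    using assms by auto
  let ?P = "\<lambda>us k. prod_list (map (\<lambda>\<beta>. a \<beta> k) us)"
  have "foldr (\<lambda>\<beta> x. coset (a \<beta>) \<otimes>\<^bsub>taylor_ext L C n\<^esub> x) (vs @ ws) \<one>\<^bsub>taylor_ext L C n\<^esub> = coset (?P (vs @ ws))"
    by (rule coset_prod(2)[OF vws])
  also have "\<dots> = coset (\<lambda>k. ?P vs k * ?P ws k)" by simp
  also have "\<dots> = coset (?P vs) \<otimes>\<^bsub>taylor_ext L C n\<^esub> coset (?P ws)"
    by (rule coset_mult[symmetric]) (rule coset_prod(1), erule vs ws)+
  also have "coset (?P vs) = foldr (\<lambda>\<beta> x. coset (a \<beta>) \<otimes>\<^bsub>taylor_ext L C n\<^esub> x) vs \<one>\<^bsub>taylor_ext L C n\<^esub>"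
    by (rule coset_prod(2)[OF vs, symmetric])
  also have "coset (?P ws) = foldr (\<lambda>\<beta> x. coset (a \<beta>) \<otimes>\<^bsub>taylor_ext L C n\<^esub> x) ws \<one>\<^bsub>taylor_ext L C n\<^esub>"
    by (rule coset_prod(2)[OF ws, symmetric])
  finally show ?thesis .
qed

end

section \<open>The factorisation\<close>

context nondegenerate_form
begin

lemma d_alg_lie_algebra:
  "operator_lie_algebra (d_alg g :: ('r::{finite,linorder}, 'n) yop set) cartan (g_plus g)"
proof
  show "op_linear A" if "A \<in> d_alg g" for A :: "('r, 'n) yop"
    using that height_filt_linear unfolding height_filt_eq_d_alg[symmetric] by blast
  show "op_comm A B \<in> d_alg g" if "A \<in> d_alg g" "B \<in> d_alg g" for A B :: "('r, 'n) yop"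
    using that by (rule d_alg_comm)
  show "op_plus A B \<in> d_alg g" if "A \<in> d_alg g" "B \<in> d_alg g" for A B :: "('r, 'n) yop"
    using that unfolding op_plus_def d_alg_def by (rule op_span_add)
  show "op_scale c A \<in> d_alg g" if "A \<in> d_alg g" for A :: "('r, 'n) yop" and c
    using that unfolding op_scale_def d_alg_def by (rule op_span_scale)
  show "(d_alg g :: ('r, 'n) yop set) \<noteq> {}"
    unfolding d_alg_def using op_span_zero by blast
  show "(cartan :: ('r, 'n) yop set) \<subseteq> d_alg g"
    unfolding cartan_def d_alg_def by (rule op_span_mono) auto
  show "(g_plus g :: ('r, 'n) yop set) \<subseteq> d_alg g"
    using g_plus_subset height_filt_subset_d_alg by blast
qed

lemma word_act_den:
  fixes h :: "('r::{finite,linorder}, 'n) yop"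
  assumes "h \<in> d_alg g" "h p = cst \<mu> * p"
  shows "word_act (prod_list (map (\<lambda>j. gen h + cst (c + of_nat j)) js)) p = cst (\<Prod>j\<leftarrow>js. \<mu> + c + of_nat j) * p"
proof -
  interpret operator_lie_algebra "d_alg g :: ('r, 'n) yop set" cartan "g_plus g" by (rule d_alg_lie_algebra)
  show ?thesis
  proof (induction js)
    case Nil
    show ?case using word_act_cst[of 1 p] by simp
  next
    case (Cons j js)
    let ?u = "prod_list (map (\<lambda>j. gen h + cst (c + of_nat j)) js)"
    have "word_act ((gen h + cst (c + of_nat j)) * ?u) p = word_act (gen h + cst (c + of_nat j)) (word_act ?u p)"
      using assms(1) by (intro word_act_mult[OF linear]) (auto intro!: free_algebra_closed)
    also have "\<dots> = cst (\<mu> + c + of_nat j) * (cst (\<Prod>j\<leftarrow>js. \<mu> + c + of_nat j) * p)"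
      unfolding Cons.IH word_act_add word_act_gen word_act_cst op_linear_scale[OF linear[OF assms(1)]] assms(2)
        add.assoc[of \<mu> c "of_nat j"] cst_plus[of \<mu>] distrib_right[of "cst \<mu>"]
      by (simp only: mult.left_commute)
    finally show ?case by (simp add: cst_mult_assoc)
  qed
qed

text \<open>Proved for every \<open>c\<close>, as \<open>right_cont_Inv\<close> demands.\<close>

lemma den_denominator:
  fixes \<beta> :: "'r::{finite,linorder} pos_root"
  assumes "\<beta> \<in> d_roots g"
  shows "operator_lie_algebra.den (coroot g \<beta>) c f \<in> denominators (d_alg g) cartan"
proof -
  interpret operator_lie_algebra "d_alg g :: ('r, 'n) yop set" cartan "g_plus g" by (rule d_alg_lie_algebra)
  let ?h = "coroot g \<beta> :: ('r, 'n) yop"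
  have h: "?h = cartan_elt (coweight \<beta>)" using assms by (rule coroot_eq)
  then have hC: "?h \<in> cartan" by (simp add: cartan_elt_in_cartan)
  obtain i where i: "coweight \<beta> i \<noteq> 0" using coweight_nonzero[OF assms] .
  \<comment> \<open>The excluded values are those at which one of the \<open>f\<close> factors of
    the denominator would act by zero.\<close>
  obtain p :: "('r, 'n) ypoly" and \<mu> where p: "p \<noteq> 0"
    "\<mu> \<notin> (\<lambda>j. - (c + of_nat j)) ` {1..<Suc f}" "cartan_elt (coweight \<beta>) p = cst \<mu> * p"
    using cartan_elt_eigenvector[of "coweight \<beta>" i "(\<lambda>j. - (c + of_nat j)) ` {1..<Suc f}", OF i] by blast
  let ?m = "\<Prod>j\<leftarrow>[1..<Suc f]. \<mu> + c + of_nat j"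
  have "word_act (den ?h c f) p = cst ?m * p"
    unfolding den_def using hC C_subset p(3) h by (intro word_act_den) auto
  moreover have "?m \<noteq> 0"
  proof -
    have "\<mu> + c + of_nat j \<noteq> 0" if "j \<in> {1..<Suc f}" for j
    proof
      assume "\<mu> + c + of_nat j = 0"
      then have "\<mu> = - (c + of_nat j)" by (simp only: eq_neg_iff_add_eq_0 add.assoc)
      then show False using p(2) that by blast
    qed
    then show ?thesis unfolding prod_list_zero_iff set_map set_upt by (metis imageE)
  qed
  ultimately have "word_act (den ?h c f) p \<noteq> 0"
    using p(1) cst_mult_cancel[OF p(1), of ?m 0] by simp
  then have "den ?h c f \<notin> env_ideal (d_alg g)" using env_ideal_act by blast
  moreover have "den ?h c f \<in> carrier (free_algebra cartan)"
    unfolding den_def using hC by (auto intro!: free_algebra_prod_list free_algebra_closed)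
  ultimately show ?thesis by (simp add: denominators_def)
qed

lemma proj_partial_sum_mult_seqs:
  fixes \<beta> :: "'r::{finite,linorder} pos_root"
  assumes \<beta>: "\<beta> \<in> d_roots g"
  shows "proj_partial_sum g \<beta> c \<in> operator_lie_algebra.mult_seqs (d_alg g) cartan (g_plus g :: ('r, 'n) yop set)"
proof -
  interpret operator_lie_algebra "d_alg g :: ('r, 'n) yop set" cartan "g_plus g" by (rule d_alg_lie_algebra)
  let ?h = "coroot g \<beta> :: ('r, 'n) yop" and ?e = "root_vec g \<beta> :: ('r, 'n) yop" and ?e' = "neg_root_vec g \<beta> :: ('r, 'n) yop"
  define t where "t f = cst ((- 1) ^ f / fact f) * gen (Inv (den ?h c f)) * ltr ?e' ^ f * ltr ?e ^ f" for f
  have sum: "proj_partial_sum g \<beta> c = (\<lambda>k. \<Sum>f<k. t f)"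
    by (simp add: proj_partial_sum_def t_def den_def fun_eq_iff)
  have h: "?h \<in> cartan" using coroot_eq[OF \<beta>] by (simp add: cartan_elt_in_cartan)
  have hL: "?h \<in> d_alg g" using h C_subset by blast
  have e: "?e \<in> g_plus g" using \<beta> unfolding g_plus_def by (intro op_span_base) simp
  have eL: "?e \<in> d_alg g" using e n_subset by blast
  have e'L: "?e' \<in> d_alg g" unfolding d_alg_def by (cases \<beta>) (auto intro!: op_span_base)
  note den = den_denominator[OF \<beta>]
  have wt: "op_comm X ?e = op_scale (root_val g \<beta> X) ?e" "op_comm X ?e' = op_scale (- root_val g \<beta> X) ?e'"
    if "X \<in> cartan" for X
    using that by (auto simp: cartan_eq root_val_eq[OF \<beta>] root_vec_weight neg_root_vec_weight)
  have Inv_cont: "right_cont (gen (Inv (den ?h c f)))" for f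
  proof (rule right_cont_Inv[OF hL den])
    show "g_plus g \<subseteq> op_span (root_vec g ` d_roots g :: ('r, 'n) yop set)" by (simp add: g_plus_def)
    then show "op_span (root_vec g ` d_roots g) \<subseteq> (d_alg g :: ('r, 'n) yop set)" using n_subset by (simp add: g_plus_def)
    show "root_vec g ` d_roots g \<subseteq> (g_plus g :: ('r, 'n) yop set)" unfolding g_plus_def by (auto intro: op_span_base)
    show "\<exists>a. op_comm ?h e = op_scale a e" if "e \<in> root_vec g ` d_roots g" for e
      using that coroot_eq[OF \<beta>] root_vec_weight by (auto 4 3)
  qed
  \<comment> \<open>The height filtration starts at level -2r, where it is all of
    \<open>d_alg g\<close>, and ends at 2r; so one instance serves raising and lowering root vectors
    alike.\<close>
  have ltr_cont: "right_cont (ltr X)" if "X \<in> d_alg g" for X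
  proof (rule right_cont_ltr)
    show "op_comm Y Z \<in> height_filt g (d + 1)" if "Y \<in> g_plus g" "Z \<in> height_filt g d" for Y Z :: "('r, 'n) yop" and d
      using height_filt_comm[of Y 1 Z d] that g_plus_subset by (auto simp: add.commute)
    show "height_filt g d \<subseteq> {\<lambda>p. 0 :: ('r, 'n) ypoly}" if "2 * int CARD('r) < d" for d
      using height_filt_vanish[OF that, of g] by simp
    show "X \<in> height_filt g (- 2 * int CARD('r))" using that by (simp only: height_filt_eq_d_alg)
  qed (rule height_filt_subset_d_alg)
  have cont: "right_cont (t f)" for f
    unfolding t_def by (intro right_cont_mult right_cont_cst Inv_cont right_cont_power ltr_cont eL e'L)
  have weight: "t f \<in> weight_space (d_alg g) cartan (\<lambda>_. 0)" for f
  proof -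
    have "ltr ?e' \<in> weight_space (d_alg g) cartan (\<lambda>X. - root_val g \<beta> X)"
      "ltr ?e \<in> weight_space (d_alg g) cartan (root_val g \<beta>)"
      by (intro weight_space_ltr eL e'L wt; assumption)+
    moreover have "gen (Inv (den ?h c f)) \<in> weight_space (d_alg g) cartan (\<lambda>_. 0)"
      by (intro weight_space_Inv h den op_comm_cartan_cartan)
    \<comment> \<open>The weights of the two f-th powers cancel; the zeros belong to the scalar and
      the inverse.\<close>
    ultimately have "t f \<in> weight_space (d_alg g) cartan
        (\<lambda>X. 0 + 0 + of_nat f * (- root_val g \<beta> X) + of_nat f * root_val g \<beta> X)"
      unfolding t_def by (intro weight_space_mult weight_space_cst weight_space_power)
    then show ?thesis by simp
  qed
  \<comment> \<open>The f-th summand ends in \<open>f\<close> positive root vectors, and this makes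
    the partial sums a Cauchy sequence.\<close>
  have "t f \<in> LP f" for f
  proof -
    have "cst ((- 1) ^ f / fact f) * gen (Inv (den ?h c f)) * ltr ?e' ^ f \<in> loc_carrier"
      by (intro loc_closed den e'L)
    moreover have "set (replicate f ?e) \<subseteq> g_plus g" using e by (auto simp: set_replicate_conv_if)
    ultimately have "cst ((- 1) ^ f / fact f) * gen (Inv (den ?h c f)) * ltr ?e' ^ f
        * prod_list (map ltr (replicate f ?e)) \<in> LP (length (replicate f ?e))"
      by (rule LP_prod)
    then show ?thesis by (simp add: t_def prod_list_replicate)
  qed
  then have tail: "t f \<in> LP m" if "m \<le> f" for f m using LP_antimono that by blast
  have cauchy: "(\<Sum>f<k. t f) - (\<Sum>f<l. t f) \<in> LP m" if "m \<le> k" "m \<le> l" for k l m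
  proof -
    have "(\<Sum>f<k. t f) = (\<Sum>f<m. t f) + (\<Sum>f=m..<k. t f)" if "m \<le> k" for k
      using that by (simp add: lessThan_atLeast0 sum.atLeastLessThan_concat)
    from this[OF that(1)] this[OF that(2)]
    have "(\<Sum>f<k. t f) - (\<Sum>f<l. t f) = (\<Sum>f=m..<k. t f) - (\<Sum>f=m..<l. t f)" by simp
    then show ?thesis by (auto intro!: LP_diff LP_sum tail)
  qed
  show ?thesis
    unfolding sum mult_seqs_def LP_cauchy_def
    using cauchy by (auto intro!: weight_space_sum weight right_cont_sum cont)
qed

lemma proj_d_factorisation:
  fixes ws :: "'r::{finite,linorder} pos_root list"
  assumes ws: "t_first_normal_ordering g ws"
  shows "proj_d g ws = proj_t g ws \<otimes>\<^bsub>taylor_d g\<^esub> proj_sl g (filter (\<lambda>\<beta>. \<beta> \<in> sl_roots) ws)"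
proof -
  interpret operator_lie_algebra "d_alg g :: ('r, 'n) yop set" cartan "g_plus g" by (rule d_alg_lie_algebra)
  define ts where "ts = filter (\<lambda>\<beta>. \<beta> \<in> t_roots g) ws"
  define ss where "ss = filter (\<lambda>\<beta>. \<beta> \<in> sl_roots) ws"
  let ?a = "\<lambda>\<beta>. proj_partial_sum g \<beta> (rho_shift g (d_roots g) \<beta>) :: nat \<Rightarrow> ('r, 'n) yop loc_letter free_alg"
  have split: "ws = ts @ ss" unfolding ts_def ss_def by (rule t_first_split[OF ws])
  have "set ws = d_roots g" using ws by (simp add: t_first_normal_ordering_def normal_ordering_def)
  then have factors: "?a \<beta> \<in> mult_seqs" if "\<beta> \<in> set ts \<union> set ss" for \<beta>
    using that by (intro proj_partial_sum_mult_seqs) (auto simp: split)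
  \<comment> \<open>With equal shifts on the roots of sl, all factors belong to the single family
    \<open>?a\<close>, to which the splitting of the product applies.\<close>
  have sl: "proj_sl g ss = ordered_proj_prod g (rho_shift g (d_roots g)) ss"
    unfolding proj_sl_def ordered_proj_prod_def
    by (intro foldr_cong refl) (simp add: ss_def rho_shift_sl)
  show ?thesis
    unfolding proj_d_def proj_t_def ts_def[symmetric] ss_def[symmetric] sl
    unfolding split ordered_proj_prod_def proj_factor_def taylor_d_def
    by (rule coset_prod_append[of ts ss ?a, OF factors])
qed

end

theorem lemma4p6:
  fixes g :: "complex^'n^'n"
  assumes "invertible g"
    and "transpose g = g \<or> transpose g = - g"
  shows "(\<exists>ws :: 'r::{finite,linorder} pos_root list. t_first_normal_ordering g ws) \<and>
    (\<forall>ws :: 'r pos_root list. t_first_normal_ordering g ws \<longrightarrow>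
       normal_ordering g sl_roots (filter (\<lambda>\<beta>. \<beta> \<in> sl_roots) ws) \<and>
       proj_d g ws =
         proj_t g ws \<otimes>\<^bsub>taylor_d g\<^esub> proj_sl g (filter (\<lambda>\<beta>. \<beta> \<in> sl_roots) ws))"
proof -
  define \<epsilon> :: complex where "\<epsilon> = (if transpose g = g then 1 else - 1)"
  have transpose: "transpose g $ a $ b = \<epsilon> * g $ a $ b" for a b
    using assms(2) by (auto simp: \<epsilon>_def)
  interpret nondegenerate_form g \<epsilon>
  proof
    show "g $ b $ a = \<epsilon> * g $ a $ b" for a b
      using transpose[of a b] by (simp only: transpose_def vec_lambda_beta)
  qed (use assms(1) in \<open>auto simp: \<epsilon>_def\<close>)
  show ?thesis
    using t_first_normal_ordering_exists normal_ordering_sl proj_d_factorisation by blast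
qed

end
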